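(* Let $T:I\to I$ be a proper one-dimensional Iwasawa continued fraction map satisfying Condition $( * )$ (in particular, $T$ may be the Rosen map $T_q$ on $I=I_q$ for any integer $q\ge3$), and let $\mu=f_1m$ be its invariant probability measure. Let $f\in BV(I)$ be real-valued and suppose that $f$ does not satisfy Condition (H), i.e. there is no $u\in L^2(\mu)$ with $f=u-u\circ T+\int_I f\,d\mu$ ($\mu$-a.e.). Then there exists $\sigma>0$ such that for all $v\in\mathbb R$, $$\lim_{N\to\infty}\mu\left[\frac{S_Nf-N\int_I f\,d\mu}{\sigma\sqrt N}\le v\right]=\frac1{\sqrt{2\pi}}\int_{-\infty}^v e^{-t^2/2}\,dt,$$ where $S_Nf=\sum_{k=0}^{N-1}f\circ T^k$.
   Context: Setting: $I=[a,b]$ is a compact nondegenerate interval and $m$ is Lebesgue measure. A (one-dimensional) Iwasawa continued fraction map is a map $T:I\to I$ for which $I$ admits a countable partition (up to common endpoints, and up to the point $0$ where the value of $T$ is irrelevant) into nondegenerate subintervals such that on each of them $T(x)=\iota(x)+\text{const}$, where $\iota$ is one fixed function among $1/x,\,-1/x,\,|1/x|,\,-|1/x|$; hence $|T'(x)|=1/x^2$. It is required that the image under $T$ of each partition interval be all of $I$, except possibly for the leftmost and rightmost partition intervals, whose images must still be intervals sharing an endpoint with $I$. $T$ is proper if $\max\{|a|,|b|\}<1$. Condition $( * )$: for any (nondegenerate) subintervals $J,K$ of $I$ there exists $N\ge 0$ such that $m(T^N(J)\cap T^N(K))>0$. Invariant measure: $\mu=f_1m$ is the $T$-invariant probability measure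 absolutely continuous with respect to $m$, with density $f_1$ of bounded variation. $BV(I)\subset L^1(I)$ is the space of (classes of) functions of bounded variation on $I$. Rosen map: for an integer $q\ge3$, $\lambda_q=2\cos(\pi/q)$, $I_q=[-\lambda_q/2,\lambda_q/2]$, and $T_q(x)=\left|\frac1x\right|-\lambda_q\left\lfloor\left|\frac{1}{\lambda_q x}\right|+\frac12\right\rfloor$ for $x\neq0$, $T_q(0)=0$. *)

theory Defs
  imports "HOL-Probability.Probability"
begin

definition subinterval :: "real set \<Rightarrow> real \<Rightarrow> real \<Rightarrow> bool" where
  "subinterval J a b \<longleftrightarrow> is_interval J \<and> interior J \<noteq> {} \<and> J \<subseteq> {a..b}"

definition leftmost :: "real set set \<Rightarrow> real set \<Rightarrow> bool" where
  "leftmost P J \<longleftrightarrow> J \<in> P \<and> (\<forall>K\<in>P. K \<noteq> J \<longrightarrow> (\<forall>x\<in>interior J. \<forall>y\<in>interior K. x < y))"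

definition rightmost :: "real set set \<Rightarrow> real set \<Rightarrow> bool" where
  "rightmost P J \<longleftrightarrow> J \<in> P \<and> (\<forall>K\<in>P. K \<noteq> J \<longrightarrow> (\<forall>x\<in>interior J. \<forall>y\<in>interior K. y < x))"

text \<open>
  Members of the partition are intervals of any kind (open, closed or half-open) and are only
  required to be disjoint up to common endpoints. Accordingly the branch formula is imposed on the
  interior of each member, and images are compared with the whole interval up to endpoints,
  that is, after taking closures. The leftmost and rightmost members need not exist, since the
  partition may accumulate at an endpoint of the interval that equals 0.
\<close>

definition iwasawa_partition ::
  "real \<Rightarrow> real \<Rightarrow> (real \<Rightarrow> real) \<Rightarrow> (real \<Rightarrow> real) \<Rightarrow> real set set \<Rightarrow> bool" where
  "iwasawa_partition a b T \<iota> P \<longleftrightarrow>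
     countable P \<and>
     (\<forall>J\<in>P. subinterval J a b) \<and>
     (\<forall>J\<in>P. \<forall>K\<in>P. J \<noteq> K \<longrightarrow> interior J \<inter> interior K = {}) \<and>
     {a..b} - {0} \<subseteq> \<Union>P \<and>
     (\<forall>J\<in>P. \<exists>c. \<forall>x\<in>interior J. T x = \<iota> x + c) \<and>
     (\<forall>J\<in>P. closure (T ` interior J) = {a..b} \<or>
        ((leftmost P J \<or> rightmost P J) \<and> is_interval (T ` interior J) \<and>
         (a \<in> closure (T ` interior J) \<or> b \<in> closure (T ` interior J))))"

definition iwasawa_map :: "real \<Rightarrow> real \<Rightarrow> (real \<Rightarrow> real) \<Rightarrow> bool" where
  "iwasawa_map a b T \<longleftrightarrow>
     a < b \<and> T \<in> {a..b} \<rightarrow> {a..b} \<and>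
     (\<exists>\<iota> \<in> {\<lambda>x. 1 / x, \<lambda>x. - (1 / x), \<lambda>x. \<bar>1 / x\<bar>, \<lambda>x. - \<bar>1 / x\<bar>}.
        \<exists>P. iwasawa_partition a b T \<iota> P)"

definition proper_iwasawa_map :: "real \<Rightarrow> real \<Rightarrow> (real \<Rightarrow> real) \<Rightarrow> bool" where
  "proper_iwasawa_map a b T \<longleftrightarrow> iwasawa_map a b T \<and> max \<bar>a\<bar> \<bar>b\<bar> < 1"

definition condition_star :: "real \<Rightarrow> real \<Rightarrow> (real \<Rightarrow> real) \<Rightarrow> bool" where
  "condition_star a b T \<longleftrightarrow>
     (\<forall>J K. subinterval J a b \<and> subinterval K a b \<longrightarrow>
        (\<exists>N. emeasure lebesgue ((T ^^ N) ` J \<inter> (T ^^ N) ` K) > 0))"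

definition bounded_variation :: "real \<Rightarrow> real \<Rightarrow> (real \<Rightarrow> real) \<Rightarrow> bool" where
  "bounded_variation a b f \<longleftrightarrow>
     (\<exists>C. \<forall>n. \<forall>x :: nat \<Rightarrow> real. mono_on {..n} x \<and> x ` {..n} \<subseteq> {a..b} \<longrightarrow>
        (\<Sum>i<n. \<bar>f (x (Suc i)) - f (x i)\<bar>) \<le> C)"

text \<open>
  The functions whose class in \<open>L\<^sup>1\<close> lies in \<open>BV\<close>. Such a function is automatically
  Lebesgue measurable on the interval, because \<open>lebesgue_on {a..b}\<close> is complete.
\<close>

definition BV :: "real \<Rightarrow> real \<Rightarrow> (real \<Rightarrow> real) set" where
  "BV a b = {f. \<exists>g. bounded_variation a b g \<and> (AE x in lebesgue_on {a..b}. f x = g x)}"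

definition invariant_measure :: "'a measure \<Rightarrow> ('a \<Rightarrow> 'a) \<Rightarrow> bool" where
  "invariant_measure M T \<longleftrightarrow> T \<in> measurable M M \<and> distr M M T = M"

definition bv_invariant_density :: "real \<Rightarrow> real \<Rightarrow> (real \<Rightarrow> real) \<Rightarrow> (real \<Rightarrow> real) \<Rightarrow> bool" where
  "bv_invariant_density a b T f1 \<longleftrightarrow>
     (\<forall>x\<in>{a..b}. 0 \<le> f1 x) \<and> bounded_variation a b f1 \<and>
     prob_space (density (lebesgue_on {a..b}) f1) \<and>
     invariant_measure (density (lebesgue_on {a..b}) f1) T"

definition condition_H :: "'a measure \<Rightarrow> ('a \<Rightarrow> 'a) \<Rightarrow> ('a \<Rightarrow> real) \<Rightarrow> bool" where
  "condition_H M T f \<longleftrightarrow>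
     (\<exists>u :: 'a \<Rightarrow> real. u \<in> borel_measurable M \<and> integrable M (\<lambda>x. (u x)\<^sup>2) \<and>
        (AE x in M. f x = u x - u (T x) + (LINT y|M. f y)))"

definition birkhoff_sum :: "('a \<Rightarrow> 'a) \<Rightarrow> ('a \<Rightarrow> real) \<Rightarrow> nat \<Rightarrow> 'a \<Rightarrow> real" where
  "birkhoff_sum T f N x = (\<Sum>k<N. f ((T ^^ k) x))"

definition rosen_lambda :: "nat \<Rightarrow> real" where
  "rosen_lambda q = 2 * cos (pi / real q)"

definition rosen_map :: "nat \<Rightarrow> real \<Rightarrow> real" where
  "rosen_map q x =
     (if x = 0 then 0
      else \<bar>1 / x\<bar> - rosen_lambda q * of_int \<lfloor>\<bar>1 / (rosen_lambda q * x)\<bar> + 1 / 2\<rfloor>)"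

end

theory Submission
  imports Defs
begin

text \<open>
  Let \<open>L\<close> be the transfer operator of \<open>T\<close> with respect to Lebesgue measure. Splitting off the branches
  close to \<open>0\<close>, which contribute an operator of small norm, one obtains a Lasota--Yorke inequality for an
  iterate of \<open>L\<close> on functions of bounded variation. By Helly's theorem, failure of uniform decay on
  functions of integral \<open>0\<close> would yield a nonzero \<open>g\<close> of bounded variation and integral \<open>0\<close> such that all
  \<open>L\<^sup>n g\<close> have the same \<open>L\<^sup>1\<close> norm. Then the images of the positive and the negative part of \<open>g\<close> never
  overlap, which contradicts \<open>condition_star\<close>. Hence \<open>L\<^sup>n\<close> decays exponentially on functions of integral \<open>0\<close>.

  For the limit theorem, let \<open>f\<close> be centred and let \<open>p\<close> be the invariant density. Solving two Poisson
  equations gives \<open>G\<close> and \<open>H\<close> such that \<open>p + itG - t\<^sup>2H\<close> is an eigenfunction of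
  \<open>h \<mapsto> L (e\<^bsup>itf\<^esup> h)\<close> up to \<open>O(t\<^sup>3)\<close>, with eigenvalue \<open>1 - \<sigma>\<^sup>2t\<^sup>2/2\<close>. Taking \<open>t\<close> of order
  \<open>1/\<surd>N\<close>, the characteristic function of the normalised Birkhoff sum converges to that of the
  normal distribution. If \<open>\<sigma> = 0\<close>, then \<open>f\<close> is the coboundary of \<open>- G/p\<close>, which lies in \<open>L\<^sup>2\<close>.

  For a Rosen map, the orbit of the left endpoint follows a rotation of order \<open>q\<close> and hits \<open>0\<close>. Every
  interval expands until it meets an endpoint of a branch, from there reaches a one-sided neighbourhood
  of the left endpoint, then of \<open>0\<close>, and is finally mapped onto the whole interval.
\<close>

section \<open>Functions of bounded variation\<close>

text \<open>Cutting a function to one branch costs a fixed factor in variation, which a contraction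
  by \<open>\<rho>\<^sup>2\<close> need not beat, and there may be infinitely many branches. Two
  facts help. On a branch whose image covers half of the interval, \<open>x\<^sup>2\<close> is at
  most a constant times the length of the branch, so the bounds \<open>\<theta> i\<close> are
  summable and the tail operator is small. For the remaining finitely many branches, a single cut
  per cylinder of length \<open>n\<close> costs a constant independent of \<open>n\<close>, against
  a contraction by \<open>\<rho> ^ (2 * n)\<close>. Preservation of the L1 norm of \<open>g\<close>
  forces \<open>L^n |g| = |L^n g|\<close> almost everywhere; this fails wherever the images of the
  positive and the negative part meet. The density \<open>p\<close> may vanish, so
  \<open>G / p\<close> need not be bounded. Positivity gives \<open>|L^n (f p)| \<le> F p\<close>
  and the decay gives \<open>|L^n (f p)| \<le> K r^n\<close>. The product of the two bounds makes
  the terms of the series for \<open>G / p\<close> geometrically small in L2 with weight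
  \<open>p\<close>.\<close>

definition dominates :: "(real \<Rightarrow> real) \<Rightarrow> (real \<Rightarrow> real) \<Rightarrow> bool" where
  "dominates v h \<longleftrightarrow> (\<forall>x y. x \<le> y \<longrightarrow> \<bar>h y - h x\<bar> \<le> v y - v x)"

text \<open>
  Instead of sums over partitions, the total variation is controlled by a function \<open>v\<close> with values in
  \<open>{0..C}\<close> whose increments dominate those of \<open>h\<close>. It is taken over the whole line, so that jumps of
  \<open>h\<close> at the endpoints \<open>a\<close> and \<open>b\<close> count.
\<close>

definition bv :: "real \<Rightarrow> real \<Rightarrow> real \<Rightarrow> (real \<Rightarrow> real) \<Rightarrow> bool" where
  "bv a b C h \<longleftrightarrow> (\<forall>x. x \<notin> {a..b} \<longrightarrow> h x = 0) \<and>
     (\<exists>v. (\<forall>x. 0 \<le> v x \<and> v x \<le> C) \<and> dominates v h)"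

lemma dominatesD: "dominates v h \<Longrightarrow> x \<le> y \<Longrightarrow> \<bar>h y - h x\<bar> \<le> v y - v x"
  by (simp add: dominates_def)

lemma dominates_mono: "dominates v h \<Longrightarrow> x \<le> y \<Longrightarrow> v x \<le> v y"
  using dominatesD[of v h x y] by simp

lemma bvI:
  assumes "\<And>x. x \<notin> {a..b} \<Longrightarrow> h x = 0" "\<And>x. 0 \<le> v x" "\<And>x. v x \<le> C"
    "\<And>x y. x < y \<Longrightarrow> \<bar>h y - h x\<bar> \<le> v y - v x"
  shows "bv a b C h"
  unfolding bv_def dominates_def
proof (intro conjI exI[of _ v] allI impI)
  fix x y :: real assume "x \<le> y"
  thus "\<bar>h y - h x\<bar> \<le> v y - v x" using assms(4)[of x y] by (cases "x = y") auto
qed (use assms in auto)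

text \<open>\<open>h\<close> vanishes outside \<open>{a..b}\<close>: comparison of \<open>x\<close>
  with a point left of \<open>a\<close> gives the bound by \<open>v x\<close>, with a point right of
  \<open>b\<close> the bound by \<open>C - v x\<close>. The two bounds pay for the jumps created by
  weights and by extension with 0.\<close>

lemma bvE:
  assumes "bv a b C h"
  obtains v where "\<And>x. 0 \<le> v x" "\<And>x. v x \<le> C" "dominates v h"
    "\<And>x. \<bar>h x\<bar> \<le> v x" "\<And>x. \<bar>h x\<bar> \<le> C - v x"
proof -
  from assms obtain v where v: "\<And>x. 0 \<le> v x" "\<And>x. v x \<le> C" "dominates v h"
    and h: "\<And>x. x \<notin> {a..b} \<Longrightarrow> h x = 0" unfolding bv_def by blast
  show ?thesis
  proof (rule that[OF v])
    fix x
    show "\<bar>h x\<bar> \<le> v x"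
      using dominatesD[OF v(3), of "min x (a - 1)" x] v(1)[of "min x (a - 1)"] h[of "min x (a - 1)"]
      by simp
    show "\<bar>h x\<bar> \<le> C - v x"
      using dominatesD[OF v(3), of x "max x (b + 1)"] v(2)[of "max x (b + 1)"] h[of "max x (b + 1)"]
      by simp
  qed
qed

lemma bv_zero_outside: "bv a b C h \<Longrightarrow> x \<notin> {a..b} \<Longrightarrow> h x = 0"
  by (simp add: bv_def)

lemma bv_nonneg: "bv a b C h \<Longrightarrow> 0 \<le> C"
  unfolding bv_def by (meson order_trans)

lemma bv_abs_le: "bv a b C h \<Longrightarrow> \<bar>h x\<bar> \<le> C"
  by (erule bvE) (metis order_trans)

lemma bv_mono: "bv a b C h \<Longrightarrow> C \<le> D \<Longrightarrow> bv a b D h"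
  unfolding bv_def by (meson order_trans)

lemma bv_zero: "bv a b 0 (\<lambda>x. 0)"
  by (rule bvI[where v = "\<lambda>x. 0"]) auto

lemma bv_add:
  assumes "bv a b C g" "bv a b D h"
  shows "bv a b (C + D) (\<lambda>x. g x + h x)"
proof -
  obtain v where v: "\<And>x. 0 \<le> v x" "\<And>x. v x \<le> C" "dominates v g" using assms(1) by (rule bvE) blast
  obtain w where w: "\<And>x. 0 \<le> w x" "\<And>x. w x \<le> D" "dominates w h" using assms(2) by (rule bvE) blast
  show ?thesis
  proof (rule bvI[where v = "\<lambda>x. v x + w x"])
    fix x y :: real assume "x < y"
    thus "\<bar>g y + h y - (g x + h x)\<bar> \<le> v y + w y - (v x + w x)"
      using dominatesD[OF v(3), of x y] dominatesD[OF w(3), of x y] by simp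
  qed (use v w assms in \<open>auto simp: add_mono bv_zero_outside\<close>)
qed

lemma bv_scale:
  assumes "bv a b C h" shows "bv a b (\<bar>k\<bar> * C) (\<lambda>x. k * h x)"
proof -
  obtain v where v: "\<And>x. 0 \<le> v x" "\<And>x. v x \<le> C" "dominates v h" using assms by (rule bvE) blast
  show ?thesis
  proof (rule bvI[where v = "\<lambda>x. \<bar>k\<bar> * v x"])
    fix x y :: real assume "x < y"
    hence "\<bar>k\<bar> * \<bar>h y - h x\<bar> \<le> \<bar>k\<bar> * (v y - v x)"
      using dominatesD[OF v(3), of x y] by (intro mult_left_mono) auto
    thus "\<bar>k * h y - k * h x\<bar> \<le> \<bar>k\<bar> * v y - \<bar>k\<bar> * v x"
      by (simp add: abs_mult[symmetric] right_diff_distrib)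
  qed (use v assms in \<open>auto simp: bv_zero_outside mult_left_mono\<close>)
qed

lemma bv_minus: "bv a b C h \<Longrightarrow> bv a b C (\<lambda>x. - h x)"
  using bv_scale[of a b C h "-1"] by simp

lemma bv_diff: "bv a b C g \<Longrightarrow> bv a b D h \<Longrightarrow> bv a b (C + D) (\<lambda>x. g x - h x)"
  using bv_add[of a b C g D "\<lambda>x. - h x"] bv_minus[of a b D h] by simp

lemma bv_sum:
  assumes "finite I" "\<And>i. i \<in> I \<Longrightarrow> bv a b (C i) (h i)"
  shows "bv a b (\<Sum>i\<in>I. C i) (\<lambda>x. \<Sum>i\<in>I. h i x)"
  using assms
proof (induction I rule: finite_induct)
  case (insert i I)
  show ?case using insert.hyps bv_add[OF insert.prems[of i] insert.IH] insert.prems by simp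
qed (simp add: bv_zero)

lemma bv_abs:
  assumes "bv a b C h" shows "bv a b C (\<lambda>x. \<bar>h x\<bar>)"
proof -
  obtain v where v: "\<And>x. 0 \<le> v x" "\<And>x. v x \<le> C" "dominates v h" using assms by (rule bvE) blast
  show ?thesis
  proof (rule bvI[where v = v])
    fix x y :: real assume "x < y"
    thus "\<bar>\<bar>h y\<bar> - \<bar>h x\<bar>\<bar> \<le> v y - v x"
      using dominatesD[OF v(3), of x y] by simp
  qed (use v assms in \<open>auto simp: bv_zero_outside\<close>)
qed

lemma bv_mult:
  assumes "bv a b C g" "bv a b D h"
  shows "bv a b (2 * C * D) (\<lambda>x. g x * h x)"
proof -
  obtain v where v: "\<And>x. 0 \<le> v x" "\<And>x. v x \<le> C" "dominates v g" using assms(1) by (rule bvE) blast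
  obtain w where w: "\<And>x. 0 \<le> w x" "\<And>x. w x \<le> D" "dominates w h" using assms(2) by (rule bvE) blast
  have C: "0 \<le> C" and D: "0 \<le> D" using assms by (auto intro: bv_nonneg)
  show ?thesis
  proof (rule bvI[where v = "\<lambda>x. D * v x + C * w x"])
    fix x y :: real assume xy: "x < y"
    have "\<bar>g y * h y - g x * h x\<bar> = \<bar>(g y - g x) * h y + g x * (h y - h x)\<bar>"
      by (simp add: algebra_simps)
    also have "\<dots> \<le> \<bar>g y - g x\<bar> * \<bar>h y\<bar> + \<bar>g x\<bar> * \<bar>h y - h x\<bar>"
      by (metis abs_mult abs_triangle_ineq)
    also have "\<dots> \<le> (v y - v x) * D + C * (w y - w x)"
      using xy dominatesD[OF v(3), of x y] dominatesD[OF w(3), of x y] assms C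
      by (intro add_mono mult_mono) (auto intro: bv_abs_le)
    finally show "\<bar>g y * h y - g x * h x\<bar> \<le> D * v y + C * w y - (D * v x + C * w x)"
      by (simp add: algebra_simps)
  next
    fix x have "D * v x + C * w x \<le> D * C + C * D"
      using v w C D by (intro add_mono mult_left_mono) auto
    thus "D * v x + C * w x \<le> 2 * C * D" by simp
  qed (use v w assms C D in \<open>auto simp: bv_zero_outside\<close>)
qed

lemma bv_suminf:
  assumes "\<And>i. bv a b (C i) (h i)" "summable C"
  shows "bv a b (\<Sum>i. C i) (\<lambda>x. \<Sum>i. h i x)"
proof -
  have "\<exists>v. (\<forall>x. 0 \<le> v x \<and> v x \<le> C i) \<and> dominates v (h i)" for i
    using assms(1)[of i] by (simp add: bv_def)
  then obtain v where v: "\<And>i x. 0 \<le> v i x" "\<And>i x. v i x \<le> C i" "\<And>i. dominates (v i) (h i)"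
    by metis
  have sv: "summable (\<lambda>i. v i x)" for x
    by (rule summable_comparison_test'[OF assms(2)]) (use v in auto)
  have sh: "summable (\<lambda>i. h i x)" for x
    by (rule summable_comparison_test'[OF assms(2)]) (use bv_abs_le[OF assms(1)] in auto)
  show ?thesis
  proof (rule bvI[where v = "\<lambda>x. \<Sum>i. v i x"])
    fix x y :: real assume xy: "x < y"
    have "\<bar>(\<Sum>i. h i y) - (\<Sum>i. h i x)\<bar> = \<bar>\<Sum>i. h i y - h i x\<bar>"
      by (subst suminf_diff[OF sh sh]) simp
    also have "\<dots> \<le> (\<Sum>i. \<bar>h i y - h i x\<bar>)"
      by (rule summable_rabs)
        (rule summable_comparison_test'[OF summable_diff[OF sv[of y] sv[of x]]],
          use dominatesD[OF v(3)] xy in auto)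
    also have "\<dots> \<le> (\<Sum>i. v i y - v i x)"
      by (rule suminf_le)
        (use dominatesD[OF v(3)] xy sv in
          \<open>auto intro: summable_diff summable_comparison_test'[OF summable_diff[OF sv[of y] sv[of x]]]\<close>)
    also have "\<dots> = (\<Sum>i. v i y) - (\<Sum>i. v i x)"
      by (rule suminf_diff[symmetric, OF sv sv])
    finally show "\<bar>(\<Sum>i. h i y) - (\<Sum>i. h i x)\<bar> \<le> (\<Sum>i. v i y) - (\<Sum>i. v i x)" .
  next
    fix x assume "x \<notin> {a..b}"
    thus "(\<Sum>i. h i x) = 0" using bv_zero_outside[OF assms(1)] by simp
  qed (use v sv assms(2) in \<open>auto intro: suminf_nonneg suminf_le\<close>)
qed

text \<open>Jordan decomposition: \<open>h\<close> is the difference of the monotone functions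
  \<open>v\<close> and \<open>v - h\<close>.\<close>

lemma bv_borel:
  assumes "bv a b C h" shows "h \<in> borel_measurable borel"
proof -
  obtain v where v: "dominates v h" using assms by (rule bvE) blast
  have "mono v" using dominates_mono[OF v] by (auto simp: mono_def)
  moreover have "mono (\<lambda>x. v x - h x)"
  proof (rule monoI)
    fix x y :: real assume "x \<le> y"
    thus "v x - h x \<le> v y - h y" using dominatesD[OF v, of x y] by linarith
  qed
  ultimately have "(\<lambda>x. v x - (v x - h x)) \<in> borel_measurable borel"
    by (intro borel_measurable_diff borel_measurable_mono)
  thus ?thesis by simp
qed

lemma integrable_bounded_on_interval:
  fixes h :: "real \<Rightarrow> real"
  assumes "h \<in> borel_measurable borel" "\<And>x. x \<notin> {a..b} \<Longrightarrow> h x = 0" "\<And>x. \<bar>h x\<bar> \<le> C"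
  shows "integrable lborel h"
proof (rule Bochner_Integration.integrable_bound[where f = "\<lambda>x. C * indicator {a..b} x"])
  show "integrable lborel (\<lambda>x. C * indicator {a..b} x :: real)"
    by (intro integrable_mult_right integrable_real_indicator) (auto simp: emeasure_lborel_Icc_eq)
  show "AE x in lborel. norm (h x) \<le> norm (C * indicator {a..b} x :: real)"
    using assms(2) order_trans[OF abs_ge_zero assms(3)] assms(3)
    by (auto split: split_indicator)
qed (use assms in auto)

lemma bv_integrable: "bv a b C h \<Longrightarrow> integrable lborel h"
  by (rule integrable_bounded_on_interval[where a=a and b=b and C=C])
    (auto intro: bv_borel bv_abs_le bv_zero_outside)

lemma integral_abs_le_interval:
  fixes h :: "real \<Rightarrow> real"
  assumes "a \<le> b" "h \<in> borel_measurable borel" "\<And>x. x \<notin> {a..b} \<Longrightarrow> h x = 0" "\<And>x. \<bar>h x\<bar> \<le> C"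
  shows "(LINT x|lborel. \<bar>h x\<bar>) \<le> C * (b - a)"
proof -
  have "(LINT x|lborel. \<bar>h x\<bar>) \<le> (LINT x|lborel. C * indicator {a..b} x)"
  proof (rule integral_mono)
    show "integrable lborel (\<lambda>x. C * indicator {a..b} x :: real)"
      by (intro integrable_mult_right integrable_real_indicator) (auto simp: emeasure_lborel_Icc_eq)
    show "integrable lborel (\<lambda>x. \<bar>h x\<bar>)"
      by (rule integrable_bounded_on_interval[where a=a and b=b and C=C]) (use assms in auto)
  qed (use assms in \<open>auto split: split_indicator\<close>)
  thus ?thesis using assms(1) by simp
qed

text \<open>Monotonicity of the weight saves the factor 2 of \<open>bv_mult\<close>. In the product
  rule an increment of \<open>W\<close> meets a value of \<open>\<bar>h\<bar>\<close>, which is at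
  most \<open>v\<close> and at most \<open>C - v\<close>; so \<open>W * v\<close> dominates for
  increasing \<open>W\<close>, and \<open>\<theta> * C - W * (C - v)\<close> for decreasing
  \<open>W\<close>.\<close>

lemma bv_weight:
  assumes h: "bv a b C h" and W: "mono W \<or> antimono W" "\<And>x. 0 \<le> W x" "\<And>x. W x \<le> \<theta>"
  shows "bv a b (\<theta> * C) (\<lambda>x. W x * h x)"
proof -
  obtain v where v: "\<And>x. 0 \<le> v x" "\<And>x. v x \<le> C" "dominates v h"
    "\<And>x. \<bar>h x\<bar> \<le> v x" "\<And>x. \<bar>h x\<bar> \<le> C - v x" using h by (rule bvE) blast
  have C: "0 \<le> C" using h by (rule bv_nonneg)
  have th: "0 \<le> \<theta>" using W(2,3) order_trans by blast
  from W(1) show ?thesis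
  proof
    assume m: "mono W"
    show ?thesis
    proof (rule bvI[where v = "\<lambda>x. W x * v x"])
      fix x y :: real assume xy: "x < y"
      have "\<bar>W y * h y - W x * h x\<bar> = \<bar>W y * (h y - h x) + (W y - W x) * h x\<bar>"
        by (simp add: algebra_simps)
      also have "\<dots> \<le> W y * \<bar>h y - h x\<bar> + (W y - W x) * \<bar>h x\<bar>"
        using monoD[OF m less_imp_le[OF xy]] W(2)[of y] 
        by (intro order_trans[OF abs_triangle_ineq]) (simp add: abs_mult)
      also have "\<dots> \<le> W y * (v y - v x) + (W y - W x) * v x"
        using dominatesD[OF v(3), of x y] v(4) monoD[OF m less_imp_le[OF xy]] W(2) xy
        by (intro add_mono mult_left_mono) auto
      finally show "\<bar>W y * h y - W x * h x\<bar> \<le> W y * v y - W x * v x"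
        by (simp add: algebra_simps)
    qed (use v W th in \<open>auto simp: bv_zero_outside[OF h] intro: mult_mono\<close>)
  next
    assume m: "antimono W"
    show ?thesis
    proof (rule bvI[where v = "\<lambda>x. \<theta> * C - W x * (C - v x)"])
      fix x y :: real assume xy: "x < y"
      have "\<bar>W y * h y - W x * h x\<bar> = \<bar>W x * (h y - h x) + (W y - W x) * h y\<bar>"
        by (simp add: algebra_simps)
      also have "\<dots> \<le> W x * \<bar>h y - h x\<bar> + (W x - W y) * \<bar>h y\<bar>"
        using antimonoD[OF m less_imp_le[OF xy]] W(2)[of x] 
        by (intro order_trans[OF abs_triangle_ineq]) (simp add: abs_mult)
      also have "\<dots> \<le> W x * (v y - v x) + (W x - W y) * (C - v y)"
        using dominatesD[OF v(3), of x y] v(5) antimonoD[OF m less_imp_le[OF xy]] W(2) xy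
        by (intro add_mono mult_left_mono) auto
      finally show "\<bar>W y * h y - W x * h x\<bar> \<le> \<theta> * C - W y * (C - v y) - (\<theta> * C - W x * (C - v x))"
        by (simp add: algebra_simps)
    next
      fix x have "W x * (C - v x) \<le> \<theta> * C" 
        using v(1)[of x] v(2)[of x] W(2)[of x] W(3)[of x] th by (intro mult_mono) auto
      thus "0 \<le> \<theta> * C - W x * (C - v x)" by simp
      show "\<theta> * C - W x * (C - v x) \<le> \<theta> * C" using v(2)[of x] W(2)[of x] by simp
    qed (use h in \<open>auto simp: bv_zero_outside\<close>)
  qed
qed

text \<open>Composition with a monotone map does not increase the variation. The extension by 0 adds
  a jump at each end of \<open>B\<close>; the new dominating function is 0 to the left of
  \<open>B\<close> and \<open>C\<close> to the right, and \<open>\<bar>h\<bar>\<close> is bounded by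
  both \<open>v\<close> and \<open>C - v\<close>, so the constant stays \<open>C\<close>.\<close>

lemma bv_reparam:
  assumes h: "bv a b C h" and B: "is_interval B" "B \<subseteq> {a..b}"
    and m: "mono_on B \<psi> \<or> antimono_on B \<psi>"
  shows "bv a b C (\<lambda>y. if y \<in> B then h (\<psi> y) else 0)"
proof -
  obtain v where v: "\<And>x. 0 \<le> v x" "\<And>x. v x \<le> C" "dominates v h"
    "\<And>x. \<bar>h x\<bar> \<le> v x" "\<And>x. \<bar>h x\<bar> \<le> C - v x" using h by (rule bvE) blast
  have C: "0 \<le> C" using h by (rule bv_nonneg)
  have Bmid: "y \<in> B" if "x \<in> B" "z \<in> B" "x \<le> y" "y \<le> z" for x y z
    using B(1) that unfolding is_interval_1 by blast
  \<comment> \<open>\<open>up y\<close> says that \<open>y\<close> lies to the right of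
    \<open>B\<close>.\<close>
  define up where "up y \<longleftrightarrow> (\<forall>z\<in>B. z < y)" for y
  have low: "y < z" if "y \<notin> B" "\<not> up y" "z \<in> B" for y z
    using that Bmid unfolding up_def by (meson not_less order.trans linear)
  have upm: "up y" if "up x" "x \<le> y" for x y using that unfolding up_def by fastforce
  have upB: "\<not> up y" if "y \<in> B" for y using that unfolding up_def by auto
  from m show ?thesis
  proof
    assume m: "mono_on B \<psi>"
    define w where "w y = (if y \<in> B then v (\<psi> y) else if up y then C else 0)" for y
    show ?thesis
    proof (rule bvI[where v = w])
      fix x y :: real assume xy: "x < y"
      consider "x \<in> B" "y \<in> B" | "x \<in> B" "y \<notin> B" "up y" | "x \<notin> B" "\<not> up x" "y \<in> B"
        | "x \<notin> B" "y \<notin> B" "up x" "up y" | "x \<notin> B" "y \<notin> B" "\<not> up x"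
        using low upm xy upB by (meson less_imp_le not_less)
      thus "\<bar>(if y \<in> B then h (\<psi> y) else 0) - (if x \<in> B then h (\<psi> x) else 0)\<bar> \<le> w y - w x"
      proof cases
        case 1
        hence "\<psi> x \<le> \<psi> y" using m xy by (auto simp: mono_on_def)
        thus ?thesis using dominatesD[OF v(3), of "\<psi> x" "\<psi> y"] 1 by (simp add: w_def)
      qed (use v C in \<open>auto simp: w_def\<close>)
    qed (use v C B in \<open>auto simp: w_def\<close>)
  next
    assume m: "antimono_on B \<psi>"
    define w where "w y = (if y \<in> B then C - v (\<psi> y) else if up y then C else 0)" for y
    show ?thesis
    proof (rule bvI[where v = w])
      fix x y :: real assume xy: "x < y"
      consider "x \<in> B" "y \<in> B" | "x \<in> B" "y \<notin> B" "up y" | "x \<notin> B" "\<not> up x" "y \<in> B"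
        | "x \<notin> B" "y \<notin> B" "up x" "up y" | "x \<notin> B" "y \<notin> B" "\<not> up x"
        using low upm xy upB by (meson less_imp_le not_less)
      thus "\<bar>(if y \<in> B then h (\<psi> y) else 0) - (if x \<in> B then h (\<psi> x) else 0)\<bar> \<le> w y - w x"
      proof cases
        case 1
        hence "\<psi> y \<le> \<psi> x" using m xy by (auto simp: monotone_on_def)
        thus ?thesis using dominatesD[OF v(3), of "\<psi> y" "\<psi> x"] 1 by (simp add: w_def)
      qed (use v C in \<open>auto simp: w_def\<close>)
    qed (use v C B in \<open>auto simp: w_def\<close>)
  qed
qed

text \<open>On the interval \<open>\<bar>h\<bar>\<close> is at most \<open>\<bar>h t\<bar>\<close>
  plus the growth of \<open>v\<close>. The cut creates two jumps of at most this size, and the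
  variation inside adds the growth of \<open>v\<close> once more; hence the factors 2 and 3.\<close>

lemma bv_restrict:
  assumes v: "dominates v h" and t: "t \<in> {\<alpha><..<\<beta>}" and sub: "{\<alpha><..<\<beta>} \<subseteq> {a..b}"
  shows "bv a b (2 * \<bar>h t\<bar> + 3 * (v \<beta> - v \<alpha>)) (\<lambda>x. indicator {\<alpha><..<\<beta>} x * h x)"
proof -
  define V where "V = v \<beta> - v \<alpha>"
  have V0: "0 \<le> V" using dominates_mono[OF v, of \<alpha> \<beta>] t by (simp add: V_def)
  have vA: "v \<alpha> \<le> v x" "v x \<le> v \<beta>" if "x \<in> {\<alpha><..<\<beta>}" for x
    using that dominates_mono[OF v] by auto
  have hA: "\<bar>h x\<bar> \<le> \<bar>h t\<bar> + V" if "x \<in> {\<alpha><..<\<beta>}" for x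
    using dominatesD[OF v, of x t] dominatesD[OF v, of t x] vA[OF that] vA[OF t] 
    by (cases "x \<le> t") (auto simp: V_def)
  define w where "w x = (if x \<le> \<alpha> then 0 else if x < \<beta> then \<bar>h t\<bar> + V + (v x - v \<alpha>) else 2 * \<bar>h t\<bar> + 3 * V)" for x
  show ?thesis
    unfolding V_def[symmetric]
  proof (rule bvI[where v = w])
    fix x y :: real assume xy: "x < y"
    consider "x \<le> \<alpha>" "y \<le> \<alpha>" | "x \<le> \<alpha>" "y \<in> {\<alpha><..<\<beta>}" | "x \<le> \<alpha>" "y \<ge> \<beta>" "y > \<alpha>"
      | "x \<in> {\<alpha><..<\<beta>}" "y \<in> {\<alpha><..<\<beta>}" | "x \<in> {\<alpha><..<\<beta>}" "y \<ge> \<beta>" | "x \<ge> \<beta>" "y \<ge> \<beta>"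
      using xy by fastforce
    thus "\<bar>indicator {\<alpha><..<\<beta>} y * h y - indicator {\<alpha><..<\<beta>} x * h x\<bar> \<le> w y - w x"
    proof cases
      case 2 thus ?thesis using hA[of y] vA[of y] by (auto simp: w_def)
    next
      case 4 thus ?thesis using dominatesD[OF v, of x y] xy by (auto simp: w_def)
    next
      case 5 thus ?thesis using hA[of x] vA[of x] V0 by (auto simp: w_def V_def)
    qed (use V0 t in \<open>auto simp: w_def\<close>)
  next
    fix x show "0 \<le> w x" using V0 vA[of x] by (auto simp: w_def)
    show "w x \<le> 2 * \<bar>h t\<bar> + 3 * V" using V0 vA[of x] by (auto simp: w_def V_def)
  next
    fix x assume "x \<notin> {a..b}"
    thus "indicator {\<alpha><..<\<beta>} x * h x = 0" using sub by (auto split: split_indicator)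
  qed
qed

section \<open>Open intervals, disjoint families and mean values\<close>

lemma open_interval_eq:
  fixes A :: "real set"
  assumes "open A" "is_interval A" "A \<noteq> {}" "A \<subseteq> {a..b}"
  obtains \<alpha> \<beta> where "\<alpha> < \<beta>" "A = {\<alpha><..<\<beta>}"
proof -
  have bd: "bdd_above A" "bdd_below A" using bdd_above_mono[OF _ assms(4)] bdd_below_mono[OF _ assms(4)] by auto
  have A: "A = {Inf A<..<Sup A}"
  proof safe
    fix x assume x: "x \<in> A"
    then obtain e where e: "0 < e" "cball x e \<subseteq> A" using assms(1) open_contains_cball by blast
    hence "x - e \<in> A" "x + e \<in> A" by (auto simp: subset_iff dist_real_def)
    thus "x \<in> {Inf A<..<Sup A}" 
      using cInf_lower[OF _ bd(2), of "x - e"] cSup_upper[OF _ bd(1), of "x + e"] e(1) by auto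
  next
    fix x assume "x \<in> {Inf A<..<Sup A}"
    hence "Inf A < x" "x < Sup A" by auto
    then obtain y z where "y \<in> A" "y < x" "z \<in> A" "x < z"
      using cInf_lessD[OF assms(3)] less_cSupD[OF assms(3)] by meson
    thus "x \<in> A" using assms(2) unfolding is_interval_1 by (meson less_imp_le)
  qed
  moreover have "Inf A < Sup A" using A assms(3) by (metis greaterThanLessThan_empty_iff not_less)
  ultimately show ?thesis using that by blast
qed

text \<open>Induction on the number of intervals: the one with the largest left endpoint is removed,
  and all others end at or before that endpoint.\<close>

lemma sum_disjoint_intervals_le:
  fixes v :: "real \<Rightarrow> real"
  assumes "finite W" "\<And>u. u \<in> W \<Longrightarrow> \<alpha> u < \<beta> u" "\<And>u. u \<in> W \<Longrightarrow> \<beta> u \<le> z"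
    "\<And>u u'. u \<in> W \<Longrightarrow> u' \<in> W \<Longrightarrow> u \<noteq> u' \<Longrightarrow> {\<alpha> u<..<\<beta> u} \<inter> {\<alpha> u'<..<\<beta> u'} = {}"
    "mono v" "\<And>x. 0 \<le> v x"
  shows "(\<Sum>u\<in>W. v (\<beta> u) - v (\<alpha> u)) \<le> v z"
  using assms
proof (induction "card W" arbitrary: W z)
  case 0 thus ?case by simp
next
  case (Suc n)
  define m where "m = Max (\<alpha> ` W)"
  have "W \<noteq> {}" using Suc.hyps by auto
  hence "m \<in> \<alpha> ` W" unfolding m_def using Suc.prems(1) by (intro Max_in) auto
  then obtain s where s: "s \<in> W" "\<alpha> s = m" by auto
  have le: "\<beta> u \<le> \<alpha> s" if u: "u \<in> W - {s}" for u
  proof (rule ccontr)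
    assume "\<not> \<beta> u \<le> \<alpha> s"
    hence lt: "\<alpha> s < min (\<beta> u) (\<beta> s)" using Suc.prems(2)[OF s(1)] by auto
    then obtain x where "\<alpha> s < x" "x < min (\<beta> u) (\<beta> s)" using dense by blast
    moreover have "\<alpha> u \<le> \<alpha> s" unfolding s(2) m_def using u Suc.prems(1) by auto
    ultimately have "x \<in> {\<alpha> u<..<\<beta> u} \<inter> {\<alpha> s<..<\<beta> s}" by auto
    thus False using Suc.prems(4)[of u s] u s by blast
  qed
  have "(\<Sum>u\<in>W - {s}. v (\<beta> u) - v (\<alpha> u)) \<le> v (\<alpha> s)"
    by (rule Suc.hyps(1)) (use Suc.prems Suc.hyps(2) s le in auto)
  moreover have "(\<Sum>u\<in>W. v (\<beta> u) - v (\<alpha> u)) = v (\<beta> s) - v (\<alpha> s) + (\<Sum>u\<in>W - {s}. v (\<beta> u) - v (\<alpha> u))"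
    using Suc.prems(1) s(1) by (rule sum.remove)
  moreover have "v (\<beta> s) \<le> v z" using Suc.prems(3)[OF s(1)] Suc.prems(5) by (simp add: monoD)
  ultimately show ?case by linarith
qed

text \<open>If \<open>\<bar>h\<bar>\<close> exceeded the quotient on the whole interval, its
  integral there would exceed the total. The point \<open>t\<close> feeds
  \<open>bv_restrict\<close>, where the value at \<open>t\<close> is thereby replaced by an L1
  norm.\<close>

lemma exists_abs_le_mean:
  assumes h: "integrable lborel h" and "\<alpha> < \<beta>"
  obtains t :: real where "t \<in> {\<alpha><..<\<beta>}" "\<bar>h t\<bar> \<le> (LINT x|lborel. \<bar>h x\<bar>) / (\<beta> - \<alpha>)"
proof -
  define I where "I = (LINT x|lborel. \<bar>h x\<bar>)"
  have "\<exists>t\<in>{\<alpha><..<\<beta>}. \<bar>h t\<bar> \<le> I / (\<beta> - \<alpha>)"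
  proof (rule ccontr)
    assume "\<not> ?thesis"
    hence gt: "\<bar>h t\<bar> > I / (\<beta> - \<alpha>)" if "t \<in> {\<alpha><..<\<beta>}" for t using that by force
    have i1: "integrable lborel (\<lambda>x. indicator {\<alpha><..<\<beta>} x * \<bar>h x\<bar>)"
      using integrable_real_mult_indicator[of "{\<alpha><..<\<beta>}" lborel "\<lambda>x. \<bar>h x\<bar>"] h
      by (simp add: mult.commute)
    have i2: "integrable lborel (\<lambda>x. I / (\<beta> - \<alpha>) * indicator {\<alpha><..<\<beta>} x)"
      using assms(2) by (intro integrable_mult_right integrable_real_indicator) auto
    define D where "D x = indicator {\<alpha><..<\<beta>} x * \<bar>h x\<bar> - I / (\<beta> - \<alpha>) * indicator {\<alpha><..<\<beta>} x" for x
    have D: "integrable lborel D" unfolding D_def using i1 i2 by simp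
    have D0: "0 \<le> D x" for x using gt[of x] by (auto simp: D_def split: split_indicator)
    have "(LINT x|lborel. indicator {\<alpha><..<\<beta>} x * \<bar>h x\<bar>) \<le> I"
      unfolding I_def using h i1 by (intro integral_mono) (auto split: split_indicator)
    hence "integral\<^sup>L lborel D \<le> 0"
      unfolding D_def using i1 i2 assms(2) by (subst Bochner_Integration.integral_diff) auto
    hence "integral\<^sup>L lborel D = 0" using D0 by (simp add: antisym)
    hence "AE x in lborel. D x = 0"
      using integral_nonneg_eq_0_iff_AE[OF D] D0 by auto
    hence "AE x in lborel. x \<notin> {\<alpha><..<\<beta>}"
      by (rule AE_mp) (rule AE_I2, use gt in \<open>force simp: D_def\<close>)
    hence "emeasure lborel {\<alpha><..<\<beta>} = 0"
      by (subst (asm) AE_iff_measurable[where N = "{\<alpha><..<\<beta>}"]) auto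
    thus False using assms(2) by simp
  qed
  thus ?thesis using that unfolding I_def by blast
qed

section \<open>The transfer operator\<close>

text \<open>\<open>J i\<close> may be empty, which covers maps with finitely many branches.\<close>

locale branches =
  fixes a b \<rho> :: real and T :: "real \<Rightarrow> real" and J :: "nat \<Rightarrow> real set"
    and e c \<theta> :: "nat \<Rightarrow> real"
  assumes ab: "a < b"
    and rho: "\<rho> < 1" "\<bar>a\<bar> \<le> \<rho>" "\<bar>b\<bar> \<le> \<rho>"
    and T_borel [measurable]: "T \<in> borel_measurable borel"
    and T_range: "x \<in> {a..b} \<Longrightarrow> T x \<in> {a..b}"
    and J_open: "open (J i)" and J_interval: "is_interval (J i)" and J_sub: "J i \<subseteq> {a..b}"
    and J_disj: "disjoint_family J" and J_nonzero: "0 \<notin> J i"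
    and J_cover: "countable ({a..b} - (\<Union>i. J i))"
    and e_sign: "e i = 1 \<or> e i = -1"
    and branch: "x \<in> J i \<Longrightarrow> T x = e i / x + c i"
    and theta: "x \<in> J i \<Longrightarrow> x\<^sup>2 \<le> \<theta> i" "0 \<le> \<theta> i" "\<theta> i \<le> \<rho>\<^sup>2" "summable \<theta>"
begin

lemma rho_nonneg: "0 \<le> \<rho>" using rho(2) by linarith

lemma J_borel [measurable]: "J i \<in> sets borel" using J_open by simp

lemma J_inj: "x \<in> J i \<Longrightarrow> x \<in> J j \<Longrightarrow> i = j"
  using J_disj by (auto simp: disjoint_family_on_def)

section \<open>Inverse branches and the transfer operator\<close>

definition \<psi> :: "nat \<Rightarrow> real \<Rightarrow> real" where
  "\<psi> i y = e i / (y - c i)"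

lemma \<psi>_T: "x \<in> J i \<Longrightarrow> \<psi> i (T x) = x"
  using branch[of x i] e_sign[of i] J_nonzero[of i] by (auto simp: \<psi>_def)

lemma J_same_sign: "x \<in> J i \<Longrightarrow> y \<in> J i \<Longrightarrow> 0 < x * y"
  using J_interval[of i] J_nonzero[of i] unfolding is_interval_1
  by (metis less_eq_real_def linorder_not_le mult_neg_neg mult_pos_pos)

lemma continuous_on_T: "continuous_on (J i) T"
proof -
  have "continuous_on (J i) (\<lambda>x. e i / x + c i)"
    using J_nonzero[of i] by (intro continuous_intros) auto
  thus ?thesis by (rule continuous_on_eq) (simp add: branch)
qed

lemma image_J_interval: "is_interval (T ` J i)"
  unfolding is_interval_connected_1
  by (intro connected_continuous_image continuous_on_T) (use J_interval is_interval_connected_1 in blast)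

lemma image_J_sub: "T ` J i \<subseteq> {a..b}"
  using T_range J_sub[of i] by blast

text \<open>The difference of two values of \<open>\<psi> i\<close> is \<open>- e i\<close> times
  the difference of the arguments times the product of the two values. That product is positive,
  since \<open>J i\<close> is an interval without 0.\<close>

lemma \<psi>_monotone: "mono_on (T ` J i) (\<psi> i) \<or> antimono_on (T ` J i) (\<psi> i)"
proof -
  have eq: "\<psi> i y' - \<psi> i y = - e i * (y' - y) * (\<psi> i y * \<psi> i y')" and pos: "0 < \<psi> i y * \<psi> i y'"
    if yy: "y \<in> T ` J i" "y' \<in> T ` J i" for y y'
  proof -
    obtain x x' where x: "x \<in> J i" "y = T x" and x': "x' \<in> J i" "y' = T x'" using yy by auto
    have nz: "x \<noteq> 0" "x' \<noteq> 0" using J_nonzero x x' by metis+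
    show "0 < \<psi> i y * \<psi> i y'" using J_same_sign[OF x(1) x'(1)] \<psi>_T x x' by simp
    show "\<psi> i y' - \<psi> i y = - e i * (y' - y) * (\<psi> i y * \<psi> i y')"
    proof -
      have "\<psi> i y = x" "\<psi> i y' = x'" using \<psi>_T x x' by auto
      moreover have "y' - y = e i / x' - e i / x" using branch[OF x(1)] branch[OF x'(1)] x(2) x'(2) by simp
      ultimately show ?thesis using nz e_sign[of i] by (auto simp: field_simps)
    qed
  qed
  show ?thesis
  proof (cases "e i = 1")
    case True
    have "\<psi> i y' \<le> \<psi> i y" if "y \<in> T ` J i" "y' \<in> T ` J i" "y \<le> y'" for y y'
      using eq[OF that(1,2)] pos[OF that(1,2)] that(3) True
      by (metis diff_ge_0_iff_ge diff_le_0_iff_le less_imp_le minus_mult_left mult_1 mult_nonneg_nonneg neg_le_0_iff_le)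
    thus ?thesis by (auto simp: monotone_on_def)
  next
    case False
    hence "e i = -1" using e_sign by auto
    hence "\<psi> i y \<le> \<psi> i y'" if "y \<in> T ` J i" "y' \<in> T ` J i" "y \<le> y'" for y y'
      using eq[OF that(1,2)] pos[OF that(1,2)] that(3)
      by (metis diff_ge_0_iff_ge less_imp_le minus_minus mult_1 mult_nonneg_nonneg)
    thus ?thesis by (auto simp: monotone_on_def)
  qed
qed

text \<open>\<open>(\<psi> i y)\<^sup>2\<close> is the absolute value of the derivative of the
  inverse branch, for either sign \<open>e i\<close>; so \<open>Lb i\<close> is the part of the
  transfer operator that stems from \<open>J i\<close>.\<close>

definition Lb :: "nat \<Rightarrow> (real \<Rightarrow> real) \<Rightarrow> real \<Rightarrow> real" where
  "Lb i h y = (if y \<in> T ` J i then (\<psi> i y)\<^sup>2 * h (\<psi> i y) else 0)"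

definition L :: "(real \<Rightarrow> real) \<Rightarrow> real \<Rightarrow> real" where
  "L h y = (\<Sum>i. Lb i h y)"

lemma Lb_T: "x \<in> J i \<Longrightarrow> Lb i h (T x) = x\<^sup>2 * h x"
  by (simp add: Lb_def \<psi>_T)

lemma Lb_outside: "y \<notin> T ` J i \<Longrightarrow> Lb i h y = 0"
  by (simp add: Lb_def)

lemma Lb_cases:
  obtains x where "x \<in> J i" "y = T x" | "y \<notin> T ` J i" by blast

lemma Lb_abs_le:
  assumes "\<And>x. \<bar>h x\<bar> \<le> D" shows "\<bar>Lb i h y\<bar> \<le> \<theta> i * D"
proof (rule Lb_cases[of i y])
  fix x assume "x \<in> J i" "y = T x"
  thus ?thesis using assms[of x] theta(1)[of x i] theta(2)[of i]
    by (auto simp: Lb_T abs_mult intro!: mult_mono)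
qed (use theta(2)[of i] order_trans[OF abs_ge_zero assms] in \<open>auto simp: Lb_outside\<close>)

lemma summable_Lb:
  assumes "\<And>x. \<bar>h x\<bar> \<le> D" shows "summable (\<lambda>i. Lb i h y)"
  by (rule summable_comparison_test'[where g = "\<lambda>i. \<theta> i * D"])
    (use theta(4) Lb_abs_le[OF assms] in \<open>auto intro: summable_mult2\<close>)

lemma summable_abs_Lb:
  assumes "\<And>x. \<bar>h x\<bar> \<le> D" shows "summable (\<lambda>i. \<bar>Lb i h y\<bar>)"
  by (rule summable_comparison_test'[where g = "\<lambda>i. \<theta> i * D"])
    (use theta(4) Lb_abs_le[OF assms] in \<open>auto intro: summable_mult2\<close>)

lemma Lb_add: "Lb i (\<lambda>x. g x + h x) y = Lb i g y + Lb i h y"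
  and Lb_scale: "Lb i (\<lambda>x. k * h x) y = k * Lb i h y"
  and Lb_abs: "Lb i (\<lambda>x. \<bar>h x\<bar>) y = \<bar>Lb i h y\<bar>"
  by (auto simp: Lb_def algebra_simps abs_mult)

lemma Lb_nonneg: "(\<And>x. 0 \<le> h x) \<Longrightarrow> 0 \<le> Lb i h y"
  by (auto simp: Lb_def)

text \<open>On \<open>J i\<close>, which lies on one side of 0, the weight \<open>x\<^sup>2\<close>
  is monotone and at most \<open>\<theta> i\<close>. So \<open>bv_weight\<close> and
  \<open>bv_reparam\<close> cost no constant beyond \<open>\<theta> i\<close>; the expensive cut to
  \<open>J i\<close> is left to the hypothesis.\<close>

lemma bv_Lb:
  assumes "bv a b C (\<lambda>x. indicator (J i) x * h x)"
  shows "bv a b (\<theta> i * C) (Lb i h)"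
proof -
  define u where "u x = indicator (J i) x * h x" for x
  \<comment> \<open>The square is frozen at 0 on the opposite side of the origin and truncated at
    \<open>\<theta> i\<close>. It becomes monotone and bounded on the whole line and still equals
    \<open>x\<^sup>2\<close> on \<open>J i\<close>.\<close>
  define W where "W x = min (\<theta> i) (if \<exists>z\<in>J i. 0 < z then (max 0 x)\<^sup>2 else (min 0 x)\<^sup>2)" for x
  have "mono W \<or> antimono W"
  proof (cases "\<exists>z\<in>J i. 0 < z")
    case True
    have "mono W" unfolding W_def using True by (auto intro!: monoI min.mono power_mono)
    thus ?thesis ..
  next
    case False
    have "antimono W" unfolding W_def using False
    proof (intro antimonoI, simp only: if_False, intro min.mono order_refl)
      fix x y :: real assume "x \<le> y"
      hence "\<bar>min 0 y\<bar> \<le> \<bar>min 0 x\<bar>" by auto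
      thus "(min 0 y)\<^sup>2 \<le> (min 0 x)\<^sup>2" using abs_le_square_iff by blast
    qed
    thus ?thesis ..
  qed
  moreover have "0 \<le> W x" "W x \<le> \<theta> i" for x using theta(2) by (auto simp: W_def)
  ultimately have Wu: "bv a b (\<theta> i * C) (\<lambda>x. W x * u x)"
    by (intro bv_weight) (use assms in \<open>auto simp: u_def\<close>)
  have WJ: "W x = x\<^sup>2" if x: "x \<in> J i" for x
  proof (cases "\<exists>z\<in>J i. 0 < z")
    case True
    then obtain z where "z \<in> J i" "0 < z" by blast
    hence "0 < x" using J_same_sign[OF x] by (metis zero_less_mult_pos2)
    thus ?thesis using theta(1)[OF x] True by (simp add: W_def min_def)
  next
    case False
    hence "x \<le> 0" using x by force
    thus ?thesis using theta(1)[OF x] False by (simp add: W_def min_def)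
  qed
  have "Lb i h = (\<lambda>y. if y \<in> T ` J i then W (\<psi> i y) * u (\<psi> i y) else 0)"
    by (rule ext) (auto simp: Lb_def \<psi>_T WJ u_def)
  thus ?thesis using bv_reparam[OF Wu image_J_interval image_J_sub \<psi>_monotone] by simp
qed

lemma J_cases: "J i = {} \<or> (\<exists>\<alpha> \<beta>. \<alpha> < \<beta> \<and> J i = {\<alpha><..<\<beta>})"
  using open_interval_eq[OF J_open J_interval _ J_sub] by metis

text \<open>The factors 2 and 3 of \<open>bv_restrict\<close>, with \<open>\<bar>h t\<bar>\<close>
  and the growth of \<open>v\<close> both estimated by \<open>C\<close>.\<close>

lemma bv_restrict_J:
  assumes h: "bv a b C h" shows "bv a b (5 * C) (\<lambda>x. indicator (J i) x * h x)"
proof (cases "J i = {}")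
  case True thus ?thesis using bv_mono[OF bv_zero, of "5 * C"] bv_nonneg[OF h] by simp
next
  case False
  then obtain \<alpha> \<beta> where J: "\<alpha> < \<beta>" "J i = {\<alpha><..<\<beta>}" using J_cases by blast
  obtain v where v: "\<And>x. 0 \<le> v x" "\<And>x. v x \<le> C" "dominates v h" using h by (rule bvE) blast
  obtain t where t: "t \<in> {\<alpha><..<\<beta>}" using J(1) by (auto dest: dense)
  have "bv a b (2 * \<bar>h t\<bar> + 3 * (v \<beta> - v \<alpha>)) (\<lambda>x. indicator {\<alpha><..<\<beta>} x * h x)"
    by (rule bv_restrict[OF v(3) t]) (use J_sub[of i] J(2) in simp)
  thus ?thesis unfolding J(2)
    by (rule bv_mono) (use bv_abs_le[OF h, of t] v(1)[of \<alpha>] v(2)[of \<beta>] in simp)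
qed

lemma bv_Lb': "bv a b C h \<Longrightarrow> bv a b (\<theta> i * (5 * C)) (Lb i h)"
  by (intro bv_Lb bv_restrict_J)

text \<open>5 is the cost of a cut in \<open>bv_restrict_J\<close>. The summand 1 makes the constant
  at least 1, so that its powers increase with the exponent.\<close>

definition \<Theta> :: real where "\<Theta> = 1 + 5 * (\<Sum>i. \<theta> i)"

lemma Theta_ge_1: "1 \<le> \<Theta>"
  using theta by (simp add: \<Theta>_def suminf_nonneg)

lemma bv_L: assumes h: "bv a b C h" shows "bv a b (\<Theta> * C) (L h)"
proof -
  have "bv a b (\<Sum>i. \<theta> i * (5 * C)) (\<lambda>y. \<Sum>i. Lb i h y)"
    by (rule bv_suminf[OF bv_Lb'[OF h]]) (use theta(4) in \<open>simp add: summable_mult2\<close>)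
  moreover have "(\<Sum>i. \<theta> i * (5 * C)) \<le> \<Theta> * C"
    using suminf_mult2[OF theta(4), of "5 * C"] bv_nonneg[OF h] by (simp add: \<Theta>_def algebra_simps)
  moreover have "(\<lambda>y. \<Sum>i. Lb i h y) = L h" by (simp add: L_def fun_eq_iff)
  ultimately show ?thesis by (metis bv_mono)
qed

lemma bv_L_pow: "bv a b C h \<Longrightarrow> bv a b (\<Theta> ^ n * C) ((L ^^ n) h)"
proof (induction n)
  case (Suc n) thus ?case using bv_L[of "\<Theta> ^ n * C"] by (simp add: mult.assoc)
qed simp

lemma L_add:
  assumes "bv a b C g" "bv a b D h"
  shows "L (\<lambda>x. g x + h x) = (\<lambda>y. L g y + L h y)"
  unfolding L_def Lb_add
  by (intro ext suminf_add[symmetric] summable_Lb[OF bv_abs_le[OF assms(1)]]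
      summable_Lb[OF bv_abs_le[OF assms(2)]])

lemma L_scale:
  assumes "bv a b C h"
  shows "L (\<lambda>x. k * h x) = (\<lambda>y. k * L h y)"
  unfolding L_def Lb_scale
  by (intro ext suminf_mult summable_Lb[OF bv_abs_le[OF assms]])

lemma L_abs_le:
  assumes "bv a b C h" shows "\<bar>L h y\<bar> \<le> L (\<lambda>x. \<bar>h x\<bar>) y"
  unfolding L_def Lb_abs by (rule summable_rabs[OF summable_abs_Lb[OF bv_abs_le[OF assms]]])

lemma L_nonneg: 
  assumes "bv a b C h" "\<And>x. 0 \<le> h x" shows "0 \<le> L h y"
  unfolding L_def
  by (intro suminf_nonneg summable_Lb[OF bv_abs_le[OF assms(1)]] Lb_nonneg assms(2))

lemma L_zero: "L (\<lambda>x. 0) = (\<lambda>x. 0)"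
proof -
  have "Lb i (\<lambda>x. 0) y = 0" for i y by (simp add: Lb_def)
  thus ?thesis by (simp add: L_def fun_eq_iff)
qed

lemma L_minus:
  assumes "bv a b C h" shows "L (\<lambda>x. - h x) = (\<lambda>y. - L h y)"
  using L_scale[OF assms, of "-1"] by simp

lemma L_diff:
  assumes "bv a b C g" "bv a b D h"
  shows "L (\<lambda>x. g x - h x) = (\<lambda>y. L g y - L h y)"
  using L_add[OF assms(1) bv_minus[OF assms(2)]] L_minus[OF assms(2)] by simp

lemma L_mono:
  assumes "bv a b C g" "bv a b D h" "\<And>x. g x \<le> h x"
  shows "L g y \<le> L h y"
  using L_nonneg[OF bv_diff[OF assms(2,1)], of y] L_diff[OF assms(2,1)] assms(3) by simp

lemma L_pow_add:
  assumes "bv a b C g" "bv a b D h"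
  shows "(L ^^ n) (\<lambda>x. g x + h x) = (\<lambda>y. (L ^^ n) g y + (L ^^ n) h y)"
  by (induction n) (simp_all add: L_add[OF bv_L_pow[OF assms(1)] bv_L_pow[OF assms(2)]])

lemma L_pow_scale:
  assumes "bv a b C h"
  shows "(L ^^ n) (\<lambda>x. k * h x) = (\<lambda>y. k * (L ^^ n) h y)"
  by (induction n) (simp_all add: L_scale[OF bv_L_pow[OF assms(1)]])

lemma L_pow_diff:
  assumes "bv a b C g" "bv a b D h"
  shows "(L ^^ n) (\<lambda>x. g x - h x) = (\<lambda>y. (L ^^ n) g y - (L ^^ n) h y)"
  by (induction n) (simp_all add: L_diff[OF bv_L_pow[OF assms(1)] bv_L_pow[OF assms(2)]])

lemma L_pow_nonneg:
  assumes "bv a b C h" "\<And>x. 0 \<le> h x" shows "0 \<le> (L ^^ n) h y"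
proof (induction n arbitrary: y)
  case (Suc n) thus ?case using L_nonneg[OF bv_L_pow[OF assms(1)]] by simp
qed (use assms in simp)

lemma L_pow_abs_le:
  assumes "bv a b C h" shows "\<bar>(L ^^ n) h y\<bar> \<le> (L ^^ n) (\<lambda>x. \<bar>h x\<bar>) y"
proof (induction n arbitrary: y)
  case (Suc n)
  have "\<bar>L ((L ^^ n) h) y\<bar> \<le> L (\<lambda>x. \<bar>(L ^^ n) h x\<bar>) y"
    by (rule L_abs_le[OF bv_L_pow[OF assms]])
  also have "\<dots> \<le> L ((L ^^ n) (\<lambda>x. \<bar>h x\<bar>)) y"
    by (rule L_mono[OF bv_abs[OF bv_L_pow[OF assms]] bv_L_pow[OF bv_abs[OF assms]] Suc])
  finally show ?case by simp
qed simp

lemma L_T_pos: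
  assumes h: "bv a b C h" "\<And>x. 0 \<le> h x" and x: "x \<in> J i" "0 < h x"
  shows "0 < L h (T x)"
proof -
  have "x \<noteq> 0" using x J_nonzero[of i] by metis
  hence "0 < Lb i h (T x)" using x by (simp add: Lb_T)
  also have "\<dots> \<le> L h (T x)"
    unfolding L_def using sum_le_suminf[OF summable_Lb[OF bv_abs_le[OF h(1)]], of "{i}"] Lb_nonneg[OF h(2)] by simp
  finally show ?thesis .
qed

text \<open>All summands of \<open>L h\<close> are nonnegative, and the branch through the current
  point contributes the value there times a nonzero square. This requires the orbit to stay inside
  the open branches before time \<open>n\<close>.\<close>

lemma L_pow_T_pos:
  assumes "bv a b C h" "\<And>x. 0 \<le> h x" "0 < h x" "\<And>k. k < n \<Longrightarrow> (T ^^ k) x \<in> (\<Union>i. J i)"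
  shows "0 < (L ^^ n) h ((T ^^ n) x)"
  using assms
proof (induction n arbitrary: h x C)
  case (Suc n)
  obtain i where "x \<in> J i" using Suc.prems(4)[of 0] by auto
  hence "0 < L h (T x)" using L_T_pos Suc.prems(1-3) by blast
  moreover have "(T ^^ k) (T x) \<in> (\<Union>i. J i)" if "k < n" for k
    using Suc.prems(4)[of "Suc k"] that by (simp add: funpow_swap1)
  ultimately have "0 < (L ^^ n) (L h) ((T ^^ n) (T x))"
    using Suc.IH[OF bv_L[OF Suc.prems(1)]] L_nonneg[OF Suc.prems(1,2)] by blast
  thus ?case by (simp add: funpow_swap1)
qed simp

end

section \<open>The Lasota--Yorke inequality\<close>

context branches
begin

section \<open>Words, cylinders and products of branch operators\<close>

primrec Lw :: "nat list \<Rightarrow> (real \<Rightarrow> real) \<Rightarrow> real \<Rightarrow> real" where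
  "Lw [] h = h"
| "Lw (i # u) h = Lw u (Lb i h)"

text \<open>The head of a word is the first symbol of the itinerary, and \<open>Lw\<close> applies
  its branch operator first; hence \<open>Lw u h\<close> depends on \<open>h\<close> only through
  its restriction to \<open>cyl u\<close>.\<close>

primrec cyl :: "nat list \<Rightarrow> real set" where
  "cyl [] = UNIV"
| "cyl (i # u) = {x \<in> J i. T x \<in> cyl u}"

lemma cyl_open: "open (cyl u)"
proof (induction u)
  case (Cons i u)
  have "cyl (i # u) = T -` cyl u \<inter> J i" by auto
  thus ?case using continuous_on_open_vimage[OF J_open] continuous_on_T Cons by metis
qed simp

lemma cyl_interval: "is_interval (cyl u)"
proof (induction u)
  case (Cons i u)
  have T_mono: "(\<forall>x\<in>J i. \<forall>y\<in>J i. x \<le> y \<longrightarrow> T x \<le> T y) \<or> (\<forall>x\<in>J i. \<forall>y\<in>J i. x \<le> y \<longrightarrow> T y \<le> T x)"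
  proof -
    have "1 / y \<le> 1 / x" if "x \<in> J i" "y \<in> J i" "x \<le> y" for x y
    proof -
      have "x \<noteq> 0" "y \<noteq> 0" using that J_nonzero by metis+
      hence "1 / x - 1 / y = (y - x) / (x * y)" by (simp add: field_simps)
      moreover have "0 \<le> (y - x) / (x * y)"
        using J_same_sign[OF that(1,2)] that(3) by (intro divide_nonneg_nonneg) auto
      ultimately show ?thesis by linarith
    qed
    thus ?thesis using e_sign[of i] branch[of _ i] by auto
  qed
  show ?case unfolding is_interval_1
  proof (intro ballI allI impI)
    fix x z y assume xz: "x \<in> cyl (i # u)" "z \<in> cyl (i # u)" and y: "x \<le> y \<and> y \<le> z"
    hence "y \<in> J i" using J_interval[of i] unfolding is_interval_1 by auto
    moreover have "T y \<in> cyl u"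
    proof -
      have cyl: "q \<in> cyl u" if "p \<in> cyl u" "r \<in> cyl u" "p \<le> q" "q \<le> r" for p q r
        using Cons that unfolding is_interval_1 by blast
      have J: "x \<in> J i" "z \<in> J i" "T x \<in> cyl u" "T z \<in> cyl u" using xz by auto
      from T_mono show ?thesis
      proof
        assume m: "\<forall>x\<in>J i. \<forall>y\<in>J i. x \<le> y \<longrightarrow> T x \<le> T y"
        have "T x \<le> T y" "T y \<le> T z" using m y J \<open>y \<in> J i\<close> by blast+
        thus ?thesis using cyl[OF J(3,4)] by blast
      next
        assume m: "\<forall>x\<in>J i. \<forall>y\<in>J i. x \<le> y \<longrightarrow> T y \<le> T x"
        have "T y \<le> T x" "T z \<le> T y" using m y J \<open>y \<in> J i\<close> by blast+
        thus ?thesis using cyl[OF J(4,3)] by blast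
      qed
    qed
    ultimately show "y \<in> cyl (i # u)" by simp
  qed
qed (simp add: is_interval_univ)

lemma cyl_disjoint:
  "length u = length w \<Longrightarrow> x \<in> cyl u \<Longrightarrow> x \<in> cyl w \<Longrightarrow> u = w"
proof (induction u arbitrary: w x)
  case (Cons i u)
  then obtain j w' where w: "w = j # w'" by (cases w) auto
  show ?case using Cons.prems Cons.IH[of w' "T x"] J_inj[of x i j] by (auto simp: w)
qed simp

lemma cyl_sub: "u \<noteq> [] \<Longrightarrow> cyl u \<subseteq> {a..b}"
  using J_sub by (cases u) auto

text \<open>The cut is made once, on the whole cylinder, and moves along: cutting \<open>h\<close>
  to \<open>cyl (i # u)\<close> before \<open>Lb i\<close> amounts to cutting \<open>Lb i h\<close>
  to \<open>cyl u\<close>. So each letter contributes a factor \<open>\<rho>\<^sup>2\<close> and no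
  constant. A new cut for each letter would cost a factor exponential in the length.\<close>

lemma bv_Lw:
  assumes "bv a b C (\<lambda>x. indicator (cyl u) x * h x)"
  shows "bv a b (\<rho> ^ (2 * length u) * C) (Lw u h)"
  using assms
proof (induction u arbitrary: h C)
  case (Cons i u)
  have C: "0 \<le> C" using Cons.prems by (rule bv_nonneg)
  define g where "g x = indicator {x. T x \<in> cyl u} x * h x" for x
  have "(\<lambda>x. indicator (J i) x * g x) = (\<lambda>x. indicator (cyl (i # u)) x * h x)"
    by (auto simp: g_def split: split_indicator)
  hence "bv a b (\<theta> i * C) (Lb i g)" using Cons.prems by (intro bv_Lb) simp
  hence "bv a b (\<rho>\<^sup>2 * C) (Lb i g)"
    by (rule bv_mono) (intro mult_right_mono theta(3) C)
  moreover have "Lb i g = (\<lambda>y. indicator (cyl u) y * Lb i h y)"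
    
  proof
    fix y show "Lb i g y = indicator (cyl u) y * Lb i h y"
      by (rule Lb_cases[of i y]) (auto simp: g_def Lb_T Lb_outside indicator_def)
  qed
  ultimately have "bv a b (\<rho> ^ (2 * length u) * (\<rho>\<^sup>2 * C)) (Lw u (Lb i h))"
    by (intro Cons.IH) simp
  thus ?case by (simp add: power_add power2_eq_square algebra_simps)
qed simp

section \<open>Truncation to finitely many branches\<close>

definition LF :: "nat \<Rightarrow> (real \<Rightarrow> real) \<Rightarrow> real \<Rightarrow> real" where
  "LF m h y = (\<Sum>i<m. Lb i h y)"

definition words :: "nat \<Rightarrow> nat \<Rightarrow> nat list set" where
  "words m n = {u. set u \<subseteq> {..<m} \<and> length u = n}"

lemma finite_words: "finite (words m n)"
  unfolding words_def by (rule finite_lists_length_eq) simp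

lemma Lw_sum: "Lw u (\<lambda>x. \<Sum>i\<in>I. g i x) = (\<lambda>y. \<Sum>i\<in>I. Lw u (g i) y)"
proof (induction u arbitrary: g)
  case (Cons j u)
  have "Lb j (\<lambda>x. \<Sum>i\<in>I. g i x) = (\<lambda>y. \<Sum>i\<in>I. Lb j (g i) y)"
    by (rule ext) (simp add: Lb_def sum_distrib_left)
  thus ?case using Cons.IH by simp
qed simp

lemma words_Suc: "words m (Suc n) = (\<lambda>(i, u). i # u) ` ({..<m} \<times> words m n)"
proof (intro equalityI subsetI)
  fix u assume "u \<in> words m (Suc n)"
  thus "u \<in> (\<lambda>(i, u). i # u) ` ({..<m} \<times> words m n)" by (cases u) (auto simp: words_def)
qed (auto simp: words_def)

lemma LF_pow: "(LF m ^^ n) h = (\<lambda>y. \<Sum>u\<in>words m n. Lw u h y)"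
proof (induction n arbitrary: h)
  case 0
  have "words m 0 = {[]}" by (auto simp: words_def)
  thus ?case by simp
next
  case (Suc n)
  have inj: "inj_on (\<lambda>(i, u). i # u) ({..<m} \<times> words m n)" by (auto simp: inj_on_def)
  have "(LF m ^^ Suc n) h = (LF m ^^ n) (\<lambda>x. \<Sum>i<m. Lb i h x)"
    by (simp only: funpow_Suc_right comp_apply) (simp only: LF_def[abs_def])
  also have "\<dots> = (\<lambda>y. \<Sum>u\<in>words m n. \<Sum>i<m. Lw (i # u) h y)"
    unfolding Suc.IH Lw_sum by simp
  also have "\<dots> = (\<lambda>y. \<Sum>u\<in>words m (Suc n). Lw u h y)"
    unfolding words_Suc by (subst sum.reindex[OF inj], subst sum.swap) (simp add: sum.cartesian_product case_prod_unfold)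
  finally show ?case .
qed

text \<open>On each cylinder a sample value of \<open>h\<close> is bounded by its mean, which gives
  the L1 term; the growth of \<open>v\<close> over the disjoint cylinders adds up to at most
  \<open>C\<close>. Finiteness of the number of words keeps \<open>K\<close> finite, and
  \<open>n > 0\<close> keeps the cylinders inside \<open>{a..b}\<close>.\<close>

lemma lasota_yorke_finite:
  assumes "n > 0"
  obtains K where "0 \<le> K"
    "\<And>C h. bv a b C h \<Longrightarrow> bv a b (3 * \<rho> ^ (2 * n) * C + K * (LINT x|lborel. \<bar>h x\<bar>)) ((LF m ^^ n) h)"
proof -
  define W where "W = {u \<in> words m n. cyl u \<noteq> {}}"
  have finW: "finite W" unfolding W_def using finite_words by simp
  have ne: "u \<noteq> []" "length u = n" if "u \<in> words m n" for u using that assms by (auto simp: words_def)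
  have "\<exists>\<alpha> \<beta>. \<alpha> < \<beta> \<and> cyl u = {\<alpha><..<\<beta>}" if "u \<in> W" for u
  proof -
    have "u \<in> words m n" "cyl u \<noteq> {}" using that by (auto simp: W_def)
    from open_interval_eq[OF cyl_open cyl_interval this(2) cyl_sub[OF ne(1)[OF this(1)]]]
    show ?thesis by blast
  qed
  then obtain \<alpha> \<beta> where ab: "\<And>u. u \<in> W \<Longrightarrow> \<alpha> u < \<beta> u" "\<And>u. u \<in> W \<Longrightarrow> cyl u = {\<alpha> u<..<\<beta> u}"
    by metis
  define K where "K = (\<Sum>u\<in>W. \<rho> ^ (2 * n) * (2 / (\<beta> u - \<alpha> u)))"
  show ?thesis
  proof (rule that[of K])
    show "0 \<le> K" unfolding K_def using ab(1) rho_nonneg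
      by (intro sum_nonneg mult_nonneg_nonneg divide_nonneg_nonneg zero_le_power) (auto intro: less_imp_le)
    fix C h assume h: "bv a b C h"
    define I where "I = (LINT x|lborel. \<bar>h x\<bar>)"
    obtain v where v: "\<And>x. 0 \<le> v x" "\<And>x. v x \<le> C" "dominates v h" using h by (rule bvE) blast
    define D where "D u = \<rho> ^ (2 * n) * (2 * (I / (\<beta> u - \<alpha> u)) + 3 * (v (\<beta> u) - v (\<alpha> u)))" for u
    have "bv a b (D u) (Lw u h)" if u: "u \<in> W" for u
    proof -
      obtain t where t: "t \<in> {\<alpha> u<..<\<beta> u}" "\<bar>h t\<bar> \<le> I / (\<beta> u - \<alpha> u)"
        using exists_abs_le_mean[OF bv_integrable[OF h] ab(1)[OF u]] unfolding I_def by metis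
      have "u \<in> words m n" using u by (simp add: W_def)
      note sub = cyl_sub[OF ne(1)[OF this], unfolded ab(2)[OF u]]
      have "bv a b (2 * \<bar>h t\<bar> + 3 * (v (\<beta> u) - v (\<alpha> u))) (\<lambda>x. indicator (cyl u) x * h x)"
        unfolding ab(2)[OF u] by (rule bv_restrict[OF v(3) t(1) sub])
      hence "bv a b (2 * (I / (\<beta> u - \<alpha> u)) + 3 * (v (\<beta> u) - v (\<alpha> u))) (\<lambda>x. indicator (cyl u) x * h x)"
        by (rule bv_mono) (use t(2) in simp)
      from bv_Lw[OF this] show ?thesis using ne(2) u by (simp add: D_def W_def)
    qed
    hence "bv a b (\<Sum>u\<in>W. D u) (\<lambda>y. \<Sum>u\<in>W. Lw u h y)" by (intro bv_sum finW)
    moreover have "(\<lambda>y. \<Sum>u\<in>W. Lw u h y) = (LF m ^^ n) h"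
    proof -
      have "Lw u h = (\<lambda>y. 0)" if "u \<in> words m n - W" for u
      proof -
        have "cyl u = {}" using that by (auto simp: W_def)
        hence "bv a b (\<rho> ^ (2 * length u) * 0) (Lw u h)" by (intro bv_Lw) (simp add: bv_zero)
        thus ?thesis using bv_abs_le by fastforce
      qed
      thus ?thesis unfolding LF_pow using finite_words
        by (intro ext sum.mono_neutral_left) (auto simp: W_def)
    qed
    moreover have "(\<Sum>u\<in>W. D u) \<le> 3 * \<rho> ^ (2 * n) * C + K * I"
    proof -
      have "(\<Sum>u\<in>W. v (\<beta> u) - v (\<alpha> u)) \<le> v (Max (insert 0 (\<beta> ` W)))"
      proof (rule sum_disjoint_intervals_le[OF finW ab(1)])
        fix u u' assume uu: "u \<in> W" "u' \<in> W" "u \<noteq> u'"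
        hence "cyl u \<inter> cyl u' = {}" using cyl_disjoint[of u u'] ne(2) by (auto simp: W_def)
        thus "{\<alpha> u<..<\<beta> u} \<inter> {\<alpha> u'<..<\<beta> u'} = {}" using ab(2) uu by simp
      qed (use finW v dominates_mono[OF v(3)] in \<open>auto simp: mono_def\<close>)
      also have "\<dots> \<le> C" by (rule v)
      finally have "3 * \<rho> ^ (2 * n) * (\<Sum>u\<in>W. v (\<beta> u) - v (\<alpha> u)) \<le> 3 * \<rho> ^ (2 * n) * C"
        using rho_nonneg by (intro mult_left_mono) auto
      moreover have "(\<Sum>u\<in>W. D u) = K * I + 3 * \<rho> ^ (2 * n) * (\<Sum>u\<in>W. v (\<beta> u) - v (\<alpha> u))"
        unfolding D_def K_def sum_distrib_right sum_distrib_left sum.distrib[symmetric]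
        by (intro sum.cong refl) (simp add: algebra_simps)
      ultimately show ?thesis by simp
    qed
    ultimately show "bv a b (3 * \<rho> ^ (2 * n) * C + K * (LINT x|lborel. \<bar>h x\<bar>)) ((LF m ^^ n) h)"
      unfolding I_def by (metis bv_mono)
  qed
qed

lemma bv_LF: assumes h: "bv a b C h" shows "bv a b (\<Theta> * C) (LF m h)"
proof -
  have "bv a b (\<Sum>i<m. \<theta> i * (5 * C)) (LF m h)"
    unfolding LF_def[abs_def] by (intro bv_sum bv_Lb'[OF h]) auto
  moreover have "(\<Sum>i<m. \<theta> i * (5 * C)) = (\<Sum>i<m. \<theta> i) * (5 * C)" by (simp add: sum_distrib_right)
  moreover have "\<dots> \<le> (\<Sum>i. \<theta> i) * (5 * C)"
    using theta bv_nonneg[OF h] by (intro mult_right_mono sum_le_suminf) auto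
  moreover have "\<dots> \<le> \<Theta> * C" using bv_nonneg[OF h] by (simp add: \<Theta>_def algebra_simps)
  ultimately show ?thesis by (metis bv_mono order_trans)
qed

lemma bv_LF_pow: "bv a b C h \<Longrightarrow> bv a b (\<Theta> ^ n * C) ((LF m ^^ n) h)"
proof (induction n)
  case (Suc n) thus ?case using bv_LF[of "\<Theta> ^ n * C"] by (simp add: mult.assoc)
qed simp

lemma bv_L_minus_LF:
  assumes h: "bv a b C h" 
  shows "bv a b (5 * (\<Sum>i. \<theta> (i + m)) * C) (\<lambda>y. L h y - LF m h y)"
proof -
  have "bv a b (\<Sum>i. \<theta> (i + m) * (5 * C)) (\<lambda>y. \<Sum>i. Lb (i + m) h y)"
    by (rule bv_suminf[OF bv_Lb'[OF h]])
      (use theta(4) in \<open>simp add: summable_mult2 summable_ignore_initial_segment\<close>)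
  moreover have "(\<Sum>i. \<theta> (i + m) * (5 * C)) = 5 * (\<Sum>i. \<theta> (i + m)) * C"
    using suminf_mult2[OF summable_ignore_initial_segment[OF theta(4)], of m "5 * C"] by simp
  moreover have "(\<Sum>i. Lb (i + m) h y) = L h y - LF m h y" for y
    unfolding L_def LF_def using suminf_minus_initial_segment[OF summable_Lb[OF bv_abs_le[OF h]]] .
  ultimately show ?thesis by simp
qed

text \<open>Telescoping: \<open>L\<close> applied to the previous difference, plus the tail of
  \<open>L\<close> applied to a power of \<open>LF m\<close>. The bound is crude in
  \<open>n\<close>, but its factor, the tail sum of \<open>\<theta>\<close>, is small for large
  \<open>m\<close>.\<close>

lemma bv_L_pow_minus_LF_pow:
  assumes h: "bv a b C h" 
  shows "bv a b (n * \<Theta> ^ n * (5 * (\<Sum>i. \<theta> (i + m))) * C) (\<lambda>y. (L ^^ n) h y - (LF m ^^ n) h y)"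
proof (induction n)
  case 0 thus ?case using bv_zero by simp
next
  case (Suc n)
  define \<epsilon> where "\<epsilon> = 5 * (\<Sum>i. \<theta> (i + m))"
  have e0: "0 \<le> \<epsilon>" unfolding \<epsilon>_def using theta by (simp add: suminf_nonneg summable_ignore_initial_segment)
  have C: "0 \<le> C" using h by (rule bv_nonneg)
  have "bv a b (\<Theta> * (n * \<Theta> ^ n * \<epsilon> * C)) (L (\<lambda>y. (L ^^ n) h y - (LF m ^^ n) h y))"
    unfolding \<epsilon>_def by (rule bv_L[OF Suc])
  moreover have "bv a b (\<epsilon> * (\<Theta> ^ n * C)) (\<lambda>y. L ((LF m ^^ n) h) y - LF m ((LF m ^^ n) h) y)"
    unfolding \<epsilon>_def by (rule bv_L_minus_LF[OF bv_LF_pow[OF h]])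
  ultimately have "bv a b (\<Theta> * (n * \<Theta> ^ n * \<epsilon> * C) + \<epsilon> * (\<Theta> ^ n * C))
    (\<lambda>y. L (\<lambda>y. (L ^^ n) h y - (LF m ^^ n) h y) y + (L ((LF m ^^ n) h) y - LF m ((LF m ^^ n) h) y))"
    by (rule bv_add)
  hence "bv a b (\<Theta> * (n * \<Theta> ^ n * \<epsilon> * C) + \<epsilon> * (\<Theta> ^ n * C)) (\<lambda>y. (L ^^ Suc n) h y - (LF m ^^ Suc n) h y)"
    by (simp add: L_diff[OF bv_L_pow[OF h] bv_LF_pow[OF h]])
  moreover have "\<Theta> * (n * \<Theta> ^ n * \<epsilon> * C) + \<epsilon> * (\<Theta> ^ n * C) \<le> Suc n * \<Theta> ^ Suc n * \<epsilon> * C"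
  proof -
    have "1 * (\<epsilon> * \<Theta> ^ n * C) \<le> \<Theta> * (\<epsilon> * \<Theta> ^ n * C)"
      using Theta_ge_1 e0 C by (intro mult_right_mono) auto
    thus ?thesis by (simp add: algebra_simps)
  qed
  ultimately show ?case unfolding \<epsilon>_def by (rule bv_mono)
qed

text \<open>\<open>n\<close> is fixed first, for the contraction of the finite part;
  \<open>m\<close> is chosen afterwards, depending on \<open>n\<close>, to make the tail of the
  branches harmless. Each part contributes a quarter of \<open>C\<close>.\<close>

theorem lasota_yorke:
  obtains n K where "n > 0" "0 \<le> K"
    "\<And>C h. bv a b C h \<Longrightarrow> bv a b (C / 2 + K * (LINT x|lborel. \<bar>h x\<bar>)) ((L ^^ n) h)"
proof -
  have "(\<lambda>n. (\<rho>\<^sup>2) ^ n) \<longlonglongrightarrow> 0"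
    using rho rho_nonneg by (intro LIMSEQ_power_zero) (simp add: power_less_one_iff abs_square_less_1)
  \<comment> \<open>The factor 3 of \<open>lasota_yorke_finite\<close> turns 1/12 into 1/4.\<close>
  hence "eventually (\<lambda>n. (\<rho>\<^sup>2) ^ n < 1 / 12) sequentially" by (rule order_tendstoD) simp
  then obtain n0 where n0: "\<And>n. n \<ge> n0 \<Longrightarrow> (\<rho>\<^sup>2) ^ n < 1 / 12" by (auto simp: eventually_sequentially)
  define n where "n = Suc n0"
  have n: "n > 0" by (simp add: n_def)
  have "(\<rho>\<^sup>2) ^ n < 1 / 12" by (rule n0) (simp add: n_def)
  hence n2: "\<rho> ^ (2 * n) < 1 / 12" by (simp add: power_mult)
  define A where "A = real n * \<Theta> ^ n * 5"
  have A: "0 < A" using Theta_ge_1 n by (simp add: A_def)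
  have "(\<lambda>m. \<Sum>i. \<theta> (i + m)) \<longlonglongrightarrow> 0" by (rule suminf_exist_split2[OF theta(4)])
  hence "eventually (\<lambda>m. (\<Sum>i. \<theta> (i + m)) < 1 / (4 * A)) sequentially"
    using A by (intro order_tendstoD) auto
  then obtain m where m: "(\<Sum>i. \<theta> (i + m)) < 1 / (4 * A)" by (auto simp: eventually_sequentially)
  have "A * (\<Sum>i. \<theta> (i + m)) \<le> 1 / 4"
    using mult_left_mono[OF less_imp_le[OF m], of A] A by simp
  hence Am: "n * \<Theta> ^ n * (5 * (\<Sum>i. \<theta> (i + m))) \<le> 1 / 4" by (simp add: A_def mult.assoc)
  obtain K where K: "0 \<le> K" 
    "\<And>C h. bv a b C h \<Longrightarrow> bv a b (3 * \<rho> ^ (2 * n) * C + K * (LINT x|lborel. \<bar>h x\<bar>)) ((LF m ^^ n) h)"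
    using lasota_yorke_finite[OF n] by metis
  show ?thesis
  proof (rule that[OF n K(1)])
    fix C h assume h: "bv a b C h"
    have "bv a b (3 * \<rho> ^ (2 * n) * C + K * (LINT x|lborel. \<bar>h x\<bar>) + n * \<Theta> ^ n * (5 * (\<Sum>i. \<theta> (i + m))) * C)
      (\<lambda>y. (LF m ^^ n) h y + ((L ^^ n) h y - (LF m ^^ n) h y))"
      by (rule bv_add[OF K(2)[OF h] bv_L_pow_minus_LF_pow[OF h]])
    moreover have "3 * \<rho> ^ (2 * n) * C + n * \<Theta> ^ n * (5 * (\<Sum>i. \<theta> (i + m))) * C \<le> 1/4 * C + 1/4 * C"
      using n2 Am bv_nonneg[OF h] by (intro add_mono mult_right_mono) auto
    ultimately show "bv a b (C / 2 + K * (LINT x|lborel. \<bar>h x\<bar>)) ((L ^^ n) h)"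
      by (simp) (erule bv_mono, simp)
  qed
qed

end

section \<open>Duality\<close>

context branches
begin

text \<open>Change of variables along \<open>\<psi> i\<close>, from the image of \<open>J i\<close>
  back onto \<open>J i\<close>, with \<open>(\<psi> i y)\<^sup>2\<close> as Jacobian. The detour
  over \<open>lebesgue\<close> translates between the gauge integral and
  \<open>lborel\<close>.\<close>

lemma integral_Lb:
  assumes h: "bv a b C h" and \<phi>: "\<phi> \<in> borel_measurable borel" "\<And>x. \<bar>\<phi> x\<bar> \<le> B"
  shows "integrable lborel (\<lambda>y. Lb i h y * \<phi> y)"
    and "(LINT y|lborel. Lb i h y * \<phi> y) = (LINT x|lborel. indicator (J i) x * (h x * \<phi> (T x)))"
    and "integrable lborel (\<lambda>x. indicator (J i) x * (h x * \<phi> (T x)))"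
proof -
  note [measurable] = \<phi>(1) bv_borel[OF h] bv_borel[OF bv_Lb'[OF h]]
  define f where "f x = h x * \<phi> (T x)" for x
  have [measurable]: "f \<in> borel_measurable borel" unfolding f_def by measurable
  have bnd: "\<bar>indicator (J i) x * f x\<bar> \<le> C * B" for x
    using bv_abs_le[OF h, of x] \<phi>(2)[of "T x"] bv_nonneg[OF h] order_trans[OF abs_ge_zero \<phi>(2)]
    by (auto simp: f_def abs_mult split: split_indicator intro!: mult_mono)
  show int1: "integrable lborel (\<lambda>x. indicator (J i) x * (h x * \<phi> (T x)))"
    unfolding f_def[symmetric]
    by (rule integrable_bounded_on_interval[where a=a and b=b and C="C * B"])
      (use bnd J_sub[of i] in \<open>auto split: split_indicator\<close>)
  have S: "T ` J i \<in> sets lebesgue"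
    using real_interval_borel_measurable[OF image_J_interval] by simp
  have der: "(\<psi> i has_field_derivative (- e i / (y - c i)\<^sup>2)) (at y within T ` J i)" if "y \<in> T ` J i" for y
  proof -
    have "y - c i \<noteq> 0" using that branch[of _ i] e_sign[of i] J_nonzero[of i] by auto
    thus ?thesis unfolding \<psi>_def[abs_def]
      by (auto intro!: derivative_eq_intros simp: power2_eq_square)
  qed
  have inj: "inj_on (\<psi> i) (T ` J i)" by (auto simp: inj_on_def \<psi>_T)
  have img: "\<psi> i ` T ` J i = J i" by (force simp: \<psi>_T image_image)
  have w: "\<bar>- e i / (y - c i)\<^sup>2\<bar> = (\<psi> i y)\<^sup>2" for y
    using e_sign[of i] by (auto simp: \<psi>_def power_divide)
  have eq: "\<bar>- e i / (y - c i)\<^sup>2\<bar> *\<^sub>R f (\<psi> i y) = Lb i h y * \<phi> y" if "y \<in> T ` J i" for y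
    using that unfolding w by (auto simp: Lb_def f_def \<psi>_T)
  have ai: "f absolutely_integrable_on J i"
    unfolding set_integrable_def using int1 by (simp add: integrable_completion f_def)
  have ai': "(\<lambda>y. Lb i h y * \<phi> y) absolutely_integrable_on T ` J i"
    and ieq: "integral (T ` J i) (\<lambda>y. Lb i h y * \<phi> y) = integral (J i) f"
  proof -
    have "(\<lambda>y. \<bar>- e i / (y - c i)\<^sup>2\<bar> *\<^sub>R f (\<psi> i y)) absolutely_integrable_on T ` J i \<and>
      integral (T ` J i) (\<lambda>y. \<bar>- e i / (y - c i)\<^sup>2\<bar> *\<^sub>R f (\<psi> i y)) = integral (J i) f"
      using has_absolute_integral_change_of_variables_real[OF S der inj, of f "integral (J i) f"] ai
      by (simp only: img)
    moreover have "(\<lambda>y. \<bar>- e i / (y - c i)\<^sup>2\<bar> *\<^sub>R f (\<psi> i y)) absolutely_integrable_on T ` J i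
      \<longleftrightarrow> (\<lambda>y. Lb i h y * \<phi> y) absolutely_integrable_on T ` J i"
      unfolding set_integrable_def using eq
      by (intro Bochner_Integration.integrable_cong) (auto split: split_indicator)
    moreover have "integral (T ` J i) (\<lambda>y. \<bar>- e i / (y - c i)\<^sup>2\<bar> *\<^sub>R f (\<psi> i y))
      = integral (T ` J i) (\<lambda>y. Lb i h y * \<phi> y)"
      by (rule Henstock_Kurzweil_Integration.integral_cong) (rule eq)
    ultimately show "(\<lambda>y. Lb i h y * \<phi> y) absolutely_integrable_on T ` J i"
      "integral (T ` J i) (\<lambda>y. Lb i h y * \<phi> y) = integral (J i) f" by simp_all
  qed
  have ind: "(\<lambda>y. indicator (T ` J i) y *\<^sub>R (Lb i h y * \<phi> y)) = (\<lambda>y. Lb i h y * \<phi> y)"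
    by (auto simp: fun_eq_iff Lb_outside split: split_indicator)
  have "integrable lebesgue (\<lambda>y. Lb i h y * \<phi> y)"
    using ai' unfolding set_integrable_def ind .
  thus "integrable lborel (\<lambda>y. Lb i h y * \<phi> y)"
    by (simp add: integrable_completion)
  have "(LINT y|lborel. Lb i h y * \<phi> y) = (LINT y|lebesgue. Lb i h y * \<phi> y)"
    by (simp add: integral_completion)
  also have "\<dots> = integral (T ` J i) (\<lambda>y. Lb i h y * \<phi> y)"
    using set_lebesgue_integral_eq_integral(2)[OF ai'] unfolding set_lebesgue_integral_def ind .
  also have "\<dots> = (LINT x:J i|lebesgue. f x)"
    unfolding ieq by (rule set_lebesgue_integral_eq_integral(2)[OF ai, symmetric])
  also have "\<dots> = (LINT x|lborel. indicator (J i) x * f x)"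
    unfolding set_lebesgue_integral_def by (simp add: integral_completion)
  finally show "(LINT y|lborel. Lb i h y * \<phi> y) = (LINT x|lborel. indicator (J i) x * (h x * \<phi> (T x)))"
    unfolding f_def .
qed

text \<open>Summation of the single-branch identities. Both interchanges of sum and integral rest on
  the summability of \<open>\<theta>\<close>, and the points of \<open>{a..b}\<close> outside all
  branches form a countable set.\<close>

theorem L_duality:
  assumes h: "bv a b C h" and \<phi>: "\<phi> \<in> borel_measurable borel" "\<And>x. \<bar>\<phi> x\<bar> \<le> B"
  shows "(LINT y|lborel. L h y * \<phi> y) = (LINT x|lborel. h x * \<phi> (T x))"
proof -
  note Lbi = integral_Lb[OF h \<phi>]
  have C: "0 \<le> C" using h by (rule bv_nonneg)
  have B: "0 \<le> B" using order_trans[OF abs_ge_zero \<phi>(2)] .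
  have absb: "\<bar>Lb i h y * \<phi> y\<bar> \<le> \<theta> i * (C * B)" for i y
    using Lb_abs_le[of h C i y] bv_abs_le[OF h] \<phi>(2)[of y] theta(2)[of i] C
      mult_mono[of "\<bar>Lb i h y\<bar>" "\<theta> i * C" "\<bar>\<phi> y\<bar>" B] by (simp add: abs_mult mult.assoc)
  have bnd: "(LINT y|lborel. \<bar>Lb i h y * \<phi> y\<bar>) \<le> \<theta> i * (C * B) * (b - a)" for i
    by (rule integral_abs_le_interval) 
      (use ab absb \<phi>(1) bv_borel[OF bv_Lb'[OF h]] bv_zero_outside[OF bv_Lb'[OF h]] in auto)
  have sumb: "summable (\<lambda>i. \<theta> i * (C * B) * (b - a))"
    using theta(4) by (intro summable_mult2)
  have s1: "summable (\<lambda>i. LINT y|lborel. \<bar>Lb i h y * \<phi> y\<bar>)"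
    by (rule summable_comparison_test'[OF sumb]) (use bnd in \<open>auto simp: integral_nonneg_AE\<close>)
  \<comment> \<open>The single-branch identity for \<open>\<bar>h\<bar>\<close> and
    \<open>\<bar>\<phi>\<bar>\<close> carries the summability from the image side to the domain
    side.\<close>
  have absint: "(LINT x|lborel. \<bar>indicator (J i) x * (h x * \<phi> (T x))\<bar>) = (LINT y|lborel. \<bar>Lb i h y * \<phi> y\<bar>)" for i
    using integral_Lb(2)[OF bv_abs[OF h], of "\<lambda>x. \<bar>\<phi> x\<bar>" B i] \<phi> by (simp add: abs_mult Lb_abs)
  have "(LINT y|lborel. L h y * \<phi> y) = (LINT y|lborel. (\<Sum>i. Lb i h y * \<phi> y))"
    unfolding L_def by (simp add: suminf_mult2[OF summable_Lb[OF bv_abs_le[OF h]]])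
  also have "\<dots> = (\<Sum>i. LINT y|lborel. Lb i h y * \<phi> y)"
  proof (rule integral_suminf[OF Lbi(1)])
    have "summable (\<lambda>i. norm (Lb i h y * \<phi> y))" for y
      by (rule summable_comparison_test'[OF summable_mult2[OF theta(4), of "C * B"]]) (use absb in simp)
    thus "AE y in lborel. summable (\<lambda>i. norm (Lb i h y * \<phi> y))" by simp
  qed (use s1 in simp)
  also have "\<dots> = (\<Sum>i. LINT x|lborel. indicator (J i) x * (h x * \<phi> (T x)))"
    by (simp only: Lbi(2))
  also have "\<dots> = (LINT x|lborel. (\<Sum>i. indicator (J i) x * (h x * \<phi> (T x))))"
  proof (rule integral_suminf[OF Lbi(3), symmetric])
    have "summable (\<lambda>i. norm (indicator (J i) x * (h x * \<phi> (T x))))" for x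
    proof (cases "\<exists>k. x \<in> J k")
      case True
      then obtain k where "x \<in> J k" by blast
      thus ?thesis by (intro summable_finite[of "{k}"]) (auto dest: J_inj split: split_indicator)
    qed auto
    thus "AE x in lborel. summable (\<lambda>i. norm (indicator (J i) x * (h x * \<phi> (T x))))" by simp
    show "summable (\<lambda>i. LINT x|lborel. norm (indicator (J i) x * (h x * \<phi> (T x))))"
      using s1 by (simp add: absint[simplified])
  qed
  also have "\<dots> = (LINT x|lborel. h x * \<phi> (T x))"
  proof (rule integral_cong_AE)
    have "AE x in lborel. x \<notin> {a..b} - (\<Union>i. J i)"
      by (rule AE_not_in) (rule countable_imp_null_set_lborel[OF J_cover])
    thus "AE x in lborel. (\<Sum>i. indicator (J i) x * (h x * \<phi> (T x))) = h x * \<phi> (T x)"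
    proof (rule AE_mp, intro AE_I2 impI)
      fix x assume x: "x \<notin> {a..b} - (\<Union>i. J i)"
      show "(\<Sum>i. indicator (J i) x * (h x * \<phi> (T x))) = h x * \<phi> (T x)"
      proof (cases "x \<in> {a..b}")
        case True
        then obtain k where "x \<in> J k" using x by blast
        thus ?thesis by (subst suminf_finite[of "{k}"]) (auto dest: J_inj split: split_indicator)
      qed (simp add: bv_zero_outside[OF h])
    qed
  qed (use \<phi>(1) bv_borel[OF h] in measurable)
  finally show ?thesis .
qed

lemma L_integral: "bv a b C h \<Longrightarrow> (LINT y|lborel. L h y) = (LINT x|lborel. h x)"
  using L_duality[of C h "\<lambda>_. 1" 1] by simp

lemma L_pow_integral: "bv a b C h \<Longrightarrow> (LINT y|lborel. (L ^^ n) h y) = (LINT x|lborel. h x)"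
  by (induction n) (simp_all add: L_integral[OF bv_L_pow])

lemma L_norm:
  assumes h: "bv a b C h" shows "(LINT y|lborel. \<bar>L h y\<bar>) \<le> (LINT x|lborel. \<bar>h x\<bar>)"
proof -
  have "(LINT y|lborel. \<bar>L h y\<bar>) \<le> (LINT y|lborel. L (\<lambda>x. \<bar>h x\<bar>) y)"
    by (rule integral_mono[OF integrable_abs[OF bv_integrable[OF bv_L[OF h]]] 
        bv_integrable[OF bv_L[OF bv_abs[OF h]]] L_abs_le[OF h]])
  thus ?thesis by (simp add: L_integral[OF bv_abs[OF h]])
qed

lemma L_pow_norm:
  assumes h: "bv a b C h" and "m \<le> n"
  shows "(LINT y|lborel. \<bar>(L ^^ n) h y\<bar>) \<le> (LINT x|lborel. \<bar>(L ^^ m) h x\<bar>)"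
  using assms(2)
proof (induction n rule: dec_induct)
  case (step n) thus ?case using L_norm[OF bv_L_pow[OF h, of n]] by simp
qed simp

lemma bv_norm_le:
  assumes h: "bv a b C h" shows "(LINT x|lborel. \<bar>h x\<bar>) \<le> C * (b - a)"
  using integral_abs_le_interval[of a b h C] ab bv_borel[OF h] bv_abs_le[OF h] bv_zero_outside[OF h] by auto

end

section \<open>Exponential decay\<close>

text \<open>\<open>G\<close> is the right limit of \<open>F\<close>. \<open>Helly_selection\<close>
  asks for right-continuous functions, and the exchange alters \<open>F\<close> only at its
  countably many discontinuities, which no integral sees.\<close>

lemma mono_right_limit:
  fixes F :: "real \<Rightarrow> real"
  assumes m: "mono F" and bd: "\<And>x. \<bar>F x\<bar> \<le> M"
  shows "\<exists>G. mono G \<and> (\<forall>x. continuous (at_right x) G) \<and> (\<forall>x. \<bar>G x\<bar> \<le> M) \<and> countable {x. F x \<noteq> G x}"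
proof -
  define G where "G x = (INF y\<in>{x<..}. F y)" for x
  have bdd: "bdd_below (F ` A)" for A
    by (rule bdd_belowI2[where m = "- M"]) (use bd in \<open>simp add: abs_le_iff minus_le_iff\<close>)
  have ne: "{x<..} \<noteq> {}" for x :: real by auto
  have G_le: "G x \<le> F y" if "x < y" for x y
    unfolding G_def by (rule cINF_lower[OF bdd]) (use that in simp)
  have le_G: "F x \<le> G x" for x
    unfolding G_def by (rule cINF_greatest[OF ne]) (use m in \<open>auto simp: mono_def\<close>)
  have mG: "mono G"
    unfolding G_def by (intro monoI cINF_superset_mono bdd) auto
  show ?thesis
  proof (intro exI[of _ G] conjI allI mG)
    fix x
    show "\<bar>G x\<bar> \<le> M" using le_G[of x] G_le[of x "x + 1"] bd[of x] bd[of "x + 1"] by simp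
    show "continuous (at_right x) G"
      unfolding continuous_within
    proof (rule order_tendstoI)
      fix l assume "l < G x"
      thus "eventually (\<lambda>y. l < G y) (at_right x)"
        unfolding eventually_at_right_field using monoD[OF mG]
        by (intro exI[of _ "x + 1"]) (auto intro: less_le_trans)
    next
      fix u assume "G x < u"
      then obtain y where y: "x < y" "F y < u"
        unfolding G_def using cINF_less_iff[OF ne bdd] by auto
      thus "eventually (\<lambda>y. G y < u) (at_right x)"
        unfolding eventually_at_right_field using G_le by (intro exI[of _ y]) (auto intro: le_less_trans)
    qed
  next
    have "F x = G x" if "isCont F x" for x
    proof (rule antisym[OF le_G])
      have "(F \<longlongrightarrow> F x) (at_right x)"
        using that by (auto simp: isCont_def filterlim_at_split)
      moreover have "eventually (\<lambda>y. G x \<le> F y) (at_right x)"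
        unfolding eventually_at_right_field using G_le by (intro exI[of _ "x + 1"]) auto
      ultimately show "G x \<le> F x" by (rule tendsto_lowerbound) simp
    qed
    hence "{x. F x \<noteq> G x} \<subseteq> {x. \<not> isCont F x}" by auto
    thus "countable {x. F x \<noteq> G x}" using mono_ctble_discont[OF m] countable_subset by blast
  qed
qed

text \<open>Helly's theorem is applied to the two monotone parts \<open>v n\<close> and
  \<open>v n - h n\<close>; dominated convergence turns convergence at all but countably many points
  into convergence in L1. Right-continuity of the limit is recorded because it makes a positive
  value persist on a half-open interval.\<close>

lemma bv_helly:
  assumes "\<And>n. bv a b C (h n)" and ab: "a < b"
  obtains s g D where "strict_mono (s :: nat \<Rightarrow> nat)" "bv a b D g"
    "\<And>x. x \<in> {a<..<b} \<Longrightarrow> continuous (at_right x) g"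
    "(\<lambda>n. LINT x|lborel. \<bar>h (s n) x - g x\<bar>) \<longlonglongrightarrow> 0"
proof -
  have "\<exists>v. (\<forall>x. 0 \<le> v x \<and> v x \<le> C) \<and> dominates v (h n)" for n
    using assms(1)[of n] by (simp add: bv_def)
  then obtain v where v: "\<And>n x. 0 \<le> v n x" "\<And>n x. v n x \<le> C" "\<And>n. dominates (v n) (h n)" by metis
  have hC: "\<bar>h n x\<bar> \<le> C" for n x by (rule bv_abs_le[OF assms(1)])
  have mv: "mono (v n)" for n using dominates_mono[OF v(3)] by (auto simp: mono_def)
  have mw: "mono (\<lambda>x. v n x - h n x)" for n
  proof (rule monoI)
    fix x y :: real assume "x \<le> y"
    thus "v n x - h n x \<le> v n y - h n y" using dominatesD[OF v(3), of x y n] by linarith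
  qed
  have "\<exists>G. mono G \<and> (\<forall>x. continuous (at_right x) G) \<and> (\<forall>x. \<bar>G x\<bar> \<le> 2 * C) \<and> countable {x. v n x \<noteq> G x}" for n
  proof (rule mono_right_limit[OF mv])
    show "\<bar>v n x\<bar> \<le> 2 * C" for x using v(1)[of n x] v(2)[of n x] by linarith
  qed
  from choice[OF allI[OF this]] obtain V where "\<forall>n. mono (V n) \<and> (\<forall>x. continuous (at_right x) (V n))
    \<and> (\<forall>x. \<bar>V n x\<bar> \<le> 2 * C) \<and> countable {x. v n x \<noteq> V n x}" ..
  hence V: "\<And>n. mono (V n)" "\<And>n x. continuous (at_right x) (V n)"
    "\<And>n x. \<bar>V n x\<bar> \<le> 2 * C" "\<And>n. countable {x. v n x \<noteq> V n x}" by auto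
  have "\<exists>G. mono G \<and> (\<forall>x. continuous (at_right x) G) \<and> (\<forall>x. \<bar>G x\<bar> \<le> 2 * C) \<and> countable {x. v n x - h n x \<noteq> G x}" for n
  proof (rule mono_right_limit[OF mw])
    show "\<bar>v n x - h n x\<bar> \<le> 2 * C" for x using v(1)[of n x] v(2)[of n x] hC[of n x] by linarith
  qed
  from choice[OF allI[OF this]] obtain W where "\<forall>n. mono (W n) \<and> (\<forall>x. continuous (at_right x) (W n))
    \<and> (\<forall>x. \<bar>W n x\<bar> \<le> 2 * C) \<and> countable {x. v n x - h n x \<noteq> W n x}" ..
  hence W: "\<And>n. mono (W n)" "\<And>n x. continuous (at_right x) (W n)"
    "\<And>n x. \<bar>W n x\<bar> \<le> 2 * C" "\<And>n. countable {x. v n x - h n x \<noteq> W n x}" by auto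
  obtain s1 F1 where s1: "strict_mono s1" and F1: "\<And>x. continuous (at_right x) F1" "mono F1" 
    "\<And>x. \<bar>F1 x\<bar> \<le> 2 * C" "\<And>x. isCont F1 x \<Longrightarrow> (\<lambda>n. V (s1 n) x) \<longlonglongrightarrow> F1 x"
    using Helly_selection[of V "2 * C", OF V(2) V(1) V(3)] by blast
  obtain s2 F2 where s2: "strict_mono s2" and F2: "\<And>x. continuous (at_right x) F2" "mono F2" 
    "\<And>x. \<bar>F2 x\<bar> \<le> 2 * C" "\<And>x. isCont F2 x \<Longrightarrow> (\<lambda>n. W (s1 (s2 n)) x) \<longlonglongrightarrow> F2 x"
    using Helly_selection[of "\<lambda>n. W (s1 n)" "2 * C", OF W(2) W(1) W(3)] by blast
  define s where "s = s1 \<circ> s2"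
  define g where "g x = indicator {a<..<b} x * (F1 x - F2 x)" for x
  have dom: "dominates (\<lambda>x. F1 x + F2 x) (\<lambda>x. F1 x - F2 x)"
    using monoD[OF F1(2)] monoD[OF F2(2)] by (fastforce simp: dominates_def abs_le_iff)
  obtain t where t: "t \<in> {a<..<b}" using ab by (auto dest: dense)
  obtain D where D: "bv a b D g"
    using bv_restrict[OF dom t, of a b] unfolding g_def[abs_def] by fastforce
  have conv: "AE x in lborel. (\<lambda>n. h (s n) x) \<longlonglongrightarrow> g x"
  proof -
    define Z where "Z = {a, b} \<union> (\<Union>n. {x. v n x \<noteq> V n x}) \<union> (\<Union>n. {x. v n x - h n x \<noteq> W n x})
      \<union> {x. \<not> isCont F1 x} \<union> {x. \<not> isCont F2 x}"
    have "countable Z" unfolding Z_def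
      using V(4) W(4) mono_ctble_discont[OF F1(2)] mono_ctble_discont[OF F2(2)] by (intro countable_Un countable_UN) auto
    hence "AE x in lborel. x \<notin> Z" by (intro AE_not_in countable_imp_null_set_lborel)
    thus ?thesis
    proof (rule AE_mp, intro AE_I2 impI)
      fix x assume x: "x \<notin> Z"
      show "(\<lambda>n. h (s n) x) \<longlonglongrightarrow> g x"
      proof (cases "x \<in> {a<..<b}")
        case True
        have "(\<lambda>n. V (s1 (s2 n)) x) \<longlonglongrightarrow> F1 x"
          using LIMSEQ_subseq_LIMSEQ[OF F1(4) s2] x by (simp add: Z_def comp_def)
        moreover have "(\<lambda>n. W (s1 (s2 n)) x) \<longlonglongrightarrow> F2 x" using F2(4) x by (simp add: Z_def)
        moreover have "h (s n) x = V (s1 (s2 n)) x - W (s1 (s2 n)) x" for n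
        proof -
          have "v k x = V k x" "v k x - h k x = W k x" for k using x by (auto simp: Z_def)
          from this[of "s1 (s2 n)"] show ?thesis by (simp add: s_def)
        qed
        ultimately show ?thesis using True by (simp add: g_def tendsto_diff)
      next
        case False
        hence "x \<notin> {a..b}" using x by (auto simp: Z_def)
        hence "h n x = 0" for n by (rule bv_zero_outside[OF assms(1)])
        thus ?thesis using False by (simp add: g_def)
      qed
    qed
  qed
  have "(\<lambda>n. LINT x|lborel. \<bar>h (s n) x - g x\<bar>) \<longlonglongrightarrow> integral\<^sup>L lborel (\<lambda>x::real. 0::real)"
  proof (rule integral_dominated_convergence[where w = "\<lambda>x. (C + D) * indicator {a..b} x"])
    show "integrable lborel (\<lambda>x. (C + D) * indicator {a..b} x :: real)"
      by (intro integrable_mult_right integrable_real_indicator) (auto simp: emeasure_lborel_Icc_eq)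
    show "AE x in lborel. (\<lambda>n. \<bar>h (s n) x - g x\<bar>) \<longlonglongrightarrow> 0"
      using conv by (rule AE_mp) (intro AE_I2 impI, metis LIM_zero tendsto_rabs_zero)
    show "AE x in lborel. norm \<bar>h (s n) x - g x\<bar> \<le> (C + D) * indicator {a..b} x" for n
    proof (rule AE_I2)
      fix x show "norm \<bar>h (s n) x - g x\<bar> \<le> (C + D) * indicator {a..b} x"
        using hC[of "s n" x] bv_abs_le[OF D, of x] bv_zero_outside[OF assms(1), of x "s n"] bv_zero_outside[OF D, of x]
        by (auto split: split_indicator)
    qed
  qed (use bv_borel[OF assms(1)] bv_borel[OF D] in auto)
  moreover have "continuous (at_right x) g" if x: "x \<in> {a<..<b}" for x
  proof -
    have "((\<lambda>y. F1 y - F2 y) \<longlongrightarrow> F1 x - F2 x) (at_right x)"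
      using F1(1)[of x] F2(1)[of x] unfolding continuous_within by (intro tendsto_diff)
    moreover have "eventually (\<lambda>y. F1 y - F2 y = g y) (at_right x)"
      unfolding eventually_at_right_field using x by (intro exI[of _ b]) (auto simp: g_def)
    ultimately have "(g \<longlongrightarrow> F1 x - F2 x) (at_right x)" by (rule Lim_transform_eventually)
    thus ?thesis using x by (simp add: continuous_within g_def)
  qed
  moreover have "strict_mono s" unfolding s_def by (rule strict_mono_o[OF s1 s2])
  ultimately show ?thesis using that D by simp
qed

text \<open>The intervals are half-open to match the sets on which a right-continuous function keeps
  its sign.\<close>

locale mixing_branches = branches +
  assumes star: "x < x' \<Longrightarrow> y < y' \<Longrightarrow> {x..<x'} \<subseteq> {a..b} \<Longrightarrow> {y..<y'} \<subseteq> {a..b} \<Longrightarrow>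
    \<exists>N. 0 < emeasure lebesgue ((T ^^ N) ` {x..<x'} \<inter> (T ^^ N) ` {y..<y'})"
begin

lemma T_pow_range: "x \<in> {a..b} \<Longrightarrow> (T ^^ n) x \<in> {a..b}"
proof (induction n)
  case (Suc n) thus ?case using T_range[of "(T ^^ n) x"] by simp
qed simp

text \<open>By \<open>pos\<close> the integral of \<open>|g| + g\<close>, twice the positive part,
  is positive. So \<open>g\<close> is positive at some interior point, and right-continuity extends
  this to an interval.\<close>

lemma positive_near:
  assumes g: "bv a b D g" and cont: "\<And>x. x \<in> {a<..<b} \<Longrightarrow> continuous (at_right x) g"
    and pos: "0 < (LINT x|lborel. \<bar>g x\<bar>) + (LINT x|lborel. g x)"
  obtains x x' where "x < x'" "{x..<x'} \<subseteq> {a..b}" "\<And>y. y \<in> {x..<x'} \<Longrightarrow> 0 < g y"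
proof -
  have "\<exists>x\<in>{a<..<b}. 0 < g x"
  proof (rule ccontr)
    assume neg: "\<not> ?thesis"
    have "AE x in lborel. x \<notin> {a, b}" by (intro AE_not_in countable_imp_null_set_lborel) auto
    hence "AE x in lborel. \<bar>g x\<bar> = - g x"
    proof (rule AE_mp, intro AE_I2 impI)
      fix x assume "x \<notin> {a, b}"
      hence "x \<in> {a<..<b} \<or> x \<notin> {a..b}" by auto
      thus "\<bar>g x\<bar> = - g x" using neg bv_zero_outside[OF g] by force
    qed
    hence "(LINT x|lborel. \<bar>g x\<bar>) = (LINT x|lborel. - g x)"
      by (intro integral_cong_AE) (use bv_borel[OF g] in auto)
    thus False using pos by simp
  qed
  then obtain x where x: "x \<in> {a<..<b}" "0 < g x" by blast
  have "eventually (\<lambda>y. 0 < g y) (at_right x)"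
    using cont[OF x(1)] x(2) unfolding continuous_within by (rule order_tendstoD(1))
  then obtain z where z: "x < z" "\<And>y. x < y \<Longrightarrow> y < z \<Longrightarrow> 0 < g y"
    unfolding eventually_at_right_field by auto
  show ?thesis
  proof (rule that[of x "min z b"])
    fix y assume "y \<in> {x..<min z b}"
    thus "0 < g y" using x(2) z(2)[of y] by (cases "y = x") auto
  qed (use x z in auto)
qed

text \<open>\<open>d = L^N |g| - |L^N g|\<close> is nonnegative with integral 0, as both terms have
  the integral of \<open>|g|\<close>. At a common image of a point with \<open>g > 0\<close> and a
  point with \<open>g < 0\<close>, both \<open>L^N (|g| + g)\<close> and
  \<open>L^N (|g| - g)\<close> are positive, hence so is \<open>d\<close>, up to countably many
  exceptions. By \<open>star\<close> such common images do not form a null set.\<close>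

lemma norm_preserved_imp_zero:
  assumes g: "bv a b D g" and cont: "\<And>x. x \<in> {a<..<b} \<Longrightarrow> continuous (at_right x) g"
    and int0: "(LINT x|lborel. g x) = 0"
    and pres: "\<And>n. (LINT x|lborel. \<bar>(L ^^ n) g x\<bar>) = (LINT x|lborel. \<bar>g x\<bar>)"
  shows "(LINT x|lborel. \<bar>g x\<bar>) = 0"
proof (rule ccontr)
  assume "(LINT x|lborel. \<bar>g x\<bar>) \<noteq> 0"
  hence I: "0 < (LINT x|lborel. \<bar>g x\<bar>)" by (simp add: less_le)
  obtain p p' where p: "p < p'" "{p..<p'} \<subseteq> {a..b}" "\<And>y. y \<in> {p..<p'} \<Longrightarrow> 0 < g y"
    using positive_near[OF g cont] I int0 by auto
  have contm: "continuous (at_right x) (\<lambda>x. - g x)" if "x \<in> {a<..<b}" for x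
    using cont[OF that] by (rule continuous_minus)
  obtain q q' where q: "q < q'" "{q..<q'} \<subseteq> {a..b}" "\<And>y. y \<in> {q..<q'} \<Longrightarrow> g y < 0"
    using positive_near[OF bv_minus[OF g] contm] I int0 by auto
  obtain N where N: "0 < emeasure lebesgue ((T ^^ N) ` {p..<p'} \<inter> (T ^^ N) ` {q..<q'})"
    using star[OF p(1) q(1) p(2) q(2)] by blast
  define E where "E = {a..b} - (\<Union>i. J i)"
  \<comment> \<open>If a point of the \<open>N\<close>-th image lies outside this countable set, the
    orbits of all its preimages in \<open>{a..b}\<close> stay inside the branches before time
    \<open>N\<close>.\<close>
  define Z where "Z = (\<Union>k\<in>{..N}. (T ^^ k) ` E)"
  have "countable Z" unfolding Z_def E_def using J_cover by (intro countable_UN countable_image) auto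
  have good: "(T ^^ k) x \<in> (\<Union>i. J i)" if "x \<in> {a..b}" "(T ^^ N) x \<notin> Z" "k < N" for x k
  proof (rule ccontr)
    assume "(T ^^ k) x \<notin> (\<Union>i. J i)"
    hence "(T ^^ k) x \<in> E" using T_pow_range[OF that(1)] by (simp add: E_def)
    hence "(T ^^ (N - k)) ((T ^^ k) x) \<in> Z" unfolding Z_def by (intro UN_I[of "N - k"]) auto
    thus False using that by (simp add: funpow_add[symmetric, THEN fun_cong, simplified])
  qed
  have abs: "bv a b D (\<lambda>x. \<bar>g x\<bar>)" by (rule bv_abs[OF g])
  define d where "d y = (L ^^ N) (\<lambda>x. \<bar>g x\<bar>) y - \<bar>(L ^^ N) g y\<bar>" for y
  have d_bv: "bv a b (\<Theta> ^ N * D + \<Theta> ^ N * D) d" unfolding d_def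
    by (intro bv_diff bv_abs bv_L_pow g)
  have d0: "0 \<le> d y" for y unfolding d_def using L_pow_abs_le[OF g, of N y] by simp
  have "(LINT y|lborel. d y) = 0" unfolding d_def
    using bv_integrable[OF bv_L_pow[OF abs]] bv_integrable[OF bv_abs[OF bv_L_pow[OF g]]]
    by (subst Bochner_Integration.integral_diff) (simp_all add: L_pow_integral[OF abs] pres)
  hence dAE: "AE y in lborel. d y = 0"
    using integral_nonneg_eq_0_iff_AE[OF bv_integrable[OF d_bv]] d0 by auto
  have pos: "0 < d y" if y: "y \<in> (T ^^ N) ` {p..<p'} \<inter> (T ^^ N) ` {q..<q'}" "y \<notin> Z" for y
  proof -
    obtain x where x: "x \<in> {p..<p'}" "y = (T ^^ N) x" using y by blast
    obtain x' where x': "x' \<in> {q..<q'}" "y = (T ^^ N) x'" using y by blast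
    have "0 < (L ^^ N) (\<lambda>x. \<bar>g x\<bar> + g x) ((T ^^ N) x)"
      by (rule L_pow_T_pos[OF bv_add[OF abs g]]) (use p(2) p(3)[OF x(1)] x good[of x] y(2) in auto)
    moreover have "0 < (L ^^ N) (\<lambda>x. \<bar>g x\<bar> - g x) ((T ^^ N) x')"
      by (rule L_pow_T_pos[OF bv_diff[OF abs g]]) (use q(2) q(3)[OF x'(1)] x' good[of x'] y(2) in auto)
    ultimately show ?thesis
      unfolding d_def x(2)[symmetric] x'(2)[symmetric] L_pow_add[OF abs g] L_pow_diff[OF abs g] by linarith
  qed
  obtain Y where Y: "Y \<in> null_sets lborel" "{y. d y \<noteq> 0} \<subseteq> Y"
    using dAE unfolding eventually_ae_filter by auto
  have "(T ^^ N) ` {p..<p'} \<inter> (T ^^ N) ` {q..<q'} \<subseteq> Y \<union> Z"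
  proof
    fix y assume "y \<in> (T ^^ N) ` {p..<p'} \<inter> (T ^^ N) ` {q..<q'}"
    thus "y \<in> Y \<union> Z" using pos[of y] Y(2) by (cases "y \<in> Z") auto
  qed
  hence "emeasure lebesgue ((T ^^ N) ` {p..<p'} \<inter> (T ^^ N) ` {q..<q'}) \<le> emeasure lebesgue (Y \<union> Z)"
    using null_sets.Un[OF Y(1) countable_imp_null_set_lborel[OF \<open>countable Z\<close>]]
    by (intro emeasure_mono sets_completionI_sets) (auto simp: null_sets_def)
  also have "\<dots> = 0"
    using null_sets_completionI[OF null_sets.Un[OF Y(1) countable_imp_null_set_lborel[OF \<open>countable Z\<close>]]]
    by (simp add: null_sets_def)
  finally show False using N by simp
qed

text \<open>All powers of \<open>L\<close> contract the L1 norm. This lets the norms of the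
  \<open>m\<close>-th images pass to a limit in L1.\<close>

lemma L_pow_norm_diff:
  assumes "bv a b C g" "bv a b D h"
  shows "\<bar>(LINT x|lborel. \<bar>(L ^^ m) g x\<bar>) - (LINT x|lborel. \<bar>(L ^^ m) h x\<bar>)\<bar> \<le> (LINT x|lborel. \<bar>g x - h x\<bar>)"
proof -
  note i = bv_integrable[OF bv_abs[OF bv_L_pow[OF assms(1)]]] bv_integrable[OF bv_abs[OF bv_L_pow[OF assms(2)]]]
  have "\<bar>(LINT x|lborel. \<bar>(L ^^ m) g x\<bar>) - (LINT x|lborel. \<bar>(L ^^ m) h x\<bar>)\<bar>
    = \<bar>LINT x|lborel. \<bar>(L ^^ m) g x\<bar> - \<bar>(L ^^ m) h x\<bar>\<bar>"
    by (subst Bochner_Integration.integral_diff[OF i]) simp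
  also have "\<dots> \<le> (LINT x|lborel. \<bar>\<bar>(L ^^ m) g x\<bar> - \<bar>(L ^^ m) h x\<bar>\<bar>)"
    by (rule integral_abs_bound)
  also have "\<dots> \<le> (LINT x|lborel. \<bar>(L ^^ m) (\<lambda>x. g x - h x) x\<bar>)"
  proof (rule integral_mono)
    show "integrable lborel (\<lambda>x. \<bar>\<bar>(L ^^ m) g x\<bar> - \<bar>(L ^^ m) h x\<bar>\<bar>)"
      by (rule bv_integrable[OF bv_abs[OF bv_diff[OF bv_abs[OF bv_L_pow[OF assms(1)]] bv_abs[OF bv_L_pow[OF assms(2)]]]]])
    show "integrable lborel (\<lambda>x. \<bar>(L ^^ m) (\<lambda>x. g x - h x) x\<bar>)"
      by (rule bv_integrable[OF bv_abs[OF bv_L_pow[OF bv_diff[OF assms]]]])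
  qed (simp add: L_pow_diff[OF assms])
  also have "\<dots> \<le> (LINT x|lborel. \<bar>g x - h x\<bar>)"
    using L_pow_norm[OF bv_diff[OF assms], of 0 m] by simp
  finally show ?thesis .
qed

text \<open>Compactness makes the L1 norm small, uniformly on the unit ball \<open>H\<close>, after
  finitely many steps; the Lasota--Yorke inequality converts this into halving of the variation
  bound after \<open>q\<close> steps, and iteration gives the rate.\<close>

theorem uniform_decay:
  obtains K r where "0 \<le> K" "0 < r" "r < 1"
    "\<And>C h n. bv a b C h \<Longrightarrow> (LINT x|lborel. h x) = 0 \<Longrightarrow> bv a b (K * r ^ n * C) ((L ^^ n) h)"
proof -
  obtain p K0 where p: "p > 0" "0 \<le> K0"
    and LY: "\<And>C h. bv a b C h \<Longrightarrow> bv a b (C / 2 + K0 * (LINT x|lborel. \<bar>h x\<bar>)) ((L ^^ p) h)"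
    by (rule lasota_yorke, rule that)
  \<comment> \<open>The geometric series with ratio 1/2 accounts for the factor 2 in front of
    \<open>K0\<close>.\<close>
  have iter: "bv a b (C / 2 ^ k + 2 * K0 * (LINT x|lborel. \<bar>h x\<bar>)) ((L ^^ (p * k)) h)" if h: "bv a b C h" for C h k
  proof (induction k)
    case 0
    show ?case using p(2) by simp (rule bv_mono[OF h], simp)
  next
    case (Suc k)
    have "K0 * (LINT x|lborel. \<bar>(L ^^ (p * k)) h x\<bar>) \<le> K0 * (LINT x|lborel. \<bar>h x\<bar>)"
      using L_pow_norm[OF h, of 0 "p * k"] p(2) by (intro mult_left_mono) auto
    hence le: "(C / 2 ^ k + 2 * K0 * (LINT x|lborel. \<bar>h x\<bar>)) / 2 + K0 * (LINT x|lborel. \<bar>(L ^^ (p * k)) h x\<bar>)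
      \<le> C / 2 ^ Suc k + 2 * K0 * (LINT x|lborel. \<bar>h x\<bar>)" by (simp add: add_divide_distrib)
    show ?case using bv_mono[OF LY[OF Suc] le] by (simp add: funpow_add)
  qed
  define H where "H = {h. bv a b 1 h \<and> (LINT x|lborel. h x) = 0}"
  define \<nu> where "\<nu> k h = (LINT x|lborel. \<bar>(L ^^ (p * k)) h x\<bar>)" for k h
  have H_ne: "H \<noteq> {}" 
  proof -
    have "(\<lambda>x. 0) \<in> H" using bv_mono[OF bv_zero, of 1] by (simp add: H_def)
    thus ?thesis by blast
  qed
  have nu_le: "\<nu> k h \<le> \<nu> j h" if "bv a b C h" "j \<le> k" for j k C h
    unfolding \<nu>_def by (rule L_pow_norm[OF that(1)]) (use that(2) in simp)
  have nu_bound: "\<nu> k h \<le> b - a" if "h \<in> H" for k h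
    using nu_le[of 1 h 0 k] bv_norm_le[of 1 h] that by (simp add: H_def \<nu>_def)
  have nu_bdd: "bdd_above (\<nu> k ` H)" for k using nu_bound by (intro bdd_aboveI2)
  \<comment> \<open>Otherwise the suprema \<open>s k\<close> decrease to some positive
    \<open>\<sigma>\<close>, and a limit of near-maximisers has norm \<open>\<sigma>\<close> under
    all powers of \<open>L\<close>.\<close>
  have unif: "\<exists>k. \<forall>h\<in>H. \<nu> k h \<le> \<delta>" if \<delta>: "0 < \<delta>" for \<delta>
  proof (rule ccontr)
    assume neg: "\<not> ?thesis"
    define s where "s k = (SUP h\<in>H. \<nu> k h)" for k
    have s_ge: "\<delta> \<le> s k" for k
    proof -
      obtain h where "h \<in> H" "\<delta> < \<nu> k h" using neg by (meson not_le)
      thus ?thesis unfolding s_def using cSUP_upper[OF _ nu_bdd, of h k] by simp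
    qed
    have "decseq s" unfolding s_def
    proof (intro decseq_SucI cSUP_mono[OF H_ne nu_bdd])
      fix k h assume "h \<in> H"
      thus "\<exists>h'\<in>H. \<nu> (Suc k) h \<le> \<nu> k h'" using nu_le[of 1 h k "Suc k"] by (auto simp: H_def)
    qed
    then obtain \<sigma> where \<sigma>: "s \<longlonglongrightarrow> \<sigma>" "\<And>k. \<sigma> \<le> s k"
      using decseq_convergent[of s \<delta>] s_ge by metis
    have "\<delta> \<le> \<sigma>" using LIMSEQ_le_const[OF \<sigma>(1)] s_ge by blast
    \<comment> \<open>The index is \<open>2 * k\<close>: the first half of the iterations brings
      \<open>h k\<close> into a set of uniformly bounded variation, the second half leaves room for
      any fixed number \<open>m\<close> of further steps with norm still close to
      \<open>\<sigma>\<close>.\<close>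
    have "\<exists>h\<in>H. \<sigma> - 1 / real (Suc k) < \<nu> (2 * k) h" for k
    proof -
      have "\<sigma> - 1 / real (Suc k) < s (2 * k)" using \<sigma>(2)[of "2 * k"] by (rule order.strict_trans2[rotated]) simp
      thus ?thesis unfolding s_def less_cSUP_iff[OF H_ne nu_bdd] .
    qed
    then obtain h where h: "\<And>k. h k \<in> H" "\<And>k. \<sigma> - 1 / real (Suc k) < \<nu> (2 * k) (h k)" by metis
    have hb: "bv a b 1 (h k)" "(LINT x|lborel. h k x) = 0" for k using h(1)[of k] by (auto simp: H_def)
    define g where "g k = (L ^^ (p * k)) (h k)" for k
    have gb: "bv a b (1 + 2 * K0 * (b - a)) (g k)" for k
      unfolding g_def
    proof (rule bv_mono[OF iter[OF hb(1)[of k], of k]])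
      have "1 / 2 ^ k \<le> (1::real)" by (simp add: divide_le_eq)
      moreover have "2 * K0 * (LINT x|lborel. \<bar>h k x\<bar>) \<le> 2 * K0 * (b - a)"
        using bv_norm_le[OF hb(1)[of k]] p(2) by (intro mult_left_mono) auto
      ultimately show "1 / 2 ^ k + 2 * K0 * (LINT x|lborel. \<bar>h k x\<bar>) \<le> 1 + 2 * K0 * (b - a)" by linarith
    qed
    have g0: "(LINT x|lborel. g k x) = 0" for k
      unfolding g_def by (simp add: L_pow_integral[OF hb(1)] hb(2))
    have g_lower: "\<sigma> - 1 / real (Suc k) \<le> (LINT x|lborel. \<bar>(L ^^ m) (g k) x\<bar>)" if "m \<le> k" for m k
    proof -
      have "\<nu> (2 * k) (h k) \<le> (LINT x|lborel. \<bar>(L ^^ (m + p * k)) (h k) x\<bar>)"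
        unfolding \<nu>_def
      proof (rule L_pow_norm[OF hb(1)])
        have "m \<le> p * k" using that p(1) by (metis One_nat_def Suc_leI le_trans mult_le_mono1 nat_mult_1)
        thus "m + p * k \<le> p * (2 * k)" by (simp add: algebra_simps)
      qed
      thus ?thesis using h(2)[of k] by (simp add: g_def funpow_add)
    qed
    have g_upper: "(LINT x|lborel. \<bar>(L ^^ m) (g k) x\<bar>) \<le> s k" for m k
    proof -
      have "(LINT x|lborel. \<bar>(L ^^ m) (g k) x\<bar>) \<le> \<nu> k (h k)"
        using L_pow_norm[OF gb, of 0 m k] by (simp add: \<nu>_def g_def)
      also have "\<dots> \<le> s k" unfolding s_def by (rule cSUP_upper[OF h(1) nu_bdd])
      finally show ?thesis .
    qed
    obtain t g' D where t: "strict_mono (t :: nat \<Rightarrow> nat)" and g': "bv a b D g'"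
      and cont: "\<And>x. x \<in> {a<..<b} \<Longrightarrow> continuous (at_right x) g'"
      and lim: "(\<lambda>n. LINT x|lborel. \<bar>g (t n) x - g' x\<bar>) \<longlonglongrightarrow> 0"
      by (rule bv_helly[OF gb ab], rule that)
    have pres: "(LINT x|lborel. \<bar>(L ^^ m) g' x\<bar>) = \<sigma>" for m
    proof (rule LIMSEQ_unique)
      show "(\<lambda>n. LINT x|lborel. \<bar>(L ^^ m) (g (t n)) x\<bar>) \<longlonglongrightarrow> (LINT x|lborel. \<bar>(L ^^ m) g' x\<bar>)"
        by (rule LIM_zero_cancel, rule Lim_null_comparison[OF _ lim])
          (use L_pow_norm_diff[OF gb g'] in simp)
      show "(\<lambda>n. LINT x|lborel. \<bar>(L ^^ m) (g (t n)) x\<bar>) \<longlonglongrightarrow> \<sigma>"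
      proof (rule tendsto_sandwich[where f = "\<lambda>n. \<sigma> - 1 / real (Suc (t n))" and h = "\<lambda>n. s (t n)"])
        show "(\<lambda>n. s (t n)) \<longlonglongrightarrow> \<sigma>" using LIMSEQ_subseq_LIMSEQ[OF \<sigma>(1) t] by (simp add: comp_def)
        have "(\<lambda>k. \<sigma> - 1 / real (Suc k)) \<longlonglongrightarrow> \<sigma> - 0"
          by (intro tendsto_diff tendsto_const LIMSEQ_Suc[OF lim_1_over_n])
        from LIMSEQ_subseq_LIMSEQ[OF this t]
        show "(\<lambda>n. \<sigma> - 1 / real (Suc (t n))) \<longlonglongrightarrow> \<sigma>" by (simp add: comp_def)
        show "eventually (\<lambda>n. \<sigma> - 1 / real (Suc (t n)) \<le> (LINT x|lborel. \<bar>(L ^^ m) (g (t n)) x\<bar>)) sequentially"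
          unfolding eventually_sequentially
          by (intro exI[of _ m] allI impI g_lower) (rule le_trans[OF _ seq_suble[OF t]])
      qed (use g_upper in simp)
    qed
    have "\<bar>LINT x|lborel. g' x\<bar> \<le> (LINT x|lborel. \<bar>g (t n) x - g' x\<bar>)" for n
    proof -
      have "(LINT x|lborel. g (t n) x - g' x) = - (LINT x|lborel. g' x)"
        using bv_integrable[OF gb] bv_integrable[OF g'] by (simp add: g0)
      thus ?thesis using integral_abs_bound[of lborel "\<lambda>x. g (t n) x - g' x"] by simp
    qed
    hence "\<bar>LINT x|lborel. g' x\<bar> \<le> 0" by (intro LIMSEQ_le_const[OF lim]) auto
    hence "\<sigma> = 0" using norm_preserved_imp_zero[OF g' cont] pres pres[of 0] by simp
    thus False using \<open>\<delta> \<le> \<sigma>\<close> \<delta> by simp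
  qed
  \<comment> \<open>The constant is such that its product with \<open>2 * K0\<close> is at most
    1/4.\<close>
  obtain k1 where k1: "\<And>h. h \<in> H \<Longrightarrow> \<nu> k1 h \<le> 1 / (8 * (K0 + 1))"
    using unif[of "1 / (8 * (K0 + 1))"] p(2) by auto
  define B where "B = 1 + 2 * K0 * (b - a)"
  obtain k2 where k2: "B / 2 ^ k2 < 1 / 4"
  proof -
    have "(\<lambda>k. B / 2 ^ k) \<longlonglongrightarrow> 0"
      using tendsto_mult_right_zero[OF LIMSEQ_power_zero[of "1/2 :: real"], of B] by (simp add: power_divide)
    hence "eventually (\<lambda>k. B / 2 ^ k < 1 / 4) sequentially" by (rule order_tendstoD) simp
    thus ?thesis using that by (auto simp: eventually_sequentially)
  qed
  \<comment> \<open>\<open>k1\<close> blocks make the norm small; the other \<open>k2 + 1\<close>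
    blocks bring the contribution of the variation bound \<open>B\<close> down to 1/4.\<close>
  define q where "q = p * (k2 + k1 + 1)"
  have q0: "q > 0" using p by (simp add: q_def)
  have half1: "bv a b (1 / 2) ((L ^^ q) h)" if "h \<in> H" for h
  proof -
    have h: "bv a b 1 h" using that by (simp add: H_def)
    have b1: "bv a b B ((L ^^ (p * k1)) h)"
    proof (rule bv_mono[OF iter[OF h]])
      have "1 / 2 ^ k1 \<le> (1::real)" by (simp add: divide_le_eq)
      moreover have "2 * K0 * (LINT x|lborel. \<bar>h x\<bar>) \<le> 2 * K0 * (b - a)"
        using bv_norm_le[OF h] p(2) by (intro mult_left_mono) auto
      ultimately show "1 / 2 ^ k1 + 2 * K0 * (LINT x|lborel. \<bar>h x\<bar>) \<le> B" unfolding B_def by linarith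
    qed
    have "bv a b (B / 2 ^ (k2 + 1) + 2 * K0 * \<nu> k1 h) ((L ^^ (p * (k2 + 1))) ((L ^^ (p * k1)) h))"
      unfolding \<nu>_def by (rule iter[OF b1])
    moreover have "2 * K0 * \<nu> k1 h \<le> 2 * K0 * (1 / (8 * (K0 + 1)))"
      using k1[OF that] p(2) by (intro mult_left_mono) auto
    moreover have "2 * K0 * (1 / (8 * (K0 + 1))) \<le> 1 / 4" using p(2) by (simp add: field_simps)
    moreover have "B / 2 ^ (k2 + 1) \<le> 1 / 4" 
    proof -
      have "0 \<le> B" unfolding B_def using p(2) ab by simp
      hence "B / 2 ^ (k2 + 1) \<le> B / 2 ^ k2" by (intro divide_left_mono) auto
      thus ?thesis using k2 by linarith
    qed
    ultimately have "bv a b (1 / 2) ((L ^^ (p * (k2 + 1))) ((L ^^ (p * k1)) h))"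
      by (elim bv_mono) linarith
    moreover have "q = p * (k2 + 1) + p * k1" by (simp add: q_def algebra_simps)
    ultimately show ?thesis by (simp add: funpow_add)
  qed
  have half: "bv a b (C / 2) ((L ^^ q) h)" if h: "bv a b C h" "(LINT x|lborel. h x) = 0" for C h
  proof (cases "C = 0")
    case True
    hence "h = (\<lambda>x. 0)" using bv_abs_le[OF h(1)] by fastforce
    moreover have "(L ^^ q) (\<lambda>x. 0) = (\<lambda>x. 0)" by (induction q) (simp_all add: L_zero)
    ultimately show ?thesis using bv_zero True by simp
  next
    case False
    hence C: "0 < C" using bv_nonneg[OF h(1)] by simp
    have "(\<lambda>x. 1 / C * h x) \<in> H" unfolding H_def
      using bv_scale[OF h(1), of "1 / C"] C h(2) by simp
    hence "bv a b (\<bar>C\<bar> * (1 / 2)) (\<lambda>y. C * (L ^^ q) (\<lambda>x. 1 / C * h x) y)"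
      by (intro bv_scale half1)
    moreover have "(\<lambda>y. C * (L ^^ q) (\<lambda>x. 1 / C * h x) y) = (L ^^ q) h"
      unfolding L_pow_scale[OF h(1)] using C by simp
    ultimately show ?thesis using C by simp
  qed
  have half_pow: "bv a b (C / 2 ^ j) ((L ^^ (q * j)) h)" if h: "bv a b C h" "(LINT x|lborel. h x) = 0" for C h j
  proof (induction j)
    case (Suc j)
    have "bv a b (C / 2 ^ j / 2) ((L ^^ q) ((L ^^ (q * j)) h))"
      by (rule half[OF Suc]) (simp add: L_pow_integral[OF h(1)] h(2))
    thus ?case by (simp add: funpow_add mult.commute[of 2])
  qed (use h in simp)
  define r where "r = root q (1 / 2)"
  have r: "0 < r" "r < 1" "r ^ q = 1 / 2" using q0 by (simp_all add: r_def)
  have "\<Theta> \<ge> 0" using Theta_ge_1 by simp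
  show ?thesis
  proof (rule that[of "2 * \<Theta> ^ q" r])
    fix C h n assume h: "bv a b C h" "(LINT x|lborel. h x) = 0"
    define j i where "j = n div q" and "i = n mod q"
    have n: "n = i + q * j" by (simp add: i_def j_def)
    have i: "i < q" using q0 by (simp add: i_def)
    have "bv a b (\<Theta> ^ i * (C / 2 ^ j)) ((L ^^ i) ((L ^^ (q * j)) h))"
      by (rule bv_L_pow[OF half_pow[OF h]])
    moreover have "\<Theta> ^ i * (C / 2 ^ j) \<le> 2 * \<Theta> ^ q * r ^ n * C"
    proof -
      \<comment> \<open>As \<open>i < q\<close>, \<open>r ^ i\<close> is at least
        \<open>r ^ q = 1 / 2\<close>; the incomplete block costs a factor of at most
        \<open>2 * \<Theta> ^ q\<close>.\<close>
      have "1 \<le> 2 * r ^ i"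
        using power_decreasing[of i q r] i r by simp
      hence "(1 / 2) ^ j \<le> (2 * r ^ i) * (1 / 2) ^ j" by simp
      also have "\<dots> = 2 * r ^ n" by (simp add: n power_add power_mult r(3))
      finally have "(1 / 2) ^ j \<le> 2 * r ^ n" .
      moreover have "\<Theta> ^ i \<le> \<Theta> ^ q" using i Theta_ge_1 by (intro power_increasing) auto
      ultimately have "\<Theta> ^ i * (1 / 2) ^ j * C \<le> \<Theta> ^ q * (2 * r ^ n) * C"
        using bv_nonneg[OF h(1)] \<open>\<Theta> \<ge> 0\<close> by (intro mult_right_mono mult_mono) auto
      thus ?thesis by (simp add: power_divide mult_ac)
    qed
    ultimately show "bv a b (2 * \<Theta> ^ q * r ^ n * C) ((L ^^ n) h)"
      unfolding n by (simp only: funpow_add comp_apply) (erule bv_mono)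
  qed (use r \<open>\<Theta> \<ge> 0\<close> in auto)
qed

end

section \<open>Characteristic functions of the Birkhoff sums\<close>

context branches
begin

lemma L_sum:
  assumes "\<And>i. bv a b (C i) (h i)"
  shows "L (\<lambda>x. \<Sum>i<(n::nat). h i x) = (\<lambda>y. \<Sum>i<n. L (h i) y)"
proof (induction n)
  case (Suc n)
  have "bv a b (\<Sum>i<n. C i) (\<lambda>x. \<Sum>i<n. h i x)" using assms by (intro bv_sum) auto
  from L_add[OF this assms[of n]] show ?case using Suc by simp
qed (simp add: L_zero)

text \<open>\<open>bv_L\<close> bounds \<open>L\<close> on the tails of the series, whose constants
  tend to 0; so \<open>L\<close> may be applied termwise.\<close>

lemma L_suminf:
  assumes h: "\<And>i. bv a b (C i) (h i)" and C: "summable C"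
  shows "L (\<lambda>x. \<Sum>i. h i x) = (\<lambda>y. \<Sum>i. L (h i) y)"
proof
  fix y
  have sh: "summable (\<lambda>i. h i x)" for x
    by (rule summable_comparison_test'[OF C]) (use bv_abs_le[OF h] in auto)
  have all: "bv a b (\<Sum>i. C i) (\<lambda>x. \<Sum>i. h i x)" by (rule bv_suminf[OF h C])
  have tail: "bv a b (\<Sum>i. C (i + n)) (\<lambda>x. \<Sum>i. h (i + n) x)" for n
    by (rule bv_suminf[OF h summable_ignore_initial_segment[OF C]])
  have part: "bv a b (\<Sum>i<n. C i) (\<lambda>x. \<Sum>i<n. h i x)" for n using h by (intro bv_sum) auto
  have bound: "norm ((\<Sum>i<n. L (h i) y) - L (\<lambda>x. \<Sum>i. h i x) y) \<le> \<Theta> * (\<Sum>i. C (i + n))" for n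
  proof -
    have "(\<lambda>x. \<Sum>i. h (i + n) x) = (\<lambda>x. (\<Sum>i. h i x) - (\<Sum>i<n. h i x))"
      using suminf_minus_initial_segment[OF sh] by auto
    hence "L (\<lambda>x. \<Sum>i. h (i + n) x) y = L (\<lambda>x. \<Sum>i. h i x) y - (\<Sum>i<n. L (h i) y)"
      by (simp add: L_diff[OF all part] L_sum[OF h])
    moreover have "\<bar>L (\<lambda>x. \<Sum>i. h (i + n) x) y\<bar> \<le> \<Theta> * (\<Sum>i. C (i + n))"
      by (rule bv_abs_le[OF bv_L[OF tail]])
    ultimately show ?thesis by simp
  qed
  have "(\<lambda>n. \<Theta> * (\<Sum>i. C (i + n))) \<longlonglongrightarrow> 0"
    using tendsto_mult_right_zero[OF suminf_exist_split2[OF C]] by simp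
  from Lim_null_comparison[OF always_eventually[OF allI[OF bound]] this]
  have "(\<lambda>n. (\<Sum>i<n. L (h i) y) - L (\<lambda>x. \<Sum>i. h i x) y) \<longlonglongrightarrow> 0" .
  hence "(\<lambda>i. L (h i) y) sums L (\<lambda>x. \<Sum>i. h i x) y"
    unfolding sums_def by (rule LIM_zero_cancel)
  thus "L (\<lambda>x. \<Sum>i. h i x) y = (\<Sum>i. L (h i) y)" by (rule sums_unique)
qed

end

context mixing_branches
begin

text \<open>Neumann series from the first power on: for \<open>h\<close> with integral 0,
  \<open>g = poisson h\<close> solves \<open>g - L g = L h\<close>, that is,
  \<open>L (g + h) = g\<close>.\<close>

definition poisson :: "(real \<Rightarrow> real) \<Rightarrow> real \<Rightarrow> real" where
  "poisson h x = (\<Sum>n. (L ^^ Suc n) h x)"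

lemma poisson:
  assumes h: "bv a b C h" "(LINT x|lborel. h x) = 0"
  obtains D where "bv a b D (poisson h)" "L (\<lambda>x. poisson h x + h x) = poisson h"
proof -
  obtain K r where Kr: "0 \<le> K" "0 < r" "r < 1"
    and dec: "\<And>C h n. bv a b C h \<Longrightarrow> (LINT x|lborel. h x) = 0 \<Longrightarrow> bv a b (K * r ^ n * C) ((L ^^ n) h)"
    by (rule uniform_decay, rule that)
  have b: "bv a b (K * r ^ Suc n * C) ((L ^^ Suc n) h)" for n by (rule dec[OF h])
  have "summable (\<lambda>n. (K * r * C) * r ^ n)" using Kr by (intro summable_mult summable_geometric) auto
  hence s: "summable (\<lambda>n. K * r ^ Suc n * C)" by (simp add: mult_ac)
  have D: "bv a b (\<Sum>n. K * r ^ Suc n * C) (poisson h)"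
    unfolding poisson_def[abs_def] by (rule bv_suminf[OF b s])
  moreover have "L (\<lambda>x. poisson h x + h x) = poisson h"
  proof
    fix y
    have sm: "summable (\<lambda>n. (L ^^ Suc n) h y)"
      by (rule summable_comparison_test'[OF s]) (use bv_abs_le[OF b] in auto)
    have "L (\<lambda>x. poisson h x + h x) y = L (poisson h) y + L h y" by (simp add: L_add[OF D h(1)])
    also have "L (poisson h) y = (\<Sum>n. L ((L ^^ Suc n) h) y)"
      unfolding poisson_def[abs_def] by (simp only: L_suminf[OF b s])
    also have "\<dots> = (\<Sum>n. (L ^^ Suc (Suc n)) h y)" by simp
    also have "\<dots> = (\<Sum>n. (L ^^ Suc n) h y) - (L ^^ Suc 0) h y"
      by (rule suminf_split_head[OF sm])
    finally show "L (\<lambda>x. poisson h x + h x) y = poisson h y" by (simp add: poisson_def)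
  qed
  ultimately show ?thesis using that by blast
qed

end

text \<open>\<open>p\<close> is the density of an invariant measure. Invariance of a measure
  determines \<open>L p\<close> only up to null sets, hence the form of
  \<open>p_inv\<close>.\<close>

locale invariant_branches = mixing_branches +
  fixes p :: "real \<Rightarrow> real" and Cp :: real
  assumes p_bv: "bv a b Cp p" and p_nonneg: "\<And>x. 0 \<le> p x"
    and p_int: "(LINT x|lborel. p x) = 1" and p_inv: "AE x in lborel. L p x = p x"

locale observable = invariant_branches +
  fixes f :: "real \<Rightarrow> real" and F :: real
  assumes f_bv: "bv a b F f" and f_mean: "(LINT x|lborel. f x * p x) = 0"
begin

definition S :: "nat \<Rightarrow> real \<Rightarrow> real" where
  "S n x = (\<Sum>k<n. f ((T ^^ k) x))"

lemma S_Suc: "S (Suc n) x = f x + S n (T x)"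
  by (simp add: S_def sum.lessThan_Suc_shift funpow_Suc_right del: sum.lessThan_Suc funpow.simps(2))

lemma T_pow_borel [measurable]: "T ^^ n \<in> borel_measurable borel"
proof (induction n)
  case (Suc n)
  have "T \<circ> (T ^^ n) \<in> borel_measurable borel" using measurable_comp[OF Suc T_borel] .
  thus ?case by (simp add: comp_def)
qed (simp add: id_def)

lemma f_borel [measurable]: "f \<in> borel_measurable borel"
  by (rule bv_borel[OF f_bv])

lemma S_borel [measurable]: "S n \<in> borel_measurable borel"
  unfolding S_def[abs_def] by measurable

definition G :: "real \<Rightarrow> real" where "G = poisson (\<lambda>x. f x * p x)"

text \<open>Up to sign the coefficient of \<open>t\<^sup>2\<close> in
  \<open>exp (i t f) * (p + i t G)\<close>. Its integral is a Green--Kubo expression: half of the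
  second moment of \<open>f\<close> under \<open>p\<close> plus the sum of the correlations at
  positive times.\<close>

definition q :: "real \<Rightarrow> real" where "q x = f x * G x + f x * (f x * p x) / 2"

text \<open>Half of the asymptotic variance.\<close>

definition c2 :: real where "c2 = (LINT x|lborel. q x)"

text \<open>Subtraction of \<open>c2 * p\<close> makes the integral 0, as the Poisson equation
  demands. The subtracted multiple of \<open>p\<close> returns as the correction
  \<open>c2 * t\<^sup>2\<close> of the eigenvalue.\<close>

definition H :: "real \<Rightarrow> real" where "H = poisson (\<lambda>x. q x - c2 * p x)"

lemma fp_bv: "bv a b (2 * F * Cp) (\<lambda>x. f x * p x)"
  by (rule bv_mult[OF f_bv p_bv])

lemma G_bv: obtains CG where "bv a b CG G" "L (\<lambda>x. G x + f x * p x) = G"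
  using poisson[OF fp_bv f_mean] unfolding G_def by blast

lemma q_bv: obtains Cq where "bv a b Cq q"
proof -
  obtain CG where CG: "bv a b CG G" "L (\<lambda>x. G x + f x * p x) = G" by (rule G_bv)
  have "bv a b (2 * F * CG + \<bar>1/2\<bar> * (2 * F * (2 * F * Cp))) (\<lambda>x. f x * G x + (1/2) * (f x * (f x * p x)))"
    by (intro bv_add bv_scale bv_mult f_bv CG p_bv)
  thus ?thesis using that by (simp add: q_def[abs_def])
qed

lemma H_bv: obtains CH where "bv a b CH H" "L (\<lambda>x. H x + (q x - c2 * p x)) = H"
proof -
  obtain Cq where q: "bv a b Cq q" by (rule q_bv)
  have b: "bv a b (Cq + \<bar>c2\<bar> * Cp) (\<lambda>x. q x - c2 * p x)" by (intro bv_diff q bv_scale p_bv)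
  have "(LINT x|lborel. q x - c2 * p x) = 0"
    using bv_integrable[OF q] bv_integrable[OF p_bv] by (simp add: p_int c2_def)
  from poisson[OF b this] show ?thesis using that unfolding H_def by blast
qed

section \<open>Twisted integrals and the approximate eigenfunction\<close>

definition A :: "real \<Rightarrow> nat \<Rightarrow> (real \<Rightarrow> complex) \<Rightarrow> complex" where
  "A t n \<phi> = (LINT x|lborel. cis (t * S n x) * \<phi> x)"

lemma cis_borel [measurable]: "cis \<in> borel_measurable borel"
  by (intro borel_measurable_continuous_onI continuous_intros)

lemma integrable_cis_mult:
  assumes "integrable lborel \<phi>" "g \<in> borel_measurable borel"
  shows "integrable lborel (\<lambda>x. cis (g x) * \<phi> x)"
proof (rule Bochner_Integration.integrable_bound[OF assms(1)])
  show "(\<lambda>x. cis (g x) * \<phi> x) \<in> borel_measurable lborel"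
    using assms(2) borel_measurable_integrable[OF assms(1)] by measurable
qed (simp add: norm_mult)

lemma norm_integral_cis_mult_le:
  assumes "integrable lborel \<phi>" "g \<in> borel_measurable borel"
  shows "norm (LINT x|lborel. cis (g x) * \<phi> x) \<le> (LINT x|lborel. norm (\<phi> x))"
  using integral_norm_bound[of lborel "\<lambda>x. cis (g x) * \<phi> x"] by (simp add: norm_mult)

text \<open>\<open>L\<close> acts on real functions, so \<open>L_duality\<close> is applied to the
  cosine and the sine part separately.\<close>

lemma A_duality:
  assumes h: "bv a b C h"
  shows "(LINT x|lborel. cis (t * S n (T x)) * complex_of_real (h x)) = A t n (\<lambda>x. complex_of_real (L h x))"
proof -
  have split: "(LINT x|lborel. cis (g x) * complex_of_real (k x))
      = complex_of_real (LINT x|lborel. k x * cos (g x)) + \<i> * complex_of_real (LINT x|lborel. k x * sin (g x))"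
    if "bv a b D k" and g: "g \<in> borel_measurable borel" for k g D
  proof -
    note k = bv_integrable[OF that(1)]
    have i: "integrable lborel (\<lambda>x. k x * cos (g x))" "integrable lborel (\<lambda>x. k x * sin (g x))"
      by (rule Bochner_Integration.integrable_bound[OF k]; use g bv_borel[OF that(1)] in
          \<open>auto simp: abs_mult mult_left_le intro!: borel_measurable_times measurable_compose[OF g]\<close>)+
    have "(LINT x|lborel. cis (g x) * complex_of_real (k x))
      = (LINT x|lborel. complex_of_real (k x * cos (g x)) + \<i> * complex_of_real (k x * sin (g x)))"
      by (intro Bochner_Integration.integral_cong) (auto simp: complex_eq_iff)
    also have "\<dots> = complex_of_real (LINT x|lborel. k x * cos (g x)) + \<i> * complex_of_real (LINT x|lborel. k x * sin (g x))"
    proof -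
      have "integrable lborel (\<lambda>x. complex_of_real (k x * cos (g x)))"
        "integrable lborel (\<lambda>x. \<i> * complex_of_real (k x * sin (g x)))"
        by (intro integrable_mult_right integrable_of_real i)+
      from Bochner_Integration.integral_add[OF this] show ?thesis
        by (simp only: integral_complex_of_real integral_mult_right_zero)
    qed
    finally show ?thesis .
  qed
  have m: "(\<lambda>x. t * S n x) \<in> borel_measurable borel" "(\<lambda>x. t * S n (T x)) \<in> borel_measurable borel"
    by measurable
  show ?thesis
    unfolding A_def split[OF h m(2)] split[OF bv_L[OF h] m(1)]
    using L_duality[OF h, of "\<lambda>x. cos (t * S n x)" 1] L_duality[OF h, of "\<lambda>x. sin (t * S n x)" 1] by simp
qed

lemma A_cong_AE:
  assumes "AE x in lborel. \<phi> x = \<phi>' x" "\<phi> \<in> borel_measurable borel" "\<phi>' \<in> borel_measurable borel"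
  shows "A t n \<phi> = A t n \<phi>'"
  unfolding A_def
proof (rule integral_cong_AE)
  show "AE x in lborel. cis (t * S n x) * \<phi> x = cis (t * S n x) * \<phi>' x"
    using assms(1) by eventually_elim simp
qed (use assms in measurable)

lemma A_norm_le:
  assumes h: "bv a b C h" shows "norm (A t n (\<lambda>x. complex_of_real (h x))) \<le> C * (b - a)"
proof -
  have "norm (A t n (\<lambda>x. complex_of_real (h x))) \<le> (LINT x|lborel. norm (complex_of_real (h x)))"
    unfolding A_def by (rule norm_integral_cis_mult_le) (use bv_integrable[OF h] in auto)
  thus ?thesis using bv_norm_le[OF h] by simp
qed

definition P :: "real \<Rightarrow> real \<Rightarrow> complex" where
  "P t x = of_real (p x) + \<i> * of_real t * of_real (G x) - of_real (t\<^sup>2) * of_real (H x)"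

lemma cis_expand:
  "norm (cis u - 1) \<le> \<bar>u\<bar>" "norm (cis u - (1 + \<i> * u)) \<le> \<bar>u\<bar> ^ 2" "norm (cis u - (1 + \<i> * u - u\<^sup>2 / 2)) \<le> \<bar>u\<bar> ^ 3"
proof -
  have e: "cis u = exp (\<i> * u)" by (simp add: cis_conv_exp)
  show "norm (cis u - 1) \<le> \<bar>u\<bar>" using iexp_approx1[of u 0] by (simp add: e)
  have "norm (cis u - (1 + \<i> * u)) \<le> \<bar>u\<bar> ^ 2 / 2"
    using iexp_approx1[of u 1] by (simp add: e power2_eq_square)
  also have "\<dots> \<le> \<bar>u\<bar> ^ 2" by simp
  finally show "norm (cis u - (1 + \<i> * u)) \<le> \<bar>u\<bar> ^ 2" .
  have "norm (cis u - (1 + \<i> * u - u\<^sup>2 / 2)) \<le> \<bar>u\<bar> ^ 3 / 6"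
    using iexp_approx1[of u 2] by (simp add: e numeral_eq_Suc fact_numeral power2_eq_square algebra_simps)
  also have "\<dots> \<le> \<bar>u\<bar> ^ 3" by simp
  finally show "norm (cis u - (1 + \<i> * u - u\<^sup>2 / 2)) \<le> \<bar>u\<bar> ^ 3" .
qed

text \<open>\<open>P t\<close> is an approximate eigenfunction of the perturbed transfer operator \<open>h \<mapsto> L (e\<^bsup>itf\<^esup> h)\<close>,
  with eigenvalue \<open>1 - c2 t\<^sup>2\<close> up to an error of order three.\<close>

lemma A_step:
  obtains B where "0 \<le> B"
    "\<And>t n. \<bar>t\<bar> \<le> 1 \<Longrightarrow> norm (A t (Suc n) (P t) - of_real (1 - c2 * t\<^sup>2) * A t n (P t)) \<le> B * \<bar>t\<bar> ^ 3"
    "\<And>t n. \<bar>t\<bar> \<le> 1 \<Longrightarrow> norm (A t n (P t) - A t n (\<lambda>x. complex_of_real (p x))) \<le> B * \<bar>t\<bar>"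
proof -
  obtain CG where G: "bv a b CG G" "L (\<lambda>x. G x + f x * p x) = G" by (rule G_bv)
  obtain CH where H: "bv a b CH H" "L (\<lambda>x. H x + (q x - c2 * p x)) = H" by (rule H_bv)
  obtain Cq where q: "bv a b Cq q" by (rule q_bv)
  note nn = bv_nonneg[OF G(1)] bv_nonneg[OF H(1)] bv_nonneg[OF p_bv] bv_nonneg[OF f_bv]
  have ba: "0 \<le> b - a" using ab by simp
  define B1 where "B1 = (F ^ 3 * Cp + F ^ 2 * CG + F * CH) * (b - a)"
  define B2 where "B2 = (CG + CH) * (b - a)"
  have B12: "0 \<le> B1" "0 \<le> B2" unfolding B1_def B2_def using nn ba by auto
  have int: "integrable lborel (\<lambda>x. complex_of_real (h x))" if "bv a b C h" for C h
    using bv_integrable[OF that] by simp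
  have AP: "A t n (P t) = A t n (\<lambda>x. of_real (p x)) + \<i> * of_real t * A t n (\<lambda>x. of_real (G x)) - of_real (t\<^sup>2) * A t n (\<lambda>x. of_real (H x))" for t n
  proof -
    have m: "(\<lambda>x. t * S n x) \<in> borel_measurable borel" by measurable
    note i = integrable_cis_mult[OF int[OF p_bv] m] integrable_cis_mult[OF int[OF G(1)] m]
      integrable_cis_mult[OF int[OF H(1)] m]
    have "A t n (P t) = (LINT x|lborel. cis (t * S n x) * of_real (p x) + \<i> * of_real t * (cis (t * S n x) * of_real (G x))
      - of_real (t\<^sup>2) * (cis (t * S n x) * of_real (H x)))"
      unfolding A_def P_def by (intro Bochner_Integration.integral_cong) (auto simp: algebra_simps)
    also have "\<dots> = A t n (\<lambda>x. of_real (p x)) + \<i> * of_real t * A t n (\<lambda>x. of_real (G x)) - of_real (t\<^sup>2) * A t n (\<lambda>x. of_real (H x))"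
      unfolding A_def using i by simp
    finally show ?thesis .
  qed
  have close: "norm (A t n (P t) - A t n (\<lambda>x. complex_of_real (p x))) \<le> B2 * \<bar>t\<bar>" if t: "\<bar>t\<bar> \<le> 1" for t n
  proof -
    have "norm (A t n (P t) - A t n (\<lambda>x. complex_of_real (p x)))
      = norm (\<i> * of_real t * A t n (\<lambda>x. of_real (G x)) - of_real (t\<^sup>2) * A t n (\<lambda>x. of_real (H x)))" by (simp add: AP)
    also have "\<dots> \<le> \<bar>t\<bar> * norm (A t n (\<lambda>x. of_real (G x))) + \<bar>t\<bar>\<^sup>2 * norm (A t n (\<lambda>x. of_real (H x)))"
      by (rule order_trans[OF norm_triangle_ineq4]) (simp add: norm_mult norm_power)
    also have "\<dots> \<le> \<bar>t\<bar> * (CG * (b - a)) + \<bar>t\<bar> * (CH * (b - a))"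
      using A_norm_le[OF G(1), of t n] A_norm_le[OF H(1), of t n] t
        mult_right_le_one_le[of "\<bar>t\<bar>" "\<bar>t\<bar>"]
      by (intro add_mono mult_mono) (auto simp: power2_eq_square)
    finally show ?thesis by (simp add: B2_def algebra_simps)
  qed
  have step: "norm (A t (Suc n) (P t) - of_real (1 - c2 * t\<^sup>2) * A t n (P t)) \<le> (B1 + \<bar>c2\<bar> * B2) * \<bar>t\<bar> ^ 3" if t: "\<bar>t\<bar> \<le> 1" for t n
  proof -
    \<comment> \<open>\<open>\<Psi>\<close> collects the terms of
      \<open>cis (t * f x) * P t x\<close> up to order \<open>t\<^sup>2\<close>; \<open>R\<close> is
      the remainder.\<close>
    define \<Psi> where "\<Psi> x = of_real (p x) + \<i> * of_real t * of_real (G x + f x * p x) - of_real (t\<^sup>2) * of_real (H x + q x)" for x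
    define R where "R x = cis (t * f x) * P t x - \<Psi> x" for x
    have m: "(\<lambda>x. t * S n (T x)) \<in> borel_measurable borel" by measurable
    have Gb: "bv a b (CG + 2 * F * Cp) (\<lambda>x. G x + f x * p x)" by (rule bv_add[OF G(1) fp_bv])
    have Hb: "bv a b (CH + Cq) (\<lambda>x. H x + q x)" by (rule bv_add[OF H(1) q])
    have Hb': "bv a b (CH + (Cq + \<bar>c2\<bar> * Cp)) (\<lambda>x. H x + (q x - c2 * p x))"
      by (intro bv_add bv_diff bv_scale H q p_bv)
    note i = integrable_cis_mult[OF int[OF p_bv] m] integrable_cis_mult[OF int[OF Gb] m]
      integrable_cis_mult[OF int[OF Hb] m]
    have P_int: "integrable lborel (P t)"
      unfolding P_def using int[OF p_bv] int[OF G(1)] int[OF H(1)] by simp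
    have Psi_int: "integrable lborel \<Psi>"
      unfolding \<Psi>_def using int[OF p_bv] int[OF Gb] int[OF Hb] by simp
    have R_int: "integrable lborel R"
      unfolding R_def by (intro Bochner_Integration.integrable_diff Psi_int integrable_cis_mult P_int) measurable
    have Rb: "norm (R x) \<le> (F ^ 3 * Cp + F ^ 2 * CG + F * CH) * \<bar>t\<bar> ^ 3 * indicator {a..b} x" for x
    proof (cases "x \<in> {a..b}")
      case False
      thus ?thesis using bv_zero_outside[OF p_bv False] bv_zero_outside[OF G(1) False] bv_zero_outside[OF H(1) False]
          bv_zero_outside[OF q False] by (simp add: R_def P_def \<Psi>_def)
    next
      case True
      define u where "u = t * f x"
      have u: "\<bar>u\<bar> \<le> \<bar>t\<bar> * F" unfolding u_def abs_mult using bv_abs_le[OF f_bv] by (intro mult_left_mono) auto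
      have tri: "norm (x + y - z) \<le> norm x + norm y + norm z" for x y z :: complex
        using norm_triangle_ineq4[of "x + y" z] norm_triangle_ineq[of x y] by linarith
      \<comment> \<open>The Taylor remainder of order 3, 2 or 1 meets a coefficient of order 0, 1 or
        2 in \<open>t\<close>, so each product is of order 3.\<close>
      have Rx: "R x = (cis u - (1 + \<i> * u - u\<^sup>2 / 2)) * of_real (p x) + \<i> * of_real t * ((cis u - (1 + \<i> * u)) * of_real (G x)) - of_real (t\<^sup>2) * ((cis u - 1) * of_real (H x))"
        unfolding R_def P_def \<Psi>_def q_def u_def
        by (simp add: field_simps power2_eq_square)
      have "norm (R x) \<le> norm (cis u - (1 + \<i> * u - u\<^sup>2 / 2)) * \<bar>p x\<bar> + \<bar>t\<bar> * (norm (cis u - (1 + \<i> * u)) * \<bar>G x\<bar>)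
          + \<bar>t\<bar> ^ 2 * (norm (cis u - 1) * \<bar>H x\<bar>)"
        unfolding Rx by (rule order_trans[OF tri]) (simp add: norm_mult norm_power)
      also have "\<dots> \<le> (\<bar>t\<bar> * F) ^ 3 * Cp + \<bar>t\<bar> * ((\<bar>t\<bar> * F) ^ 2 * CG) + \<bar>t\<bar> ^ 2 * ((\<bar>t\<bar> * F) * CH)"
      proof -
        have tF: "0 \<le> \<bar>t\<bar> * F" using nn(4) by (intro mult_nonneg_nonneg) auto
        have "norm (cis u - (1 + \<i> * u - u\<^sup>2 / 2)) \<le> (\<bar>t\<bar> * F) ^ 3"
          by (rule order_trans[OF cis_expand(3) power_mono[OF u]]) simp
        hence 3: "norm (cis u - (1 + \<i> * u - u\<^sup>2 / 2)) * \<bar>p x\<bar> \<le> (\<bar>t\<bar> * F) ^ 3 * Cp"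
          using tF bv_abs_le[OF p_bv] by (intro mult_mono) auto
        have "norm (cis u - (1 + \<i> * u)) \<le> (\<bar>t\<bar> * F) ^ 2"
          by (rule order_trans[OF cis_expand(2) power_mono[OF u]]) simp
        hence 2: "norm (cis u - (1 + \<i> * u)) * \<bar>G x\<bar> \<le> (\<bar>t\<bar> * F) ^ 2 * CG"
          using tF bv_abs_le[OF G(1)] by (intro mult_mono) auto
        have 1: "norm (cis u - 1) * \<bar>H x\<bar> \<le> (\<bar>t\<bar> * F) * CH"
          using tF bv_abs_le[OF H(1)] order_trans[OF cis_expand(1) u] by (intro mult_mono) auto
        show ?thesis by (intro add_mono mult_left_mono 1 2 3) auto
      qed
      also have "\<dots> = (F ^ 3 * Cp + F ^ 2 * CG + F * CH) * \<bar>t\<bar> ^ 3"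
        by (simp add: algebra_simps power2_eq_square power3_eq_cube)
      finally show ?thesis using True by simp
    qed
    have "(LINT x|lborel. norm (R x)) \<le> (LINT x|lborel. (F ^ 3 * Cp + F ^ 2 * CG + F * CH) * \<bar>t\<bar> ^ 3 * indicator {a..b} x)"
      using R_int Rb by (intro integral_mono integrable_norm integrable_mult_right integrable_real_indicator)
        (auto simp: emeasure_lborel_Icc_eq)
    also have "\<dots> = B1 * \<bar>t\<bar> ^ 3" using ab by (simp add: B1_def)
    finally have R_le: "norm (LINT x|lborel. cis (t * S n (T x)) * R x) \<le> B1 * \<bar>t\<bar> ^ 3"
      using norm_integral_cis_mult_le[OF R_int m] by linarith
    have "A t (Suc n) (P t) = (LINT x|lborel. cis (t * S n (T x)) * \<Psi> x + cis (t * S n (T x)) * R x)"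
      unfolding A_def
      by (intro Bochner_Integration.integral_cong) (auto simp: R_def S_Suc distrib_left cis_mult[symmetric] algebra_simps)
    also have "\<dots> = (LINT x|lborel. cis (t * S n (T x)) * \<Psi> x) + (LINT x|lborel. cis (t * S n (T x)) * R x)"
      by (intro Bochner_Integration.integral_add integrable_cis_mult Psi_int R_int m)
    finally have E1: "A t (Suc n) (P t) = (LINT x|lborel. cis (t * S n (T x)) * \<Psi> x) + (LINT x|lborel. cis (t * S n (T x)) * R x)" .
    have "(LINT x|lborel. cis (t * S n (T x)) * \<Psi> x) = (LINT x|lborel. cis (t * S n (T x)) * of_real (p x)
        + \<i> * of_real t * (cis (t * S n (T x)) * of_real (G x + f x * p x)) - of_real (t\<^sup>2) * (cis (t * S n (T x)) * of_real (H x + q x)))"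
      unfolding \<Psi>_def by (intro Bochner_Integration.integral_cong) (auto simp: algebra_simps)
    also have "\<dots> = (LINT x|lborel. cis (t * S n (T x)) * of_real (p x))
        + \<i> * of_real t * (LINT x|lborel. cis (t * S n (T x)) * of_real (G x + f x * p x))
        - of_real (t\<^sup>2) * (LINT x|lborel. cis (t * S n (T x)) * of_real (H x + q x))"
      using i by simp
    finally have E2: "(LINT x|lborel. cis (t * S n (T x)) * \<Psi> x) = (LINT x|lborel. cis (t * S n (T x)) * of_real (p x))
        + \<i> * of_real t * (LINT x|lborel. cis (t * S n (T x)) * of_real (G x + f x * p x))
        - of_real (t\<^sup>2) * (LINT x|lborel. cis (t * S n (T x)) * of_real (H x + q x))" .
    have E3: "(LINT x|lborel. cis (t * S n (T x)) * of_real (p x)) = A t n (\<lambda>x. of_real (p x))"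
      unfolding A_duality[OF p_bv]
      by (rule A_cong_AE) (use p_inv bv_borel[OF bv_L[OF p_bv]] bv_borel[OF p_bv] in auto)
    have E4: "(LINT x|lborel. cis (t * S n (T x)) * of_real (G x + f x * p x)) = A t n (\<lambda>x. of_real (G x))"
      unfolding A_duality[OF Gb] G(2) ..
    \<comment> \<open>By the Poisson equation for \<open>q - c2 * p\<close>, \<open>L\<close> maps
      \<open>H + q\<close> to \<open>H + c2 * p\<close> almost everywhere.\<close>
    have E5: "(LINT x|lborel. cis (t * S n (T x)) * of_real (H x + q x)) 
      = A t n (\<lambda>x. of_real (H x)) + of_real c2 * A t n (\<lambda>x. of_real (p x))"
    proof -
      have "(\<lambda>x. H x + q x) = (\<lambda>x. (H x + (q x - c2 * p x)) + c2 * p x)" by auto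
      hence "L (\<lambda>x. H x + q x) = (\<lambda>x. H x + c2 * L p x)"
        using L_add[OF Hb' bv_scale[OF p_bv, of c2]] L_scale[OF p_bv, of c2] H(2) by simp
      hence "(LINT x|lborel. cis (t * S n (T x)) * of_real (H x + q x)) = A t n (\<lambda>x. of_real (H x + c2 * L p x))"
        unfolding A_duality[OF Hb] by simp
      also have "\<dots> = A t n (\<lambda>x. of_real (H x + c2 * p x))"
        by (rule A_cong_AE) (use p_inv bv_borel[OF bv_L[OF p_bv]] bv_borel[OF p_bv] bv_borel[OF H(1)] in auto)
      also have "\<dots> = (LINT x|lborel. cis (t * S n x) * of_real (H x) + of_real c2 * (cis (t * S n x) * of_real (p x)))"
        unfolding A_def by (intro Bochner_Integration.integral_cong) (auto simp: algebra_simps)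
      also have "\<dots> = A t n (\<lambda>x. of_real (H x)) + of_real c2 * A t n (\<lambda>x. of_real (p x))"
      proof -
        have m: "(\<lambda>x. t * S n x) \<in> borel_measurable borel" by measurable
        show ?thesis unfolding A_def 
          using integrable_cis_mult[OF int[OF p_bv] m] integrable_cis_mult[OF int[OF H(1)] m] by simp
      qed
      finally show ?thesis .
    qed
    \<comment> \<open>All terms cancel except that \<open>c2 * t\<^sup>2\<close> multiplies
      \<open>P t\<close> instead of \<open>p\<close>. The two integrals differ by order
      \<open>t\<close>, so the discrepancy is again of order 3.\<close>
    have E: "A t (Suc n) (P t) - of_real (1 - c2 * t\<^sup>2) * A t n (P t)
      = of_real (c2 * t\<^sup>2) * (A t n (P t) - A t n (\<lambda>x. of_real (p x))) + (LINT x|lborel. cis (t * S n (T x)) * R x)"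
      unfolding E1 E2 E3 E4 E5 AP[of t n] by (simp add: algebra_simps)
    have "norm (A t (Suc n) (P t) - of_real (1 - c2 * t\<^sup>2) * A t n (P t)) \<le> \<bar>c2\<bar> * \<bar>t\<bar> ^ 2 * (B2 * \<bar>t\<bar>) + B1 * \<bar>t\<bar> ^ 3"
      unfolding E using mult_left_mono[OF close[OF t, of n], of "\<bar>c2\<bar> * \<bar>t\<bar> ^ 2"]
      by (intro order_trans[OF norm_triangle_ineq] add_mono R_le) (simp add: norm_mult norm_power)
    thus ?thesis by (simp add: algebra_simps power2_eq_square power3_eq_cube)
  qed
  show ?thesis
  proof (rule that[of "B1 + \<bar>c2\<bar> * B2 + B2"])
    show "0 \<le> B1 + \<bar>c2\<bar> * B2 + B2" using B12 by simp
    fix t :: real and n assume t: "\<bar>t\<bar> \<le> 1"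
    show "norm (A t (Suc n) (P t) - of_real (1 - c2 * t\<^sup>2) * A t n (P t)) \<le> (B1 + \<bar>c2\<bar> * B2 + B2) * \<bar>t\<bar> ^ 3"
      by (rule order_trans[OF step[OF t]]) (use B12 in \<open>auto intro!: mult_right_mono\<close>)
    show "norm (A t n (P t) - A t n (\<lambda>x. complex_of_real (p x))) \<le> (B1 + \<bar>c2\<bar> * B2 + B2) * \<bar>t\<bar>"
      by (rule order_trans[OF close[OF t]]) (use B12 in \<open>auto intro!: mult_right_mono\<close>)
  qed
qed

text \<open>The conditions \<open>0 \<le> c2\<close> and \<open>c2 * t\<^sup>2 \<le> 1\<close> place
  the approximate eigenvalue between 0 and 1, so the \<open>n\<close> one-step errors of order
  \<open>t ^ 3\<close> add up without amplification. The term of order \<open>t\<close> comes from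
  exchanging \<open>P t\<close> and \<open>p\<close>, both at the start and at the end.\<close>

lemma A_asymp:
  assumes c2: "0 \<le> c2"
  obtains B where "0 \<le> B" 
    "\<And>t n. \<bar>t\<bar> \<le> 1 \<Longrightarrow> c2 * t\<^sup>2 \<le> 1 \<Longrightarrow>
      norm (A t n (\<lambda>x. of_real (p x)) - of_real ((1 - c2 * t\<^sup>2) ^ n)) \<le> B * (n * \<bar>t\<bar> ^ 3 + \<bar>t\<bar>)"
proof -
  obtain B where B: "0 \<le> B"
    "\<And>t n. \<bar>t\<bar> \<le> 1 \<Longrightarrow> norm (A t (Suc n) (P t) - of_real (1 - c2 * t\<^sup>2) * A t n (P t)) \<le> B * \<bar>t\<bar> ^ 3"
    "\<And>t n. \<bar>t\<bar> \<le> 1 \<Longrightarrow> norm (A t n (P t) - A t n (\<lambda>x. complex_of_real (p x))) \<le> B * \<bar>t\<bar>"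
    by (rule A_step, rule that)
  show ?thesis
  proof (rule that[of "2 * B"])
    fix t :: real and n assume t: "\<bar>t\<bar> \<le> 1" "c2 * t\<^sup>2 \<le> 1"
    define z where "z = 1 - c2 * t\<^sup>2"
    have z: "0 \<le> z" "z \<le> 1" using t(2) c2 by (auto simp: z_def)
    have A0: "A t 0 (\<lambda>x. of_real (p x)) = 1"
      using p_int by (simp add: A_def S_def integral_complex_of_real)
    have "norm (A t n (P t) - of_real (z ^ n)) \<le> B * \<bar>t\<bar> + n * (B * \<bar>t\<bar> ^ 3)"
    proof (induction n)
      case 0 show ?case using B(3)[OF t(1), of 0] A0 by simp
    next
      case (Suc n)
      have "A t (Suc n) (P t) - of_real (z ^ Suc n) = (A t (Suc n) (P t) - of_real z * A t n (P t))
          + of_real z * (A t n (P t) - of_real (z ^ n))" by (simp add: algebra_simps)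
      also have "norm \<dots> \<le> B * \<bar>t\<bar> ^ 3 + 1 * (B * \<bar>t\<bar> + n * (B * \<bar>t\<bar> ^ 3))"
        using B(2)[OF t(1), of n, folded z_def] mult_mono[OF z(2) Suc] z B(1)
        by (intro order_trans[OF norm_triangle_ineq] add_mono) (auto simp: norm_mult)
      finally show ?case by (simp add: algebra_simps)
    qed
    moreover have "norm (A t n (\<lambda>x. of_real (p x)) - of_real (z ^ n))
      \<le> norm (A t n (P t) - of_real (z ^ n)) + norm (A t n (P t) - A t n (\<lambda>x. complex_of_real (p x)))"
      using norm_triangle_ineq4[of "A t n (P t) - of_real (z ^ n)" "A t n (P t) - A t n (\<lambda>x. complex_of_real (p x))"]
      by simp
    moreover have "0 \<le> n * (B * \<bar>t\<bar> ^ 3)" using B(1) by simp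
    ultimately show "norm (A t n (\<lambda>x. of_real (p x)) - of_real ((1 - c2 * t\<^sup>2) ^ n)) \<le> 2 * B * (n * \<bar>t\<bar> ^ 3 + \<bar>t\<bar>)"
      using B(3)[OF t(1), of n] unfolding z_def by (simp add: algebra_simps)
  qed (use B in simp)
qed

end

section \<open>Vanishing variance\<close>

context observable
begin

definition M :: "real measure" where "M = density lborel (\<lambda>x. ennreal (p x))"

lemma p_borel [measurable]: "p \<in> borel_measurable borel"
  by (rule bv_borel[OF p_bv])

lemma sets_M [simp, measurable_cong]: "sets M = sets borel" and space_M [simp]: "space M = UNIV"
  by (simp_all add: M_def)

lemma prob_space_M: "prob_space M"
proof
  have "emeasure M (space M) = (\<integral>\<^sup>+x. ennreal (p x) \<partial>lborel)"
    by (simp add: M_def emeasure_density)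
  also have "\<dots> = ennreal (LINT x|lborel. p x)"
    by (rule nn_integral_eq_integral[OF bv_integrable[OF p_bv]]) (simp add: p_nonneg)
  finally show "emeasure M (space M) = 1" by (simp add: p_int)
qed

lemma integral_M:
  fixes g :: "real \<Rightarrow> real"
  assumes "g \<in> borel_measurable borel"
  shows "(LINT x|M. g x) = (LINT x|lborel. g x * p x)"
  unfolding M_def using assms by (subst integral_density) (auto simp: p_nonneg mult.commute)

lemma distr_M: "distr M M T = M"
proof -
  interpret prob_space M by (rule prob_space_M)
  have "measure M (T -` B) = measure M B" if B: "B \<in> sets borel" for B
  proof -
    have m: "measure M X = (LINT x|lborel. indicator X x * p x)" if "X \<in> sets borel" for X
      using integral_M[of "indicator X"] that by simp
    have TB: "T -` B \<in> sets borel" using measurable_sets[OF T_borel B] by simp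
    have "measure M (T -` B) = (LINT x|lborel. p x * indicator B (T x))"
      unfolding m[OF TB] by (intro Bochner_Integration.integral_cong) (auto split: split_indicator)
    also have "\<dots> = (LINT x|lborel. L p x * indicator B x)"
      by (rule L_duality[OF p_bv, symmetric, where B = 1]) (use B in \<open>auto split: split_indicator\<close>)
    also have "\<dots> = (LINT x|lborel. indicator B x * p x)"
      by (rule integral_cong_AE) (use p_inv B bv_borel[OF bv_L[OF p_bv]] in auto)
    finally show ?thesis by (simp add: m[OF B])
  qed
  hence "emeasure M (T -` B) = emeasure M B" if "B \<in> sets borel" for B
    using that measurable_sets[OF T_borel that] by (simp add: emeasure_eq_measure)
  thus ?thesis by (intro measure_eqI) (auto simp: emeasure_distr)
qed

text \<open>\<open>L\<close> evaluates its argument pointwise; that null sets do not matter follows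
  from contraction of the L1 norm, applied to the difference.\<close>

lemma L_cong_AE:
  assumes "bv a b C g" "bv a b D h" "AE x in lborel. g x = h x"
  shows "AE x in lborel. L g x = L h x"
proof -
  have d: "bv a b (C + D) (\<lambda>x. g x - h x)" by (rule bv_diff[OF assms(1,2)])
  have "(LINT x|lborel. \<bar>g x - h x\<bar>) = integral\<^sup>L lborel (\<lambda>x::real. 0::real)"
    by (rule integral_cong_AE) (use assms(3) bv_borel[OF d] in auto)
  hence "(LINT x|lborel. \<bar>L (\<lambda>x. g x - h x) x\<bar>) = 0"
    using L_norm[OF d] by (intro antisym) auto
  hence "AE x in lborel. \<bar>L (\<lambda>x. g x - h x) x\<bar> = 0"
    using integral_nonneg_eq_0_iff_AE[OF bv_integrable[OF bv_abs[OF bv_L[OF d]]]] by simp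
  thus ?thesis by eventually_elim (simp add: L_diff[OF assms(1,2)])
qed

lemma L_pow_p: "AE x in lborel. (L ^^ n) p x = p x"
proof (induction n)
  case (Suc n)
  have "AE x in lborel. L ((L ^^ n) p) x = L p x"
    by (rule L_cong_AE[OF bv_L_pow[OF p_bv] p_bv Suc])
  thus ?case using p_inv by eventually_elim simp
qed simp

section \<open>Iterates normalised by the density\<close>

definition iter :: "nat \<Rightarrow> real \<Rightarrow> real" where
  "iter n = (L ^^ Suc n) (\<lambda>x. f x * p x)"

lemma iter_bv: "bv a b (\<Theta> ^ Suc n * (2 * F * Cp)) (iter n)"
  unfolding iter_def by (rule bv_L_pow[OF fp_bv])

text \<open>Positivity of \<open>L\<close> and invariance of \<open>p\<close> preserve the bound
  \<open>\<bar>f * p\<bar> \<le> F * p\<close>. It controls the quotient of \<open>iter n\<close>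
  and \<open>p\<close> even where \<open>p\<close> is small.\<close>

lemma iter_le: "AE x in lborel. \<bar>iter n x\<bar> \<le> F * p x"
proof -
  have Fp: "bv a b (\<bar>F\<bar> * Cp) (\<lambda>x. F * p x)" by (rule bv_scale[OF p_bv])
  have "\<bar>iter n x\<bar> \<le> F * (L ^^ Suc n) p x" for x
  proof -
    have "\<bar>iter n x\<bar> \<le> (L ^^ Suc n) (\<lambda>x. \<bar>f x * p x\<bar>) x"
      unfolding iter_def by (rule L_pow_abs_le[OF fp_bv])
    also have "\<dots> \<le> (L ^^ Suc n) (\<lambda>x. F * p x) x"
      using L_pow_nonneg[OF bv_diff[OF Fp bv_abs[OF fp_bv]], of "Suc n" x]
        bv_abs_le[OF f_bv] p_nonneg L_pow_diff[OF Fp bv_abs[OF fp_bv], of "Suc n"]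
      by (simp add: abs_mult mult_right_mono del: funpow.simps)
    finally show ?thesis by (simp add: L_pow_scale[OF p_bv] del: funpow.simps)
  qed
  note le = this
  from L_pow_p[of "Suc n"] show ?thesis by eventually_elim (metis le)
qed

text \<open>\<open>lw n\<close> is the \<open>(n + 1)\<close>-st iterate of \<open>f\<close> under the transfer operator normalised with respect to
  \<open>p\<close>; the truncation makes the bound \<open>F\<close> hold everywhere.\<close>

definition lw :: "nat \<Rightarrow> real \<Rightarrow> real" where
  "lw n x = (if \<bar>iter n x\<bar> \<le> F * p x then iter n x / p x else 0)"

lemma F_nonneg: "0 \<le> F" by (rule bv_nonneg[OF f_bv])

lemma lw_le: "\<bar>lw n x\<bar> \<le> F"
  using p_nonneg[of x] F_nonneg by (cases "p x = 0") (auto simp: lw_def abs_divide divide_le_eq)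

lemma lw_p: "\<bar>iter n x\<bar> \<le> F * p x \<Longrightarrow> lw n x * p x = iter n x"
  by (cases "p x = 0") (auto simp: lw_def)

lemma lw_p_AE: "AE x in lborel. lw n x * p x = iter n x"
  using iter_le by eventually_elim (rule lw_p)

lemma iter_borel [measurable]: "iter n \<in> borel_measurable borel"
  by (rule bv_borel[OF iter_bv])

lemma lw_borel [measurable]: "lw n \<in> borel_measurable borel"
  unfolding lw_def[abs_def] by measurable

text \<open>Partial sum of the series for \<open>G / p\<close>. It is bounded, by
  \<open>ws_le\<close>, so all squares and products below are integrable against
  \<open>p\<close>.\<close>

definition ws :: "nat \<Rightarrow> real \<Rightarrow> real" where "ws n x = (\<Sum>i<n. lw i x)"

lemma ws_borel [measurable]: "ws n \<in> borel_measurable borel"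
  unfolding ws_def[abs_def] by measurable

lemma ws_le: "\<bar>ws n x\<bar> \<le> n * F"
  unfolding ws_def using sum_norm_le[of "{..<n}" "\<lambda>i. lw i x" "\<lambda>_. F"] lw_le by simp

definition Gs :: "nat \<Rightarrow> real \<Rightarrow> real" where "Gs n x = (\<Sum>i<n. iter i x)"

lemma Gs_bv: "bv a b (\<Sum>i<n. \<Theta> ^ Suc i * (2 * F * Cp)) (Gs n)"
  unfolding Gs_def[abs_def] by (intro bv_sum iter_bv) auto

lemma ws_p_AE: "AE x in lborel. ws n x * p x = Gs n x"
proof -
  have "AE x in lborel. \<forall>i. lw i x * p x = iter i x"
    unfolding AE_all_countable using lw_p_AE by simp
  thus ?thesis by eventually_elim (simp add: ws_def Gs_def sum_distrib_right)
qed

lemma L_Gs: "L (\<lambda>x. f x * p x + Gs n x) = Gs (Suc n)"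
proof -
  have "L (Gs n) = (\<lambda>x. \<Sum>i<n. iter (Suc i) x)"
    unfolding Gs_def[abs_def] L_sum[OF iter_bv] by (simp add: iter_def)
  moreover have "L (\<lambda>x. f x * p x) = iter 0" by (simp add: iter_def)
  ultimately have "L (\<lambda>x. f x * p x + Gs n x) = (\<lambda>x. iter 0 x + (\<Sum>i<n. iter (Suc i) x))"
    by (simp add: L_add[OF fp_bv Gs_bv])
  thus ?thesis by (simp add: Gs_def[abs_def] sum.lessThan_Suc_shift del: sum.lessThan_Suc)
qed

lemma integrable_bounded_times_bv:
  assumes "bv a b C h" "g \<in> borel_measurable borel" "\<And>x. \<bar>g x\<bar> \<le> B"
  shows "integrable lborel (\<lambda>x. g x * h x)"
proof (rule integrable_bounded_on_interval[where a = a and b = b and C = "B * C"])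
  show "\<bar>g x * h x\<bar> \<le> B * C" for x
    unfolding abs_mult using assms bv_abs_le[OF assms(1)] order_trans[OF abs_ge_zero assms(3)]
    by (intro mult_mono) auto
qed (use assms bv_borel[OF assms(1)] bv_zero_outside[OF assms(1)] in auto)

text \<open>In the expanded square, invariance identifies the integrals of the squares of
  \<open>ws n x\<close> and \<open>ws n (T x)\<close>, and duality with \<open>L_Gs\<close> rewrites
  the mixed products with \<open>ws n (T x)\<close>. All integrals of the square of
  \<open>ws n\<close> cancel, and an error involving \<open>iter n\<close> remains.\<close>

lemma variance_approx:
  "(LINT x|lborel. (f x + ws n x - ws n (T x))\<^sup>2 * p x)
    = (LINT x|lborel. f x * (f x * p x)) + 2 * (LINT x|lborel. f x * Gs n x) - 2 * (LINT x|lborel. ws n x * iter n x)"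
proof -
  have fb: "\<bar>f x\<bar> \<le> F" for x by (rule bv_abs_le[OF f_bv])
  have m2: "\<bar>g x * h x\<bar> \<le> B * D" if "\<And>x. \<bar>g x\<bar> \<le> B" "\<And>x. \<bar>h x\<bar> \<le> D" for g h :: "real \<Rightarrow> real" and B D x
    unfolding abs_mult using that order_trans[OF abs_ge_zero that(1)] by (intro mult_mono) auto
  note ib = integrable_bounded_times_bv[OF p_bv]
  have i1: "integrable lborel (\<lambda>x. f x * f x * p x)" by (rule ib[OF _ m2[OF fb fb]]) measurable
  have i2: "integrable lborel (\<lambda>x. f x * ws n x * p x)" by (rule ib[OF _ m2[OF fb ws_le]]) measurable
  have i3: "integrable lborel (\<lambda>x. ws n x * ws n x * p x)" by (rule ib[OF _ m2[OF ws_le ws_le]]) measurable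
  have i4: "integrable lborel (\<lambda>x. ws n (T x) * ws n (T x) * p x)" by (rule ib[OF _ m2[OF ws_le ws_le]]) measurable
  have i5: "integrable lborel (\<lambda>x. f x * ws n (T x) * p x)" by (rule ib[OF _ m2[OF fb ws_le]]) measurable
  have i6: "integrable lborel (\<lambda>x. ws n x * ws n (T x) * p x)" by (rule ib[OF _ m2[OF ws_le ws_le]]) measurable
  have "(LINT x|lborel. (f x + ws n x - ws n (T x))\<^sup>2 * p x)
    = (LINT x|lborel. f x * f x * p x + 2 * (f x * ws n x * p x) + ws n x * ws n x * p x + ws n (T x) * ws n (T x) * p x
       - 2 * (f x * ws n (T x) * p x + ws n x * ws n (T x) * p x))"
    by (intro Bochner_Integration.integral_cong) (auto simp: power2_eq_square algebra_simps)
  also have "\<dots> = (LINT x|lborel. f x * f x * p x) + 2 * (LINT x|lborel. f x * ws n x * p x)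
      + (LINT x|lborel. ws n x * ws n x * p x) + (LINT x|lborel. ws n (T x) * ws n (T x) * p x)
      - 2 * (LINT x|lborel. f x * ws n (T x) * p x + ws n x * ws n (T x) * p x)"
    using i1 i2 i3 i4 i5 i6 by simp
  finally have E: "(LINT x|lborel. (f x + ws n x - ws n (T x))\<^sup>2 * p x) = \<dots>" .
  have E1: "(LINT x|lborel. f x * f x * p x) = (LINT x|lborel. f x * (f x * p x))" by (simp add: mult.assoc)
  have E2: "(LINT x|lborel. f x * ws n x * p x) = (LINT x|lborel. f x * Gs n x)"
    by (rule integral_cong_AE) (use ws_p_AE[of n] bv_borel[OF Gs_bv] in \<open>auto simp: mult.assoc elim!: eventually_mono\<close>)
  have E4: "(LINT x|lborel. ws n (T x) * ws n (T x) * p x) = (LINT x|lborel. ws n x * ws n x * p x)"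
  proof -
    have "(LINT x|lborel. p x * (ws n (T x) * ws n (T x))) = (LINT x|lborel. L p x * (ws n x * ws n x))"
      by (rule L_duality[OF p_bv _ m2[OF ws_le ws_le], symmetric]) measurable
    also have "\<dots> = (LINT x|lborel. p x * (ws n x * ws n x))"
      by (rule integral_cong_AE) (use p_inv bv_borel[OF bv_L[OF p_bv]] in auto)
    finally show ?thesis by (simp add: mult_ac)
  qed
  have E5: "(LINT x|lborel. f x * ws n (T x) * p x + ws n x * ws n (T x) * p x)
    = (LINT x|lborel. ws n x * ws n x * p x) + (LINT x|lborel. ws n x * iter n x)"
  proof -
    have "(LINT x|lborel. f x * ws n (T x) * p x + ws n x * ws n (T x) * p x)
      = (LINT x|lborel. (f x * p x + Gs n x) * ws n (T x))"
    proof (rule integral_cong_AE)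
      show "AE x in lborel. f x * ws n (T x) * p x + ws n x * ws n (T x) * p x = (f x * p x + Gs n x) * ws n (T x)"
        using ws_p_AE[of n] by eventually_elim (simp add: algebra_simps)
    qed (use bv_borel[OF Gs_bv] in measurable)
    also have "\<dots> = (LINT x|lborel. Gs (Suc n) x * ws n x)"
      unfolding L_Gs[symmetric] by (rule L_duality[OF bv_add[OF fp_bv Gs_bv] _ ws_le, symmetric]) measurable
    also have "\<dots> = (LINT x|lborel. ws n x * ws n x * p x + ws n x * iter n x)"
    proof (rule integral_cong_AE)
      show "AE x in lborel. Gs (Suc n) x * ws n x = ws n x * ws n x * p x + ws n x * iter n x"
        using ws_p_AE[of n]
      proof eventually_elim
        case (elim x)
        have "Gs (Suc n) x = ws n x * p x + iter n x" unfolding elim by (simp add: Gs_def)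
        thus ?case by (simp add: algebra_simps)
      qed
    qed (use bv_borel[OF Gs_bv] in measurable)
    also have "\<dots> = (LINT x|lborel. ws n x * ws n x * p x) + (LINT x|lborel. ws n x * iter n x)"
      by (rule Bochner_Integration.integral_add[OF i3 integrable_bounded_times_bv[OF iter_bv ws_borel ws_le]])
    finally show ?thesis .
  qed
  show ?thesis unfolding E E1 E2 E4 E5 by simp
qed

lemma iter_decay:
  obtains K r where "0 \<le> K" "0 < r" "r < 1" "\<And>n x. \<bar>iter n x\<bar> \<le> K * r ^ n"
proof -
  obtain K r where Kr: "0 \<le> K" "0 < r" "r < 1"
    and dec: "\<And>C h n. bv a b C h \<Longrightarrow> (LINT x|lborel. h x) = 0 \<Longrightarrow> bv a b (K * r ^ n * C) ((L ^^ n) h)"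
    by (rule uniform_decay, rule that)
  have nn: "0 \<le> 2 * F * Cp" by (rule bv_nonneg[OF fp_bv])
  show ?thesis
  proof (rule that[of "K * (2 * F * Cp)" r])
    fix n x
    have "\<bar>iter n x\<bar> \<le> K * r ^ Suc n * (2 * F * Cp)"
      unfolding iter_def by (rule bv_abs_le[OF dec[OF fp_bv f_mean]])
    also have "\<dots> \<le> K * r ^ n * (2 * F * Cp)"
      using Kr nn by (intro mult_right_mono mult_left_mono power_decreasing) auto
    finally show "\<bar>iter n x\<bar> \<le> K * (2 * F * Cp) * r ^ n" by (simp add: mult_ac)
  qed (use Kr nn in auto)
qed

text \<open>\<open>ws n\<close> grows at most linearly while \<open>iter n\<close> decays
  geometrically, so the error term of \<open>variance_approx\<close> tends to 0; the partial sums
  \<open>Gs n\<close> converge to \<open>G\<close>.\<close>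

lemma variance_lim:
  "(\<lambda>n. LINT x|lborel. (f x + ws n x - ws n (T x))\<^sup>2 * p x) \<longlonglongrightarrow> 2 * c2"
proof -
  obtain K r where Kr: "0 \<le> K" "0 < r" "r < 1" and it: "\<And>n x. \<bar>iter n x\<bar> \<le> K * r ^ n"
    by (rule iter_decay, rule that)
  obtain CG where GB: "bv a b CG G" by (rule G_bv)
  have sumr: "summable (\<lambda>n. K * r ^ n)" using Kr by (intro summable_mult summable_geometric) auto
  have sumi: "summable (\<lambda>n. iter n x)" for x
    by (rule summable_comparison_test'[OF sumr]) (use it in auto)
  have Gx: "G x = (\<Sum>i. iter i x)" for x by (simp add: G_def poisson_def iter_def)
  have "(\<lambda>n. LINT x|lborel. f x * Gs n x) \<longlonglongrightarrow> (LINT x|lborel. f x * G x)"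
  proof (rule integral_dominated_convergence[where w = "\<lambda>x. F * (\<Sum>n. K * r ^ n) * indicator {a..b} x"])
    show "integrable lborel (\<lambda>x. F * (\<Sum>n. K * r ^ n) * indicator {a..b} x :: real)"
      by (intro integrable_mult_right integrable_real_indicator) (auto simp: emeasure_lborel_Icc_eq)
    have "(\<lambda>n. Gs n x) \<longlonglongrightarrow> G x" for x
      unfolding Gx Gs_def by (rule summable_LIMSEQ[OF sumi])
    thus "AE x in lborel. (\<lambda>n. f x * Gs n x) \<longlonglongrightarrow> f x * G x" by (intro AE_I2 tendsto_mult_left)
    show "AE x in lborel. norm (f x * Gs n x) \<le> F * (\<Sum>n. K * r ^ n) * indicator {a..b} x" for n
    proof (rule AE_I2)
      fix x
      have "\<bar>Gs n x\<bar> \<le> (\<Sum>i<n. K * r ^ i)" unfolding Gs_def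
        by (rule order_trans[OF sum_abs sum_mono]) (rule it)
      also have "\<dots> \<le> (\<Sum>i. K * r ^ i)" by (rule sum_le_suminf[OF sumr]) (use Kr in auto)
      finally have "\<bar>f x\<bar> * \<bar>Gs n x\<bar> \<le> F * (\<Sum>n. K * r ^ n)"
        using bv_abs_le[OF f_bv, of x] F_nonneg by (intro mult_mono) auto
      thus "norm (f x * Gs n x) \<le> F * (\<Sum>n. K * r ^ n) * indicator {a..b} x"
        using bv_zero_outside[OF f_bv, of x] by (auto simp: abs_mult split: split_indicator)
    qed
  qed (use bv_borel[OF Gs_bv] bv_borel[OF GB] in measurable)
  moreover have "(\<lambda>n. LINT x|lborel. ws n x * iter n x) \<longlonglongrightarrow> 0"
  proof (rule Lim_null_comparison)
    have "\<bar>ws n x * iter n x\<bar> \<le> n * F * (K * r ^ n)" for n x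
      unfolding abs_mult using ws_le it F_nonneg by (intro mult_mono) auto
    hence bnd: "(LINT x|lborel. \<bar>ws n x * iter n x\<bar>) \<le> n * F * (K * r ^ n) * (b - a)" for n
      by (intro integral_abs_le_interval) (use ab bv_zero_outside[OF iter_bv] in auto)
    show "eventually (\<lambda>n. norm (LINT x|lborel. ws n x * iter n x) \<le> n * F * (K * r ^ n) * (b - a)) sequentially"
    proof (intro always_eventually allI)
      fix n
      show "norm (LINT x|lborel. ws n x * iter n x) \<le> n * F * (K * r ^ n) * (b - a)"
        unfolding real_norm_def by (rule order_trans[OF integral_abs_bound bnd])
    qed
    have "(\<lambda>n. n * r ^ n) \<longlonglongrightarrow> 0" using powser_times_n_limit_0[of r] Kr by simp
    from tendsto_mult_right_zero[OF this, of "F * K * (b - a)"]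
    show "(\<lambda>n. n * F * (K * r ^ n) * (b - a)) \<longlonglongrightarrow> 0" by (simp add: mult_ac)
  qed
  ultimately have "(\<lambda>n. (LINT x|lborel. f x * (f x * p x)) + 2 * (LINT x|lborel. f x * Gs n x)
      - 2 * (LINT x|lborel. ws n x * iter n x))
    \<longlonglongrightarrow> (LINT x|lborel. f x * (f x * p x)) + 2 * (LINT x|lborel. f x * G x) - 2 * 0"
    by (intro tendsto_intros)
  moreover have "(LINT x|lborel. f x * (f x * p x)) + 2 * (LINT x|lborel. f x * G x) - 2 * 0 = 2 * c2"
    unfolding c2_def q_def
    using bv_integrable[OF bv_mult[OF f_bv GB]] bv_integrable[OF bv_mult[OF f_bv fp_bv]] by simp
  ultimately show ?thesis unfolding variance_approx by simp
qed

text \<open>Twice \<open>c2\<close> is a limit of integrals of squares.\<close>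

lemma c2_nonneg: "0 \<le> c2"
proof -
  have "0 \<le> 2 * c2"
    by (rule LIMSEQ_le_const[OF variance_lim]) (auto intro!: exI integral_nonneg_AE simp: p_nonneg)
  thus ?thesis by simp
qed

definition w :: "real \<Rightarrow> real" where "w x = (\<Sum>i. lw i x)"

lemma w_borel [measurable]: "w \<in> borel_measurable borel"
  unfolding w_def[abs_def] by measurable

text \<open>Two bounds are multiplied: \<open>F\<close> for \<open>\<bar>lw n\<bar>\<close>, and
  \<open>K * r ^ n\<close> for \<open>\<bar>lw n * p\<bar>\<close>. So
  \<open>\<bar>lw n\<bar> * sqrt p\<close> decays like a power of \<open>sqrt r\<close>, and the
  tails of the series are small with weight \<open>p\<close>, without any lower bound on
  \<open>p\<close>.\<close>

lemma w_bounds: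
  obtains K r where "0 \<le> K" "0 < r" "r < 1" "\<And>n x. (w x - ws n x)\<^sup>2 * p x \<le> K * r ^ n"
proof -
  obtain K r where Kr: "0 \<le> K" "0 < r" "r < 1" and it: "\<And>n x. \<bar>iter n x\<bar> \<le> K * r ^ n"
    by (rule iter_decay, rule that)
  define \<kappa> s where "\<kappa> = sqrt (F * K)" and "s = sqrt r"
  have s: "0 < s" "s < 1" "0 \<le> \<kappa>" using Kr F_nonneg by (auto simp: s_def \<kappa>_def)
  have lw_decay: "\<bar>lw n x\<bar> * sqrt (p x) \<le> \<kappa> * s ^ n" for n x
  proof (cases "\<bar>iter n x\<bar> \<le> F * p x")
    case True
    have "(lw n x)\<^sup>2 * p x = \<bar>lw n x\<bar>\<^sup>2 * p x" by simp
    also have "\<dots> = \<bar>lw n x\<bar> * \<bar>lw n x * p x\<bar>"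
      by (simp only: abs_mult power2_eq_square mult.assoc abs_of_nonneg[OF p_nonneg])
    also have "\<dots> \<le> F * (K * r ^ n)" unfolding lw_p[OF True] using lw_le it F_nonneg by (intro mult_mono) auto
    finally have "sqrt ((lw n x)\<^sup>2 * p x) \<le> sqrt (F * (K * r ^ n))" by simp
    moreover have "sqrt ((lw n x)\<^sup>2 * p x) = \<bar>lw n x\<bar> * sqrt (p x)"
      by (simp only: real_sqrt_mult real_sqrt_abs)
    moreover have "sqrt (F * (K * r ^ n)) = \<kappa> * s ^ n"
      by (simp add: real_sqrt_mult \<kappa>_def s_def real_sqrt_power)
    ultimately show ?thesis by simp
  qed (use s in \<open>auto simp: lw_def\<close>)
  have tail: "\<bar>w x - ws n x\<bar> * sqrt (p x) \<le> \<kappa> / (1 - s) * s ^ n" for n x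
  proof (cases "p x = 0")
    case True
    thus ?thesis using s by simp
  next
    case False
    hence sp: "0 < sqrt (p x)" using p_nonneg[of x] by (simp add: less_le)
    have le: "\<bar>lw n x\<bar> \<le> \<kappa> / sqrt (p x) * s ^ n" for n
      using lw_decay[of n x] sp by (simp add: field_simps)
    have sg: "summable (\<lambda>n. \<kappa> / sqrt (p x) * s ^ n)" using s by (intro summable_mult summable_geometric) auto
    have sl: "summable (\<lambda>n. \<bar>lw n x\<bar>)" by (rule summable_comparison_test'[OF sg]) (use le in auto)
    have "w x - ws n x = (\<Sum>i. lw (i + n) x)"
      unfolding w_def ws_def using suminf_minus_initial_segment[OF summable_rabs_cancel[OF sl]] by simp
    also have "\<bar>\<dots>\<bar> \<le> (\<Sum>i. \<bar>lw (i + n) x\<bar>)"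
      by (rule summable_rabs[OF summable_ignore_initial_segment[OF sl]])
    also have "\<dots> \<le> (\<Sum>i. \<kappa> / sqrt (p x) * s ^ n * s ^ i)"
    proof (rule suminf_le[OF _ summable_ignore_initial_segment[OF sl]])
      show "\<bar>lw (i + n) x\<bar> \<le> \<kappa> / sqrt (p x) * s ^ n * s ^ i" for i
        using le[of "i + n"] by (simp add: power_add mult_ac)
      show "summable (\<lambda>i. \<kappa> / sqrt (p x) * s ^ n * s ^ i)"
        using s by (intro summable_mult summable_geometric) auto
    qed
    also have "\<dots> = \<kappa> / sqrt (p x) * s ^ n * (1 / (1 - s))"
      using s by (subst suminf_mult) (auto simp: suminf_geometric summable_geometric)
    finally show ?thesis using sp s by (simp add: field_simps)
  qed
  show ?thesis
  proof (rule that[of "(\<kappa> / (1 - s))\<^sup>2" r])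
    fix n x
    have "(\<bar>w x - ws n x\<bar> * sqrt (p x))\<^sup>2 \<le> (\<kappa> / (1 - s) * s ^ n)\<^sup>2"
      using p_nonneg[of x] by (intro power_mono tail) auto
    moreover have "(s ^ n)\<^sup>2 = r ^ n" using Kr by (simp add: s_def power_mult[symmetric] mult.commute[of n] power_mult)
    ultimately show "(w x - ws n x)\<^sup>2 * p x \<le> (\<kappa> / (1 - s))\<^sup>2 * r ^ n"
      using p_nonneg[of x] by (simp add: power_mult_distrib power_divide)
  qed (use Kr in auto)
qed

lemma nn_integral_M:
  assumes "g \<in> borel_measurable borel"
  shows "(\<integral>\<^sup>+x. ennreal (g x) \<partial>M) = (\<integral>\<^sup>+x. ennreal (g x * p x) \<partial>lborel)"
  unfolding M_def using assms p_nonneg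
  by (subst nn_integral_density) (auto simp: ennreal_mult'' mult.commute intro!: nn_integral_cong)

text \<open>With \<open>w\<close> in the role of \<open>G / p\<close>, the function
  \<open>f x + w x - w (T x)\<close> differs from its truncation by two tails, which by invariance
  have the same L2 norm. For \<open>c2 = 0\<close> the truncation tends to 0 in L2, so the function
  vanishes almost everywhere and \<open>u = - w\<close> works.\<close>

theorem coboundary:
  assumes "c2 = 0"
  obtains u where "u \<in> borel_measurable borel" "integrable M (\<lambda>x. (u x)\<^sup>2)" "AE x in M. f x = u x - u (T x)"
proof -
  interpret prob_space M by (rule prob_space_M)
  obtain K r where Kr: "0 \<le> K" "0 < r" "r < 1" and wb: "\<And>n x. (w x - ws n x)\<^sup>2 * p x \<le> K * r ^ n"
    by (rule w_bounds, rule that)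
  define g where "g x = f x + w x - w (T x)" for x
  define gs where "gs n x = f x + ws n x - ws n (T x)" for n x
  have tail: "(\<integral>\<^sup>+x. ennreal ((w x - ws n x)\<^sup>2) \<partial>M) \<le> ennreal (K * r ^ n * (b - a))" for n
  proof -
    have "(\<integral>\<^sup>+x. ennreal ((w x - ws n x)\<^sup>2) \<partial>M) = (\<integral>\<^sup>+x. ennreal ((w x - ws n x)\<^sup>2 * p x) \<partial>lborel)"
      by (rule nn_integral_M) measurable
    also have "\<dots> \<le> (\<integral>\<^sup>+x. ennreal (K * r ^ n) * indicator {a..b} x \<partial>lborel)"
      using wb[of _ n] bv_zero_outside[OF p_bv] 
      by (intro nn_integral_mono) (auto split: split_indicator intro!: ennreal_leI)
    also have "\<dots> = ennreal (K * r ^ n * (b - a))"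
      using ab Kr by (simp add: nn_integral_cmult emeasure_lborel_Icc_eq ennreal_mult'')
    finally show ?thesis .
  qed
  have tailT: "(\<integral>\<^sup>+x. ennreal ((w (T x) - ws n (T x))\<^sup>2) \<partial>M) \<le> ennreal (K * r ^ n * (b - a))" for n
  proof -
    have "(\<integral>\<^sup>+x. ennreal ((w (T x) - ws n (T x))\<^sup>2) \<partial>M) = (\<integral>\<^sup>+x. ennreal ((w x - ws n x)\<^sup>2) \<partial>distr M M T)"
      by (rule nn_integral_distr[symmetric]) auto
    thus ?thesis using tail[of n] by (simp add: distr_M)
  qed
  have main: "(\<integral>\<^sup>+x. ennreal ((gs n x)\<^sup>2) \<partial>M) = ennreal (LINT x|lborel. (gs n x)\<^sup>2 * p x)" for n
  proof -
    have gsb: "\<bar>gs n x\<bar> \<le> F + n * F + n * F" for x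
      using bv_abs_le[OF f_bv, of x] ws_le[of n x] ws_le[of n "T x"] unfolding gs_def by linarith
    have "integrable lborel (\<lambda>x. (gs n x)\<^sup>2 * p x)"
    proof (rule integrable_bounded_times_bv[OF p_bv])
      show "\<bar>(gs n x)\<^sup>2\<bar> \<le> (F + n * F + n * F)\<^sup>2" for x using power_mono[OF gsb[of x], of 2] by simp
    qed (simp add: gs_def)
    moreover have "(\<integral>\<^sup>+x. ennreal ((gs n x)\<^sup>2) \<partial>M) = (\<integral>\<^sup>+x. ennreal ((gs n x)\<^sup>2 * p x) \<partial>lborel)"
      by (rule nn_integral_M) (simp add: gs_def)
    ultimately show ?thesis by (simp add: nn_integral_eq_integral p_nonneg)
  qed
  \<comment> \<open>The square of a sum of three terms is at most 3 times the sum of the squares;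
    the two tails together give the 6.\<close>
  have bound: "(\<integral>\<^sup>+x. ennreal ((g x)\<^sup>2) \<partial>M) \<le>
    ennreal (3 * (LINT x|lborel. (gs n x)\<^sup>2 * p x) + 6 * (K * r ^ n * (b - a)))" for n
  proof -
    have "(g x)\<^sup>2 \<le> 3 * (gs n x)\<^sup>2 + 3 * (w x - ws n x)\<^sup>2 + 3 * (w (T x) - ws n (T x))\<^sup>2" for x
    proof -
      have "(u + v - z)\<^sup>2 \<le> 3 * u\<^sup>2 + 3 * v\<^sup>2 + 3 * z\<^sup>2" for u v z :: real
        using sum_squares_ge_zero[of "u - v" "u + z"] zero_le_power2[of "v + z"]
        by (simp add: power2_eq_square algebra_simps)
      from this[of "gs n x" "w x - ws n x" "w (T x) - ws n (T x)"] show ?thesis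
        by (simp add: g_def gs_def algebra_simps)
    qed
    hence "(\<integral>\<^sup>+x. ennreal ((g x)\<^sup>2) \<partial>M) \<le> (\<integral>\<^sup>+x. 3 * ennreal ((gs n x)\<^sup>2) + 3 * ennreal ((w x - ws n x)\<^sup>2)
        + 3 * ennreal ((w (T x) - ws n (T x))\<^sup>2) \<partial>M)"
      by (intro nn_integral_mono) (auto simp: ennreal_plus[symmetric] ennreal_mult'[symmetric] 
          ennreal_numeral[symmetric] simp del: ennreal_plus ennreal_numeral intro!: ennreal_leI)
    also have "\<dots> = 3 * (\<integral>\<^sup>+x. ennreal ((gs n x)\<^sup>2) \<partial>M) + 3 * (\<integral>\<^sup>+x. ennreal ((w x - ws n x)\<^sup>2) \<partial>M)
        + 3 * (\<integral>\<^sup>+x. ennreal ((w (T x) - ws n (T x))\<^sup>2) \<partial>M)"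
      by (simp add: nn_integral_add nn_integral_cmult gs_def)
    also have "\<dots> \<le> 3 * ennreal (LINT x|lborel. (gs n x)\<^sup>2 * p x) + 3 * ennreal (K * r ^ n * (b - a))
        + 3 * ennreal (K * r ^ n * (b - a))"
      by (intro add_mono mult_left_mono tail tailT) (auto simp: main)
    also have "\<dots> = ennreal (3 * (LINT x|lborel. (gs n x)\<^sup>2 * p x) + 6 * (K * r ^ n * (b - a)))"
    proof -
      have "0 \<le> (LINT x|lborel. (gs n x)\<^sup>2 * p x)" by (intro integral_nonneg_AE) (simp add: p_nonneg)
      moreover have "0 \<le> K * r ^ n * (b - a)" using Kr ab by simp
      ultimately show ?thesis
        by (simp add: ennreal_plus[symmetric] ennreal_mult'[symmetric] 
          ennreal_numeral[symmetric] algebra_simps del: ennreal_plus ennreal_numeral)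
    qed
    finally show ?thesis .
  qed
  have "(\<lambda>n. 3 * (LINT x|lborel. (gs n x)\<^sup>2 * p x) + 6 * (K * r ^ n * (b - a))) \<longlonglongrightarrow> 3 * (2 * c2) + 6 * (K * 0 * (b - a))"
    unfolding gs_def using Kr by (intro tendsto_intros variance_lim LIMSEQ_power_zero) auto
  hence "(\<lambda>n. ennreal (3 * (LINT x|lborel. (gs n x)\<^sup>2 * p x) + 6 * (K * r ^ n * (b - a)))) \<longlonglongrightarrow> ennreal 0"
    using assms by (intro tendsto_ennrealI) simp
  hence "(\<integral>\<^sup>+x. ennreal ((g x)\<^sup>2) \<partial>M) \<le> ennreal 0"
    by (rule LIMSEQ_le_const) (use bound in auto)
  hence "(\<integral>\<^sup>+x. ennreal ((g x)\<^sup>2) \<partial>M) = 0" by simp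
  hence "AE x in M. ennreal ((g x)\<^sup>2) = 0"
    by (subst (asm) nn_integral_0_iff_AE) (auto simp: g_def)
  hence g0: "AE x in M. f x = - w x - (- w (T x))" by eventually_elim (simp add: g_def)
  have "integrable M (\<lambda>x. (w x)\<^sup>2)"
  proof (rule integrableI_bounded)
    have "(\<integral>\<^sup>+x. ennreal (norm ((w x)\<^sup>2)) \<partial>M) \<le> ennreal (K * r ^ 0 * (b - a))"
      using tail[of 0] by (simp add: ws_def)
    also have "\<dots> < \<infinity>" by simp
    finally show "(\<integral>\<^sup>+x. ennreal (norm ((w x)\<^sup>2)) \<partial>M) < \<infinity>" .
  qed simp
  thus ?thesis using that[of "\<lambda>x. - w x"] g0 by simp
qed

end

section \<open>The central limit theorem\<close>

context observable
begin

text \<open>For \<open>t = s / (\<sigma> * sqrt N)\<close> the error in \<open>A_asymp\<close> is of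
  order \<open>1 / sqrt N\<close>, and the main term is the \<open>N\<close>-th power of
  \<open>1 - s\<^sup>2 / (2 * N)\<close>, which tends to the characteristic function of the standard
  normal law. Levy's continuity theorem applies, and the limit law has no atoms.\<close>

theorem central_limit:
  assumes c2: "0 < c2"
  shows "(\<lambda>N. measure M {x. S N x / (sqrt (2 * c2) * sqrt (real N)) \<le> v}) \<longlonglongrightarrow> cdf std_normal_distribution v"
proof -
  interpret prob_space M by (rule prob_space_M)
  define \<sigma> where "\<sigma> = sqrt (2 * c2)"
  have \<sigma>: "0 < \<sigma>" "\<sigma>\<^sup>2 = 2 * c2" using c2 by (simp_all add: \<sigma>_def)
  define X where "X N x = S N x / (\<sigma> * sqrt (real N))" for N x
  have X [measurable]: "X N \<in> borel_measurable borel" for N unfolding X_def[abs_def] by measurable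
  have XM: "X N \<in> borel_measurable M" for N by simp
  have normal: "real_distribution std_normal_distribution" by (rule real_dist_normal_dist)
  interpret std: real_distribution std_normal_distribution by (rule normal)
  have dist: "real_distribution (distr M borel (X N))" for N by (rule real_distribution_distr) simp
  obtain B where B: "0 \<le> B"
    "\<And>t n. \<bar>t\<bar> \<le> 1 \<Longrightarrow> c2 * t\<^sup>2 \<le> 1 \<Longrightarrow>
      norm (A t n (\<lambda>x. of_real (p x)) - of_real ((1 - c2 * t\<^sup>2) ^ n)) \<le> B * (n * \<bar>t\<bar> ^ 3 + \<bar>t\<bar>)"
    by (rule A_asymp[OF c2_nonneg], rule that)
  have char_eq: "char (distr M borel (X N)) s = A (s / (\<sigma> * sqrt (real N))) N (\<lambda>x. of_real (p x))" for N s
  proof -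
    have "char (distr M borel (X N)) s = (CLINT x|M. cis (s * X N x))"
      unfolding char_def by (subst integral_distr) (auto simp: cis_conv_exp)
    also have "\<dots> = (CLINT x|lborel. p x *\<^sub>R cis (s * X N x))"
      unfolding M_def by (rule integral_density) (auto simp: p_nonneg)
    also have "\<dots> = A (s / (\<sigma> * sqrt (real N))) N (\<lambda>x. of_real (p x))"
      unfolding A_def by (intro Bochner_Integration.integral_cong) (auto simp: X_def scaleR_conv_of_real mult_ac)
    finally show ?thesis .
  qed
  have "weak_conv_m (\<lambda>N. distr M borel (X N)) std_normal_distribution"
  proof (rule levy_continuity[OF dist normal])
    fix s :: real
    define t where "t N = s / (\<sigma> * sqrt (real N))" for N :: nat
    have inv0: "(\<lambda>N. 1 / sqrt (real N)) \<longlonglongrightarrow> 0"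
      by (intro tendsto_divide_0[OF tendsto_const] filterlim_at_top_imp_at_infinity
          filterlim_compose[OF sqrt_at_top filterlim_real_sequentially])
    have t0: "t \<longlonglongrightarrow> 0"
      using tendsto_mult_right_zero[OF inv0, of "s / \<sigma>"] by (simp add: t_def[abs_def] )
    have t2: "c2 * (t N)\<^sup>2 = s\<^sup>2 / 2 / real N" for N
      using c2 \<sigma> by (simp add: t_def power_divide power_mult_distrib field_simps)
    have Nt3: "real N * \<bar>t N\<bar> ^ 3 = \<bar>s\<bar> ^ 3 / \<sigma> ^ 3 * (1 / sqrt (real N))" for N
    proof (cases "N = 0")
      case False
      hence "sqrt (real N) ^ 3 = real N * sqrt (real N)" by (simp add: power3_eq_cube)
      thus ?thesis using \<sigma>(1) False by (simp add: t_def power_divide power_mult_distrib abs_mult)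
    qed (simp add: t_def)
    have ev: "eventually (\<lambda>N. norm (A (t N) N (\<lambda>x. of_real (p x)) - of_real ((1 + (- (s\<^sup>2 / 2)) / real N) ^ N))
      \<le> B * (\<bar>s\<bar> ^ 3 / \<sigma> ^ 3 * (1 / sqrt (real N)) + \<bar>t N\<bar>)) sequentially"
    proof -
      have "eventually (\<lambda>N. \<bar>t N\<bar> < 1) sequentially"
        using tendsto_rabs_zero[OF t0] by (rule order_tendstoD) simp
      moreover have "eventually (\<lambda>N. c2 * (t N)\<^sup>2 < 1) sequentially"
      proof -
        have "(\<lambda>N. c2 * (t N)\<^sup>2) \<longlonglongrightarrow> c2 * 0\<^sup>2" by (intro tendsto_intros t0)
        thus ?thesis by (rule order_tendstoD) simp
      qed
      ultimately show ?thesis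
      proof eventually_elim
        case (elim N)
        have "norm (A (t N) N (\<lambda>x. of_real (p x)) - of_real ((1 - c2 * (t N)\<^sup>2) ^ N)) \<le> B * (N * \<bar>t N\<bar> ^ 3 + \<bar>t N\<bar>)"
          by (rule B(2)) (use elim in auto)
        thus ?case unfolding Nt3 unfolding t2 by simp
      qed
    qed
    have "(\<lambda>N. B * (\<bar>s\<bar> ^ 3 / \<sigma> ^ 3 * (1 / sqrt (real N)) + \<bar>t N\<bar>)) \<longlonglongrightarrow> B * (\<bar>s\<bar> ^ 3 / \<sigma> ^ 3 * 0 + 0)"
      by (intro tendsto_intros inv0 tendsto_rabs_zero t0)
    hence "(\<lambda>N. B * (\<bar>s\<bar> ^ 3 / \<sigma> ^ 3 * (1 / sqrt (real N)) + \<bar>t N\<bar>)) \<longlonglongrightarrow> 0" by simp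
    from Lim_null_comparison[OF ev this]
    have "(\<lambda>N. A (t N) N (\<lambda>x. of_real (p x)) - of_real ((1 + (- (s\<^sup>2 / 2)) / real N) ^ N)) \<longlonglongrightarrow> 0" .
    moreover have "(\<lambda>N. complex_of_real ((1 + (- (s\<^sup>2 / 2)) / real N) ^ N)) \<longlonglongrightarrow> complex_of_real (exp (- (s\<^sup>2 / 2)))"
      by (intro tendsto_of_real tendsto_exp_limit_sequentially)
    ultimately have "(\<lambda>N. A (t N) N (\<lambda>x. of_real (p x))) \<longlonglongrightarrow> complex_of_real (exp (- (s\<^sup>2 / 2)))"
      by (rule Lim_transform[rotated])
    thus "(\<lambda>N. char (distr M borel (X N)) s) \<longlonglongrightarrow> char std_normal_distribution s"
      unfolding char_eq t_def by (simp add: char_std_normal_distribution)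
  qed
  moreover have "isCont (cdf std_normal_distribution) v"
  proof -
    have "emeasure std_normal_distribution {v} = 0"
      by (subst emeasure_density) (auto intro!: nn_integral_null_set simp: mult.commute countable_imp_null_set_lborel)
    thus ?thesis by (simp add: std.isCont_cdf measure_def)
  qed
  ultimately have "(\<lambda>N. cdf (distr M borel (X N)) v) \<longlonglongrightarrow> cdf std_normal_distribution v"
    unfolding weak_conv_m_def weak_conv_def by blast
  moreover have "cdf (distr M borel (X N)) v = measure M {x. X N x \<le> v}" for N
    unfolding cdf_def by (subst measure_distr) (auto simp: vimage_def)
  ultimately show ?thesis by (simp add: X_def \<sigma>_def)
qed

end

lemma cdf_std_normal:
  "cdf std_normal_distribution v = 1 / sqrt (2 * pi) * (LBINT t:{..v}. exp (- (t\<^sup>2 / 2)))"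
proof -
  interpret std: real_distribution std_normal_distribution by (rule real_dist_normal_dist)
  have "cdf std_normal_distribution v = (LINT x|std_normal_distribution. indicator {..v} x)"
    by (simp add: cdf_def)
  also have "\<dots> = (LINT x|lborel. std_normal_density x *\<^sub>R indicator {..v} x)"
    by (rule integral_density) auto
  also have "\<dots> = (LINT x|lborel. 1 / sqrt (2 * pi) * (indicator {..v} x *\<^sub>R exp (- (x\<^sup>2 / 2))))"
    by (intro Bochner_Integration.integral_cong) (auto simp: std_normal_density_def)
  finally show ?thesis by (simp add: set_lebesgue_integral_def)
qed

section \<open>Iwasawa maps\<close>

text \<open>\<open>V x\<close> is the variation of \<open>g\<close> on \<open>{a..x}\<close>. As the
  function is extended by 0, the dominating function also has to jump by
  \<open>\<bar>g a\<bar>\<close> at \<open>a\<close> and by \<open>\<bar>g b\<bar>\<close> after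
  \<open>b\<close>.\<close>

lemma bounded_variation_imp_bv:
  assumes ab: "a \<le> b" and g: "bounded_variation a b g"
  obtains C where "bv a b C (\<lambda>x. if x \<in> {a..b} then g x else 0)"
proof -
  obtain C where C: "\<And>n (x :: nat \<Rightarrow> real). mono_on {..n} x \<Longrightarrow> x ` {..n} \<subseteq> {a..b} \<Longrightarrow>
    (\<Sum>i<n. \<bar>g (x (Suc i)) - g (x i)\<bar>) \<le> C"
    using g unfolding bounded_variation_def by blast
  define X where "X x = {(\<Sum>i<n. \<bar>g (s (Suc i)) - g (s i)\<bar>) |n (s :: nat \<Rightarrow> real). mono_on {..n} s \<and> s ` {..n} \<subseteq> {a..x}}" for x
  have bdd: "bdd_above (X x)" if "x \<le> b" for x
  proof (rule bdd_aboveI)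
    fix y assume "y \<in> X x"
    then obtain n and s :: "nat \<Rightarrow> real" where s: "mono_on {..n} s" "s ` {..n} \<subseteq> {a..x}" 
      "y = (\<Sum>i<n. \<bar>g (s (Suc i)) - g (s i)\<bar>)" unfolding X_def by blast
    have "s ` {..n} \<subseteq> {a..b}" using s(2) that by fastforce
    thus "y \<le> C" using C[OF s(1)] s(3) by simp
  qed
  have zero: "0 \<in> X x" if "a \<le> x" for x
    unfolding X_def by (rule CollectI, rule exI[of _ 0], rule exI[of _ "\<lambda>_. a"]) (use that in \<open>auto simp: mono_on_def\<close>)
  define V where "V x = Sup (X x)" for x
  have step: "V x + \<bar>g y - g x\<bar> \<le> V y" if xy: "a \<le> x" "x < y" "y \<le> b" for x y
  proof -
    have "V x \<le> V y - \<bar>g y - g x\<bar>"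
      unfolding V_def[of x]
    proof (rule cSup_least)
      show "X x \<noteq> {}" using zero[OF xy(1)] by blast
      fix z assume "z \<in> X x"
      then obtain n and s :: "nat \<Rightarrow> real" where s: "mono_on {..n} s" "s ` {..n} \<subseteq> {a..x}" 
        "z = (\<Sum>i<n. \<bar>g (s (Suc i)) - g (s i)\<bar>)" unfolding X_def by blast
      have sr: "a \<le> s i" "s i \<le> x" if "i \<le> n" for i using s(2) that by (auto simp: image_subset_iff)
      define t where "t i = (if i \<le> n then s i else if i = Suc n then x else y)" for i
      have "mono_on {..Suc (Suc n)} t"
      proof (rule mono_onI)
        fix i j assume "i \<in> {..Suc (Suc n)}" "j \<in> {..Suc (Suc n)}" "i \<le> j"
        thus "t i \<le> t j" using s(1) sr[of i] xy by (auto simp: t_def mono_on_def)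
      qed
      moreover have "t ` {..Suc (Suc n)} \<subseteq> {a..y}"
        using sr xy by (fastforce simp: t_def)
      ultimately have "(\<Sum>i<Suc (Suc n). \<bar>g (t (Suc i)) - g (t i)\<bar>) \<in> X y" unfolding X_def by blast
      hence "(\<Sum>i<Suc (Suc n). \<bar>g (t (Suc i)) - g (t i)\<bar>) \<le> V y"
        unfolding V_def by (rule cSup_upper[OF _ bdd[OF xy(3)]])
      moreover have "(\<Sum>i<n. \<bar>g (t (Suc i)) - g (t i)\<bar>) = z" unfolding s(3)
        by (intro sum.cong) (auto simp: t_def)
      ultimately show "z \<le> V y - \<bar>g y - g x\<bar>" by (simp add: t_def)
    qed
    thus ?thesis by simp
  qed
  have V0: "0 \<le> V x" if "a \<le> x" "x \<le> b" for x
    unfolding V_def by (rule cSup_upper[OF zero[OF that(1)] bdd[OF that(2)]])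
  have Vb: "V x + \<bar>g b - g x\<bar> \<le> V b" if "a \<le> x" "x \<le> b" for x
    using step[of x b] that by (cases "x = b") auto
  define v where "v x = (if x < a then 0 else if x \<le> b then \<bar>g a\<bar> + V x else \<bar>g a\<bar> + V b + \<bar>g b\<bar>)" for x
  have Va: "\<bar>g x\<bar> \<le> \<bar>g a\<bar> + V x" if "a \<le> x" "x \<le> b" for x
    using step[of a x] that V0[of a] V0[of x] by (cases "a = x") auto
  show ?thesis
  proof (rule that, rule bvI[where v = v and C = "\<bar>g a\<bar> + V b + \<bar>g b\<bar>"])
    fix x y :: real assume xy: "x < y"
    consider "y < a" | "x < a" "y \<in> {a..b}" | "x < a" "b < y" | "x \<in> {a..b}" "y \<in> {a..b}" | "x \<in> {a..b}" "b < y" | "b < x"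
      using xy ab by fastforce
    thus "\<bar>(if y \<in> {a..b} then g y else 0) - (if x \<in> {a..b} then g x else 0)\<bar> \<le> v y - v x"
    proof cases
      case 2 thus ?thesis using Va[of y] by (auto simp: v_def)
    next
      case 3 thus ?thesis using V0[of b] ab by (auto simp: v_def)
    next
      case 4 thus ?thesis using step[of x y] xy by (auto simp: v_def)
    next
      case 5 thus ?thesis using Vb[of x] by (auto simp: v_def)
    qed (use xy ab in \<open>auto simp: v_def\<close>)
  next
    fix x show "0 \<le> v x" "v x \<le> \<bar>g a\<bar> + V b + \<bar>g b\<bar>"
      using V0[of x] V0[of b] ab Vb[of x] by (auto simp: v_def)
  qed auto
qed

text \<open>At most one member is leftmost and at most one rightmost. Their images may be short, so
  the estimate of \<open>x\<^sup>2\<close> by the length may fail there; finitely many exceptions do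
  not affect summability.\<close>

lemma finite_leftmost_rightmost:
  assumes "\<And>K. K \<in> P \<Longrightarrow> interior K \<noteq> {}"
  shows "finite {K. leftmost P K \<or> rightmost P K}"
proof -
  have l: "K = K'" if lr: "leftmost P K" "leftmost P K'" for K K'
  proof (rule ccontr)
    assume "K \<noteq> K'"
    have P: "K \<in> P" "K' \<in> P" using lr by (simp_all add: leftmost_def)
    obtain x where x: "x \<in> interior K" using assms[OF P(1)] by blast
    obtain y where y: "y \<in> interior K'" using assms[OF P(2)] by blast
    have "x < y" "y < x" using lr P x y \<open>K \<noteq> K'\<close> unfolding leftmost_def by simp_all
    thus False by simp
  qed
  have r: "K = K'" if lr: "rightmost P K" "rightmost P K'" for K K'
  proof (rule ccontr)
    assume "K \<noteq> K'"
    have P: "K \<in> P" "K' \<in> P" using lr by (simp_all add: rightmost_def)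
    obtain x where x: "x \<in> interior K" using assms[OF P(1)] by blast
    obtain y where y: "y \<in> interior K'" using assms[OF P(2)] by blast
    have "x < y" "y < x" using lr P x y \<open>K \<noteq> K'\<close> unfolding rightmost_def by simp_all
    thus False by simp
  qed
  have fin: "finite A" if "\<And>x y. x \<in> A \<Longrightarrow> y \<in> A \<Longrightarrow> x = y" for A :: "real set set"
  proof (cases "A = {}")
    case False
    then obtain x where "x \<in> A" by blast
    hence "A \<subseteq> {x}" using that by blast
    thus ?thesis by (rule finite_subset) simp
  qed simp
  have "finite {K. leftmost P K}" "finite {K. rightmost P K}" using l r by (auto intro!: fin)
  thus ?thesis by (simp add: Collect_disj_eq)
qed

lemma countable_interval_minus_interior:
  fixes K :: "real set"
  assumes "is_interval K" "interior K \<noteq> {}" "K \<subseteq> {a..b}"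
  shows "countable (K - interior K)"
proof -
  have "convex K" using assms(1) by (simp add: is_interval_convex_1)
  have "is_interval (interior K)" using convex_interior[OF \<open>convex K\<close>] by (simp add: is_interval_convex_1)
  then obtain \<alpha> \<beta> where \<alpha>\<beta>: "\<alpha> < \<beta>" "interior K = {\<alpha><..<\<beta>}"
    using open_interval_eq[OF open_interior _ assms(2) order_trans[OF interior_subset assms(3)]] by blast
  have "K \<subseteq> closure (interior K)"
    using convex_closure_interior[OF \<open>convex K\<close> assms(2)] closure_subset by blast
  hence "K \<subseteq> {\<alpha>..\<beta>}" using \<alpha>\<beta> by simp
  hence "K - interior K \<subseteq> {\<alpha>, \<beta>}" using \<alpha>\<beta> by force
  thus ?thesis by (rule countable_subset) simp
qed

text \<open>The hypotheses on \<open>1 / x\<close> say that a branch \<open>x \<mapsto> \<plusminus>1 / x + c\<close> over \<open>J\<close> maps into \<open>{a..b}\<close> and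
  covers at least half of its length.\<close>

lemma square_le_measure:
  fixes J :: "real set"
  assumes J: "open J" "is_interval J" "J \<subseteq> {a..b}" "0 \<notin> J" and ab: "a < b" "\<bar>a\<bar> \<le> 1" "\<bar>b\<bar> \<le> 1"
    and osc: "\<And>x y. x \<in> J \<Longrightarrow> y \<in> J \<Longrightarrow> \<bar>1 / x - 1 / y\<bar> \<le> b - a"
    and xy: "x \<in> J" "y \<in> J" "(b - a) / 2 \<le> \<bar>1 / x - 1 / y\<bar>" and z: "z \<in> J"
  shows "z\<^sup>2 \<le> 18 / (b - a) * measure lborel J"
proof -
  obtain \<alpha> \<beta> where \<alpha>\<beta>: "\<alpha> < \<beta>" "J = {\<alpha><..<\<beta>}"
    using open_interval_eq[OF J(1,2) _ J(3)] xy(1) by blast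
  have nz: "x \<noteq> 0" "y \<noteq> 0" "z \<noteq> 0" using J(4) xy z by metis+
  have z1: "\<bar>z\<bar> \<le> 1" using z J(3) ab by (auto simp: subset_iff)
  \<comment> \<open>The values of \<open>1 / x\<close> on \<open>J\<close> vary by at most
    \<open>b - a \<le> 2\<close>, and \<open>\<bar>z\<bar> \<le> 1\<close>; so all points of
    \<open>J\<close> are of comparable size.\<close>
  have comp: "\<bar>z\<bar> \<le> 3 * \<bar>u\<bar>" if u: "u \<in> J" for u
  proof -
    have u0: "u \<noteq> 0" using J(4) u by metis
    have "\<bar>1 / u\<bar> \<le> \<bar>1 / z\<bar> + \<bar>1 / u - 1 / z\<bar>" by linarith
    hence "\<bar>z\<bar> * \<bar>1 / u\<bar> \<le> \<bar>z\<bar> * (\<bar>1 / z\<bar> + \<bar>1 / u - 1 / z\<bar>)" by (rule mult_left_mono) simp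
    also have "\<dots> = 1 + \<bar>z\<bar> * \<bar>1 / u - 1 / z\<bar>" using nz by (simp add: distrib_left abs_divide)
    also have "\<dots> \<le> 1 + 1 * (b - a)" using osc[OF u z] z1 by (intro add_left_mono mult_mono) auto
    also have "\<dots> \<le> 3" using ab by simp
    finally show ?thesis using u0 by (simp add: abs_divide field_simps)
  qed
  have "z\<^sup>2 = \<bar>z\<bar> * \<bar>z\<bar>" by (simp add: power2_eq_square)
  also have "\<dots> \<le> (3 * \<bar>x\<bar>) * (3 * \<bar>y\<bar>)" by (intro mult_mono comp xy) auto
  also have "\<dots> = 9 * \<bar>x * y\<bar>" by (simp add: abs_mult)
  \<comment> \<open>\<open>\<bar>x * y\<bar>\<close> times the difference of the reciprocals is the
    distance of \<open>x\<close> and \<open>y\<close>. That difference is at least half of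
    \<open>b - a\<close>, which turns 9 into 18.\<close>
  also have "\<dots> \<le> 18 / (b - a) * (\<beta> - \<alpha>)"
  proof -
    have "\<bar>x * y\<bar> * ((b - a) / 2) \<le> \<bar>x * y\<bar> * \<bar>1 / x - 1 / y\<bar>" by (intro mult_left_mono xy) auto
    also have "\<dots> = \<bar>y - x\<bar>" using nz by (simp add: abs_mult[symmetric] right_diff_distrib)
    also have "\<dots> \<le> \<beta> - \<alpha>" using xy \<alpha>\<beta> by auto
    finally show ?thesis using ab by (simp add: field_simps)
  qed
  also have "\<beta> - \<alpha> = measure lborel J" using \<alpha>\<beta> by simp
  finally show ?thesis .
qed

text \<open>\<open>T\<close> is arbitrary outside of \<open>{a..b}\<close>, hence the modification \<open>T'\<close>, which is Borel measurable.\<close>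

lemma iwasawa_branches:
  assumes "proper_iwasawa_map a b T"
  defines "T' \<equiv> \<lambda>x. if x \<in> {a..b} then T x else 0"
  obtains J e c \<theta> where "branches a b (max \<bar>a\<bar> \<bar>b\<bar>) T' J e c \<theta>"
proof -
  define \<rho> where "\<rho> = max \<bar>a\<bar> \<bar>b\<bar>"
  have rho: "\<rho> < 1" "\<bar>a\<bar> \<le> \<rho>" "\<bar>b\<bar> \<le> \<rho>" using assms(1) by (auto simp: \<rho>_def proper_iwasawa_map_def)
  have im: "iwasawa_map a b T" using assms(1) by (simp add: proper_iwasawa_map_def)
  hence ab: "a < b" and T_range: "\<And>x. x \<in> {a..b} \<Longrightarrow> T x \<in> {a..b}" by (auto simp: iwasawa_map_def)
  obtain \<iota> P where \<iota>: "\<iota> \<in> {\<lambda>x. 1 / x, \<lambda>x. - (1 / x), \<lambda>x. \<bar>1 / x\<bar>, \<lambda>x. - \<bar>1 / x\<bar>}"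
    and P: "iwasawa_partition a b T \<iota> P" using im unfolding iwasawa_map_def by blast
  note P' = P[unfolded iwasawa_partition_def]
  have cP: "countable P" and sub: "\<And>K. K \<in> P \<Longrightarrow> subinterval K a b" and cover: "{a..b} - {0} \<subseteq> \<Union>P"
    using P' by auto
  have disj: "\<And>K K'. K \<in> P \<Longrightarrow> K' \<in> P \<Longrightarrow> K \<noteq> K' \<Longrightarrow> interior K \<inter> interior K' = {}"
    using P' by simp
  have br: "\<exists>c. \<forall>x\<in>interior K. T x = \<iota> x + c" if "K \<in> P" for K
    using P' that by simp
  have full: "closure (T ` interior K) = {a..b} \<or> leftmost P K \<or> rightmost P K" if "K \<in> P" for K
  proof -
    have "closure (T ` interior K) = {a..b} \<or> (leftmost P K \<or> rightmost P K) \<and> is_interval (T ` interior K) \<and>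
         (a \<in> closure (T ` interior K) \<or> b \<in> closure (T ` interior K))" 
      using P' that by (elim conjE) (erule bspec)
    thus ?thesis by blast
  qed
  define enc where "enc = to_nat_on P"
  have enc: "inj_on enc P" unfolding enc_def by (rule inj_on_to_nat_on[OF cP])
  define K where "K i = inv_into P enc i" for i
  \<comment> \<open>Indices that do not encode a member of the partition get the empty
    branch.\<close>
  define J where "J i = (if i \<in> enc ` P then interior (K i) else {})" for i
  have K_in: "K i \<in> P" "enc (K i) = i" if "i \<in> enc ` P" for i
    using that unfolding K_def by (auto intro: inv_into_into f_inv_into_f)
  have K_enc: "K (enc k) = k" if "k \<in> P" for k
    unfolding K_def using enc that by (rule inv_into_f_f)
  have J_open: "open (J i)" for i by (simp add: J_def)
  have J_int: "is_interval (J i)" for i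
    using convex_interior[of "K i"] sub[OF K_in(1)] unfolding J_def subinterval_def
    by (auto simp: is_interval_convex_1)
  have J_sub: "J i \<subseteq> {a..b}" for i
    using sub[OF K_in(1)] interior_subset[of "K i"] unfolding J_def subinterval_def by auto
  have J_disj: "disjoint_family J"
  proof (unfold disjoint_family_on_def, intro ballI impI)
    fix m n :: nat assume "m \<noteq> n"
    show "J m \<inter> J n = {}"
    proof (cases "m \<in> enc ` P \<and> n \<in> enc ` P")
      case True
      hence "K m \<noteq> K n" using K_in(2)[of m] K_in(2)[of n] \<open>m \<noteq> n\<close> by auto
      thus ?thesis using disj[of "K m" "K n"] K_in(1) True by (simp add: J_def)
    qed (auto simp: J_def)
  qed
  have T_J: "\<exists>c. \<forall>x\<in>J i. T x = \<iota> x + c" for i using br[OF K_in(1)] by (auto simp: J_def)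
  have J0: "0 \<notin> J i" for i
  proof
    assume "0 \<in> J i"
    then obtain d where d: "0 < d" "ball 0 d \<subseteq> J i" using J_open open_contains_ball by blast
    obtain c where c: "\<And>x. x \<in> J i \<Longrightarrow> T x = \<iota> x + c" using T_J by blast
    \<comment> \<open>So close to 0 the reciprocal exceeds \<open>\<bar>c\<bar> + 1\<close>, while
      \<open>\<bar>T x\<bar> \<le> 1\<close>.\<close>
    define x where "x = min (d / 2) (1 / (\<bar>c\<bar> + 2))"
    have x: "0 < x" "x < d" "x \<le> 1 / (\<bar>c\<bar> + 2)" using d(1) by (auto simp: x_def min_def)
    have xJ: "x \<in> J i" using d(2) x by (auto simp: subset_iff)
    have "\<bar>c\<bar> + 2 \<le> 1 / x" using x by (simp add: field_simps)
    moreover have "\<bar>\<iota> x\<bar> = 1 / x" using \<iota> x by auto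
    moreover have "\<bar>T x\<bar> \<le> 1"
    proof -
      have "T x \<in> {a..b}" using xJ J_sub[of i] by (intro T_range) blast
      hence "a \<le> T x" "T x \<le> b" by auto
      thus ?thesis using rho by linarith
    qed
    moreover have "\<bar>\<iota> x\<bar> \<le> \<bar>T x\<bar> + \<bar>c\<bar>" using c[OF xJ] by simp
    ultimately show False by linarith
  qed
  have "\<exists>e c. (e = 1 \<or> e = -1) \<and> (\<forall>x\<in>J i. T x = e / x + c)" for i
  proof -
    obtain c where c: "\<And>x. x \<in> J i \<Longrightarrow> T x = \<iota> x + c" using T_J by blast
    have sign: "(\<forall>x\<in>J i. 0 < x) \<or> (\<forall>x\<in>J i. x < 0)"
    proof (rule ccontr)
      assume "\<not> ?thesis"
      then obtain x y where xy: "x \<in> J i" "x \<le> 0" "y \<in> J i" "0 \<le> y" by (auto simp: not_less)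
      hence "0 \<in> J i" using J_int[of i] unfolding is_interval_1 by blast
      thus False using J0 by blast
    qed
    have "\<exists>e. (e = 1 \<or> e = -1) \<and> (\<forall>x\<in>J i. \<iota> x = e / x)"
    proof -
      have "(\<forall>x\<in>J i. \<iota> x = 1 / x) \<or> (\<forall>x\<in>J i. \<iota> x = - 1 / x)"
        using \<iota> sign by auto
      thus ?thesis by blast
    qed
    thus ?thesis using c by metis
  qed
  then obtain e c where ec: "\<And>i. e i = 1 \<or> e i = -1" "\<And>i x. x \<in> J i \<Longrightarrow> T x = e i / x + c i" by metis
  have J_cover: "countable ({a..b} - (\<Union>i. J i))"
  proof (rule countable_subset)
    show "{a..b} - (\<Union>i. J i) \<subseteq> {0} \<union> (\<Union>k\<in>P. k - interior k)"
    proof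
      fix x assume x: "x \<in> {a..b} - (\<Union>i. J i)"
      show "x \<in> {0} \<union> (\<Union>k\<in>P. k - interior k)"
      proof (cases "x = 0")
        case False
        then obtain k where k: "k \<in> P" "x \<in> k" using cover x by blast
        have "x \<notin> J (enc k)" using x by blast
        hence "x \<notin> interior k" using k K_enc by (simp add: J_def)
        thus ?thesis using k by blast
      qed simp
    qed
    have "countable (k - interior k)" if "k \<in> P" for k
      using countable_interval_minus_interior[of k a b] sub[OF that] by (simp add: subinterval_def)
    thus "countable ({0} \<union> (\<Union>k\<in>P. k - interior k))" using cP by (intro countable_Un countable_UN) auto
  qed
  have osc: "\<bar>1 / x - 1 / y\<bar> = \<bar>T x - T y\<bar>" if "x \<in> J i" "y \<in> J i" for x y i
    using ec(1)[of i] ec(2)[OF that(1)] ec(2)[OF that(2)] by auto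
  have osc_le: "\<bar>1 / x - 1 / y\<bar> \<le> b - a" if "x \<in> J i" "y \<in> J i" for x y i
  proof -
    have "T x \<in> {a..b}" "T y \<in> {a..b}" using that J_sub[of i] by (auto intro!: T_range simp del: atLeastAtMost_iff)
    thus ?thesis unfolding osc[OF that] by auto
  qed
  define N where "N = enc ` {k. leftmost P k \<or> rightmost P k}"
  have finN: "finite N" unfolding N_def
    by (intro finite_imageI finite_leftmost_rightmost) (use sub in \<open>auto simp: subinterval_def\<close>)
  \<comment> \<open>The image is dense in \<open>{a..b}\<close>, so there are two points whose
    images are within a quarter of the length from either end.\<close>
  have wide: "\<exists>x\<in>J i. \<exists>y\<in>J i. (b - a) / 2 \<le> \<bar>1 / x - 1 / y\<bar>" if i: "J i \<noteq> {}" "i \<notin> N" for i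
  proof -
    have iP: "i \<in> enc ` P" using i by (auto simp: J_def split: if_splits)
    have "\<not> (leftmost P (K i) \<or> rightmost P (K i))" 
    proof
      assume "leftmost P (K i) \<or> rightmost P (K i)"
      hence "enc (K i) \<in> N" unfolding N_def by (intro imageI CollectI)
      thus False using i(2) K_in(2)[OF iP] by simp
    qed
    hence cl: "closure (T ` J i) = {a..b}" using full[OF K_in(1)[OF iP]] iP by (simp add: J_def)
    have "a \<in> closure (T ` J i)" "b \<in> closure (T ` J i)" using cl ab by auto
    then obtain x y where x: "x \<in> J i" "dist a (T x) < (b - a) / 4" and y: "y \<in> J i" "dist b (T y) < (b - a) / 4"
      using closure_approachableD[of a "T ` J i" "(b - a) / 4"] closure_approachableD[of b "T ` J i" "(b - a) / 4"] ab
      by auto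
    have "T x < a + (b - a) / 4" "b - (b - a) / 4 < T y"
      using x(2) y(2) unfolding dist_real_def abs_less_iff by linarith+
    hence "(b - a) / 2 \<le> T y - T x" by (simp add: field_simps)
    hence "(b - a) / 2 \<le> \<bar>T x - T y\<bar>" by linarith
    hence "(b - a) / 2 \<le> \<bar>1 / x - 1 / y\<bar>" unfolding osc[OF x(1) y(1)] .
    thus ?thesis using x(1) y(1) by blast
  qed
  \<comment> \<open>The lengths of the disjoint branches are summable; the minimum with
    \<open>\<rho>\<^sup>2\<close> keeps the uniform contraction of each branch.\<close>
  define \<theta> where "\<theta> i = (if i \<in> N then \<rho>\<^sup>2 else min (\<rho>\<^sup>2) (18 / (b - a) * measure lborel (J i)))" for i
  have sq: "x\<^sup>2 \<le> \<rho>\<^sup>2" if "x \<in> J i" for x i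
  proof -
    have "x \<in> {a..b}" using J_sub[of i] that by blast
    hence "a \<le> x" "x \<le> b" by auto
    hence "\<bar>x\<bar> \<le> \<rho>" using rho by linarith
    thus ?thesis using abs_le_square_iff[of x \<rho>] rho by simp
  qed
  have emJ: "emeasure lborel (J i) < \<infinity>" for i
    using emeasure_mono[OF J_sub[of i], of lborel] by (auto simp: emeasure_lborel_Icc_eq top.not_eq_extremum intro: le_less_trans)
  have summ: "summable (\<lambda>i. measure lborel (J i))"
  proof -
    have "emeasure lborel (\<Union>i. J i) \<le> emeasure lborel {a..b}" using J_sub by (intro emeasure_mono) auto
    also have "\<dots> < \<infinity>" by (simp add: emeasure_lborel_Icc_eq)
    finally have fin: "emeasure lborel (\<Union>i. J i) \<noteq> \<infinity>" by simp
    have "(\<lambda>i. measure lborel (J i)) sums measure lborel (\<Union>i. J i)"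
      by (rule measure_UNION[OF _ J_disj fin]) (use J_open in auto)
    thus ?thesis by (rule sums_summable)
  qed
  have "branches a b \<rho> T' J e c \<theta>"
  proof
    show "T' \<in> borel_measurable borel"
    proof (rule measurableI)
      fix B :: "real set" assume B: "B \<in> sets borel"
      have Jm: "J i \<inter> (\<lambda>x. e i / x + c i) -` B \<in> sets borel" for i
      proof -
        have "(\<lambda>x. e i / x + c i) \<in> borel_measurable borel" by measurable
        from measurable_sets[OF this B] show ?thesis using J_open by auto
      qed
      have eq: "T' -` B = (\<Union>i. J i \<inter> (\<lambda>x. e i / x + c i) -` B) \<union> (T' -` B \<inter> ({a..b} - (\<Union>i. J i))) \<union> (if 0 \<in> B then - {a..b} else {})"
      proof -
        have "T' x = e i / x + c i" if "x \<in> J i" for x i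
          using that J_sub[of i] ec(2) by (auto simp: T'_def)
        moreover have "T' x = 0" if "x \<notin> {a..b}" for x using that by (auto simp: T'_def)
        moreover have "x \<in> {a..b}" if "x \<in> J i" for x i using that J_sub by blast
        ultimately show ?thesis by (auto split: if_splits)
      qed
      have E: "T' -` B \<inter> ({a..b} - (\<Union>i. J i)) \<in> sets borel"
        by (rule countable_imp_null_set_lborel[THEN null_setsD2, simplified]) (rule countable_subset[OF _ J_cover], auto)
      have "(\<Union>i. J i \<inter> (\<lambda>x. e i / x + c i) -` B) \<union> (T' -` B \<inter> ({a..b} - (\<Union>i. J i))) \<union> (if 0 \<in> B then - {a..b} else {}) \<in> sets borel"
        by (intro sets.Un E sets.countable_UN) (use Jm in auto)
      thus "T' -` B \<inter> space borel \<in> sets borel" unfolding eq[symmetric] by simp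
    qed simp
    show "T' x \<in> {a..b}" if "x \<in> {a..b}" for x using T_range[OF that] that by (simp add: T'_def)
    show "T' x = e i / x + c i" if "x \<in> J i" for x i using that J_sub[of i] ec(2) by (auto simp: T'_def)
    show "0 \<le> \<theta> i" "\<theta> i \<le> \<rho>\<^sup>2" for i using ab by (auto simp: \<theta>_def)
    show "x\<^sup>2 \<le> \<theta> i" if x: "x \<in> J i" for x i
    proof (cases "i \<in> N")
      case False
      obtain u v where "u \<in> J i" "v \<in> J i" "(b - a) / 2 \<le> \<bar>1 / u - 1 / v\<bar>"
        using wide[OF _ False] x by blast
      hence "x\<^sup>2 \<le> 18 / (b - a) * measure lborel (J i)"
        using square_le_measure[OF J_open J_int J_sub J0 ab _ _ osc_le _ _ _ x] rho by auto
      thus ?thesis using False sq[OF x] by (simp add: \<theta>_def)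
    qed (use sq[OF x] in \<open>simp add: \<theta>_def\<close>)
    show "summable \<theta>"
    proof (rule summable_comparison_test')
      have "summable (\<lambda>i. if i \<in> N then \<rho>\<^sup>2 else 0)" using finN by (rule summable_If_finite_set)
      thus "summable (\<lambda>i. (if i \<in> N then \<rho>\<^sup>2 else 0) + 18 / (b - a) * measure lborel (J i))"
        by (intro summable_add summable_mult summ)
      show "norm (\<theta> i) \<le> (if i \<in> N then \<rho>\<^sup>2 else 0) + 18 / (b - a) * measure lborel (J i)" for i
        using ab by (auto simp: \<theta>_def)
    qed
  qed (use ab rho J_open J_int J_sub J_disj J0 J_cover ec(1) in auto)
  thus ?thesis using that unfolding \<rho>_def by blast
qed

text \<open>Three replacements, invisible to \<open>\<mu>\<close>, lead to the locale
  \<open>observable\<close>: \<open>T\<close> by its Borel modification, the density by its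
  extension with 0 to the line, and \<open>f\<close> by a centred representative of bounded
  variation. The case \<open>c2 = 0\<close> is excluded because it would give
  \<open>condition_H\<close>.\<close>

theorem iwasawa_central_limit:
  assumes T: "proper_iwasawa_map a b T" "condition_star a b T"
    and f1: "bv_invariant_density a b T f1" and \<mu>: "\<mu> = density (lebesgue_on {a..b}) f1"
    and f: "f \<in> BV a b" and notH: "\<not> condition_H \<mu> T f"
  shows "\<exists>\<sigma>>0. \<forall>v. (\<lambda>N. measure \<mu> {x \<in> space \<mu>.
      (birkhoff_sum T f N x - real N * (LINT y|\<mu>. f y)) / (\<sigma> * sqrt (real N)) \<le> v})
    \<longlonglongrightarrow> cdf std_normal_distribution v"
proof -
  define T' where "T' x = (if x \<in> {a..b} then T x else 0)" for x
  have T'_eq: "T' = (\<lambda>x. if x \<in> {a..b} then T x else 0)" by (simp add: T'_def fun_eq_iff)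
  obtain J e c \<theta> where br: "branches a b (max \<bar>a\<bar> \<bar>b\<bar>) T' J e c \<theta>"
    unfolding T'_eq by (rule iwasawa_branches[OF T(1)])
  interpret branches a b "max \<bar>a\<bar> \<bar>b\<bar>" T' J e c \<theta> by (rule br)
  have range: "T x \<in> {a..b}" if "x \<in> {a..b}" for x using T_range[OF that] that by (simp add: T'_def)
  have pow_range: "(T ^^ n) x \<in> {a..b}" if "x \<in> {a..b}" for x n
  proof (induction n)
    case (Suc n) thus ?case using range[of "(T ^^ n) x"] by simp
  qed (use that in simp)
  have pow_eq: "(T' ^^ n) x = (T ^^ n) x" if "x \<in> {a..b}" for x n
  proof (induction n)
    case (Suc n) thus ?case using pow_range[OF that, of n] by (simp add: T'_def)
  qed simp
  interpret mixing_branches a b "max \<bar>a\<bar> \<bar>b\<bar>" T' J e c \<theta>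
  proof
    fix x x' y y' :: real
    assume xy: "x < x'" "y < y'" "{x..<x'} \<subseteq> {a..b}" "{y..<y'} \<subseteq> {a..b}"
    hence "subinterval {x..<x'} a b" "subinterval {y..<y'} a b"
      by (auto simp: subinterval_def is_interval_co)
    then obtain N where "0 < emeasure lebesgue ((T ^^ N) ` {x..<x'} \<inter> (T ^^ N) ` {y..<y'})"
      using T(2) unfolding condition_star_def by blast
    moreover have "(T' ^^ N) ` {x..<x'} = (T ^^ N) ` {x..<x'}" "(T' ^^ N) ` {y..<y'} = (T ^^ N) ` {y..<y'}"
      using xy(3,4) by (intro image_cong refl pow_eq; blast)+
    ultimately show "\<exists>N. 0 < emeasure lebesgue ((T' ^^ N) ` {x..<x'} \<inter> (T' ^^ N) ` {y..<y'})" by metis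
  qed
  have f1_nn: "\<And>x. x \<in> {a..b} \<Longrightarrow> 0 \<le> f1 x" and f1_bv: "bounded_variation a b f1"
    and prob: "prob_space \<mu>" and inv: "T \<in> measurable \<mu> \<mu>" "distr \<mu> \<mu> T = \<mu>"
    using f1 unfolding bv_invariant_density_def invariant_measure_def \<mu> by auto
  define p where "p x = (if x \<in> {a..b} then f1 x else 0)" for x
  have p_eq: "p = (\<lambda>x. if x \<in> {a..b} then f1 x else 0)" by (simp add: p_def fun_eq_iff)
  obtain Cp where p: "bv a b Cp p"
    using bounded_variation_imp_bv[OF less_imp_le[OF ab] f1_bv] unfolding p_eq by blast
  have p_nn: "0 \<le> p x" for x using f1_nn by (simp add: p_def)
  have space_mu: "space \<mu> = {a..b}" by (simp add: \<mu>)
  have borel_leb: "\<phi> \<in> borel_measurable (lebesgue_on {a..b})" if "\<phi> \<in> borel_measurable borel" for \<phi> :: "real \<Rightarrow> real"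
    using that by (intro measurable_restrict_space1 measurable_completion) simp
  have borel_mu: "\<phi> \<in> borel_measurable \<mu>" if "\<phi> \<in> borel_measurable borel" for \<phi> :: "real \<Rightarrow> real"
    using borel_leb[OF that] by (simp add: \<mu>)
  have f1_meas: "f1 \<in> borel_measurable (lebesgue_on {a..b})"
    using borel_leb[OF bv_borel[OF p]] by (rule measurable_cong[THEN iffD1, rotated]) (simp add: p_def)
  have f1_AE: "AE x in lebesgue_on {a..b}. 0 \<le> f1 x" using f1_nn by (intro AE_I2) simp
  have ind: "indicator {a..b} x *\<^sub>R (f1 x *\<^sub>R \<phi> x) = \<phi> x * p x" for \<phi> :: "real \<Rightarrow> real" and x
    by (simp add: p_def)
  have int_mu: "(LINT x|\<mu>. \<phi> x) = (LINT x|lborel. \<phi> x * p x)" if \<phi>: "\<phi> \<in> borel_measurable borel" for \<phi> :: "real \<Rightarrow> real"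
  proof -
    have "(LINT x|\<mu>. \<phi> x) = (LINT x|lebesgue_on {a..b}. f1 x *\<^sub>R \<phi> x)"
      unfolding \<mu> by (rule integral_density[OF borel_leb[OF \<phi>] f1_meas f1_AE])
    also have "\<dots> = (LINT x|lebesgue. indicator {a..b} x *\<^sub>R (f1 x *\<^sub>R \<phi> x))"
      by (rule integral_restrict_space) simp
    also have "\<dots> = (LINT x|lborel. \<phi> x * p x)"
      unfolding ind using \<phi> bv_borel[OF p] by (intro integral_completion) auto
    finally show ?thesis .
  qed
  have integrable_mu: "integrable \<mu> \<phi>" if \<phi>: "\<phi> \<in> borel_measurable borel" "integrable lborel (\<lambda>x. \<phi> x * p x)"
    for \<phi> :: "real \<Rightarrow> real"
  proof -
    have "integrable lebesgue (\<lambda>x. indicator {a..b} x *\<^sub>R (f1 x *\<^sub>R \<phi> x))"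
      unfolding ind using \<phi> bv_borel[OF p] by (subst integrable_completion) auto
    hence "integrable (lebesgue_on {a..b}) (\<lambda>x. f1 x *\<^sub>R \<phi> x)"
      by (subst integrable_restrict_space) auto
    thus ?thesis unfolding \<mu> using integrable_density[OF borel_leb[OF \<phi>(1)] f1_meas f1_AE] by simp
  qed
  have AE_mu: "AE x in \<mu>. Q x" if "AE x in lborel. 0 < p x \<longrightarrow> Q x" for Q
  proof -
    have "AE x in lebesgue. 0 < p x \<longrightarrow> Q x" using that by (rule AE_completion)
    hence "AE x in lebesgue_on {a..b}. 0 < f1 x \<longrightarrow> Q x"
      by (subst AE_restrict_space_iff) (auto simp: p_def elim: eventually_mono)
    thus ?thesis unfolding \<mu> using f1_meas by (subst AE_density) auto
  qed
  have p_int: "(LINT x|lborel. p x) = 1"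
    using int_mu[of "\<lambda>_. 1"] prob_space.prob_space[OF prob] by simp
  have p_inv: "AE x in lborel. L p x = p x"
  proof -
    \<comment> \<open>Duality and invariance, tested with the sign of \<open>L p - p\<close>, show
      that the integral of \<open>\<bar>L p - p\<bar>\<close> is 0.\<close>
    define \<phi> where "\<phi> x = sgn (L p x - p x)" for x
    note [measurable] = bv_borel[OF p] bv_borel[OF bv_L[OF p]]
    have \<phi>: "\<phi> \<in> borel_measurable borel" unfolding \<phi>_def[abs_def] by measurable
    have \<phi>1: "\<bar>\<phi> x\<bar> \<le> 1" for x by (simp add: \<phi>_def abs_sgn_eq)
    note [measurable] = \<phi>
    have "(LINT x|lborel. L p x * \<phi> x) = (LINT x|lborel. \<phi> (T' x) * p x)"
      using L_duality[OF p \<phi> \<phi>1] by (simp add: mult.commute)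
    also have "\<dots> = (LINT x|\<mu>. \<phi> (T' x))" by (rule int_mu[symmetric]) measurable
    also have "\<dots> = (LINT x|\<mu>. \<phi> (T x))"
      by (rule Bochner_Integration.integral_cong) (auto simp: space_mu T'_def)
    also have "\<dots> = (LINT x|distr \<mu> \<mu> T. \<phi> x)"
      by (rule integral_distr[symmetric, OF inv(1) borel_mu[OF \<phi>]])
    also have "\<dots> = (LINT x|lborel. p x * \<phi> x)" unfolding inv(2) by (simp add: int_mu[OF \<phi>] mult.commute)
    finally have eq: "(LINT x|lborel. L p x * \<phi> x) = (LINT x|lborel. p x * \<phi> x)" .
    have d: "bv a b (\<Theta> * Cp + Cp) (\<lambda>x. L p x - p x)" by (intro bv_diff bv_L p)
    have i: "integrable lborel (\<lambda>x. h x * \<phi> x)" if "bv a b D h" for D h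
      by (rule Bochner_Integration.integrable_bound[OF bv_integrable[OF that]])
        (use bv_borel[OF that] \<phi>1 in \<open>auto simp: abs_mult mult_left_le\<close>)
    have "(LINT x|lborel. \<bar>L p x - p x\<bar>) = (LINT x|lborel. L p x * \<phi> x - p x * \<phi> x)"
      by (intro Bochner_Integration.integral_cong) (auto simp: \<phi>_def abs_sgn left_diff_distrib)
    also have "\<dots> = 0" using i[OF bv_L[OF p]] i[OF p] eq by simp
    finally have "AE x in lborel. \<bar>L p x - p x\<bar> = 0"
      using integral_nonneg_eq_0_iff_AE[OF bv_integrable[OF bv_abs[OF d]]] by simp
    thus ?thesis by eventually_elim simp
  qed
  obtain g where g: "bounded_variation a b g" "AE x in lebesgue_on {a..b}. f x = g x"
    using f unfolding BV_def by blast
  define m where "m = (LINT y|\<mu>. f y)"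
  define g0 where "g0 x = (if x \<in> {a..b} then g x else 0)" for x
  have g0_eq: "g0 = (\<lambda>x. if x \<in> {a..b} then g x else 0)" by (simp add: g0_def fun_eq_iff)
  obtain Cg where g0: "bv a b Cg g0"
    using bounded_variation_imp_bv[OF less_imp_le[OF ab] g(1)] unfolding g0_eq by blast
  have "bounded_variation a b (\<lambda>_. m)" unfolding bounded_variation_def by (intro exI[of _ 0]) simp
  then obtain Cm where m: "bv a b Cm (\<lambda>x. if x \<in> {a..b} then m else 0)"
    using bounded_variation_imp_bv[OF less_imp_le[OF ab]] by blast
  define h where "h x = g0 x - (if x \<in> {a..b} then m else 0)" for x
  have h: "bv a b (Cg + Cm) h" unfolding h_def[abs_def] by (rule bv_diff[OF g0 m])
  have fg: "AE x in \<mu>. f x = g x"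
    unfolding \<mu> using g(2) f1_meas by (subst AE_density) (auto elim: eventually_mono)
  \<comment> \<open>\<open>f\<close> agrees with a Borel function only almost everywhere;
    completeness of \<open>lebesgue\<close> makes its preimages measurable.\<close>
  have f_meas: "f \<in> borel_measurable \<mu>"
  proof (rule measurableI)
    fix B :: "real set" assume B: "B \<in> sets borel"
    have "AE x in lebesgue. x \<in> {a..b} \<longrightarrow> f x = g x"
      using g(2) by (subst (asm) AE_restrict_space_iff) auto
    hence "AE x in lebesgue. x \<in> g0 -` B \<inter> {a..b} \<longleftrightarrow> x \<in> f -` B \<inter> {a..b}"
      by eventually_elim (auto simp: g0_def)
    moreover have "g0 -` B \<inter> {a..b} \<in> sets lebesgue"
      using measurable_sets[OF bv_borel[OF g0] B] by (intro sets_completionI_sets) auto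
    ultimately have "f -` B \<inter> {a..b} \<in> sets lebesgue"
      by (rule completion.in_sets_AE) simp
    thus "f -` B \<inter> space \<mu> \<in> sets \<mu>"
      unfolding space_mu by (simp add: \<mu> sets_restrict_space_iff)
  qed simp
  have h_mean: "(LINT x|lborel. h x * p x) = 0"
  proof -
    have "m = (LINT x|\<mu>. g0 x)"
      unfolding m_def
    proof (rule integral_cong_AE[OF f_meas borel_mu[OF bv_borel[OF g0]]])
      show "AE x in \<mu>. f x = g0 x"
        using fg AE_space by eventually_elim (simp add: g0_def space_mu)
    qed
    also have "\<dots> = (LINT x|lborel. g0 x * p x)" by (rule int_mu[OF bv_borel[OF g0]])
    finally have "(LINT x|lborel. g0 x * p x) = m" ..
    moreover have "(LINT x|lborel. h x * p x) = (LINT x|lborel. g0 x * p x - m * p x)"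
      by (intro Bochner_Integration.integral_cong) (auto simp: h_def p_def algebra_simps)
    ultimately show ?thesis
      using bv_integrable[OF bv_mult[OF g0 p]] bv_integrable[OF p] by (simp add: p_int)
  qed
  interpret observable a b "max \<bar>a\<bar> \<bar>b\<bar>" T' J e c \<theta> p Cp h "Cg + Cm"
    by unfold_locales (use p p_nn p_int p_inv h h_mean in auto)
  \<comment> \<open>Invariance carries the null set where \<open>f\<close> and \<open>g\<close>
    differ to every time \<open>k\<close>.\<close>
  have orbit: "AE x in \<mu>. f ((T ^^ k) x) = g ((T ^^ k) x)" for k
  proof (induction k)
    case (Suc k)
    hence "AE x in distr \<mu> \<mu> T. f ((T ^^ k) x) = g ((T ^^ k) x)" by (simp only: inv(2))
    from AE_distrD[OF inv(1) this] show ?case by (simp add: funpow_swap1)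
  qed (use fg in simp)
  have birkhoff: "AE x in \<mu>. birkhoff_sum T f N x - real N * m = S N x" for N
  proof -
    have "AE x in \<mu>. \<forall>k. f ((T ^^ k) x) = g ((T ^^ k) x)" unfolding AE_all_countable using orbit by simp
    thus ?thesis
    proof (rule AE_mp, intro AE_I2 impI)
      fix x assume x: "x \<in> space \<mu>" and eq: "\<forall>k. f ((T ^^ k) x) = g ((T ^^ k) x)"
      have xI: "x \<in> {a..b}" using x by (simp only: space_mu)
      have "h ((T' ^^ k) x) = f ((T ^^ k) x) - m" for k
        using eq pow_range[OF xI, of k] by (simp add: pow_eq[OF xI] h_def g0_def)
      thus "birkhoff_sum T f N x - real N * m = S N x"
        by (simp add: birkhoff_sum_def S_def sum_subtractf)
    qed
  qed
  have c2: "0 < c2"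
  proof (rule ccontr)
    assume "\<not> 0 < c2"
    hence "c2 = 0" using c2_nonneg by simp
    from coboundary[OF this] obtain u where u: "u \<in> borel_measurable borel" "integrable M (\<lambda>x. (u x)\<^sup>2)"
      "AE x in M. h x = u x - u (T' x)" .
    have "integrable \<mu> (\<lambda>x. (u x)\<^sup>2)"
    proof (rule integrable_mu)
      show "(\<lambda>x. (u x)\<^sup>2) \<in> borel_measurable borel" using u(1) by measurable
      have "integrable lborel (\<lambda>x. p x *\<^sub>R (u x)\<^sup>2)"
        using u(1,2) p_nn bv_borel[OF p] unfolding M_def by (subst (asm) integrable_density) auto
      thus "integrable lborel (\<lambda>x. (u x)\<^sup>2 * p x)" by (simp add: mult.commute)
    qed
    moreover have "AE x in \<mu>. f x = u x - u (T x) + m"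
    proof -
      have "AE x in lborel. 0 < p x \<longrightarrow> h x = u x - u (T' x)"
        using u(3) bv_borel[OF p] unfolding M_def by (subst (asm) AE_density) auto
      from AE_mu[OF this] fg AE_space show ?thesis
      proof eventually_elim
        case (elim x)
        have "x \<in> {a..b}" using elim(3) by (simp only: space_mu)
        thus ?case using elim(1,2) by (simp add: h_def g0_def T'_def)
      qed
    qed
    ultimately have "condition_H \<mu> T f"
      unfolding condition_H_def m_def using borel_mu[OF u(1)] by blast
    thus False using notH by blast
  qed
  show ?thesis
  proof (intro exI[of _ "sqrt (2 * c2)"] conjI allI)
    show "0 < sqrt (2 * c2)" using c2 by simp
    fix v
    have "measure \<mu> {x \<in> space \<mu>. (birkhoff_sum T f N x - real N * (LINT y|\<mu>. f y)) / (sqrt (2 * c2) * sqrt (real N)) \<le> v}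
      = measure M {x. S N x / (sqrt (2 * c2) * sqrt (real N)) \<le> v}" for N
    proof -
      define B where "B = {x. S N x / (sqrt (2 * c2) * sqrt (real N)) \<le> v}"
      have B: "B \<in> sets borel" unfolding B_def by measurable
      have Tn: "T ^^ k \<in> measurable \<mu> \<mu>" for k
      proof (induction k)
        case (Suc k) thus ?case using measurable_comp[OF Suc inv(1)] by (simp add: comp_def)
      qed (simp add: id_def)
      have "(\<lambda>x. f ((T ^^ k) x)) \<in> borel_measurable \<mu>" for k
        by (rule measurable_compose[OF Tn f_meas])
      hence [measurable]: "birkhoff_sum T f N \<in> borel_measurable \<mu>"
        unfolding birkhoff_sum_def[abs_def] by measurable
      have "measure \<mu> {x \<in> space \<mu>. (birkhoff_sum T f N x - real N * m) / (sqrt (2 * c2) * sqrt (real N)) \<le> v}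
        = measure \<mu> (B \<inter> space \<mu>)"
      proof (rule measure_eq_AE)
        show "AE x in \<mu>. x \<in> {x \<in> space \<mu>. (birkhoff_sum T f N x - real N * m) / (sqrt (2 * c2) * sqrt (real N)) \<le> v}
          \<longleftrightarrow> x \<in> B \<inter> space \<mu>"
          using birkhoff[of N] by eventually_elim (auto simp: B_def)
        show "{x \<in> space \<mu>. (birkhoff_sum T f N x - real N * m) / (sqrt (2 * c2) * sqrt (real N)) \<le> v} \<in> sets \<mu>"
          by measurable
        show "B \<inter> space \<mu> \<in> sets \<mu>"
          using measurable_sets[OF borel_mu[of "\<lambda>x. x"] B] by simp
      qed
      also have "\<dots> = (LINT x|\<mu>. indicator B x)" by simp
      also have "\<dots> = (LINT x|lborel. indicator B x * p x)" by (rule int_mu) (use B in simp)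
      also have "\<dots> = (LINT x|M. indicator B x)" by (rule integral_M[symmetric]) (use B in simp)
      also have "\<dots> = measure M B" using B by simp
      finally show ?thesis unfolding B_def m_def .
    qed
    thus "(\<lambda>N. measure \<mu> {x \<in> space \<mu>. (birkhoff_sum T f N x - real N * (LINT y|\<mu>. f y))
      / (sqrt (2 * c2) * sqrt (real N)) \<le> v}) \<longlonglongrightarrow> cdf std_normal_distribution v"
      using central_limit[OF c2, of v] by simp
  qed
qed

section \<open>Rosen maps\<close>

locale rosen =
  fixes q :: nat assumes q: "3 \<le> q"
begin

definition \<alpha> :: real where "\<alpha> = pi / real q"

text \<open>Half of \<open>rosen_lambda q\<close>: the interval is \<open>{- cc..cc}\<close>, and
  \<open>R\<close> reduces \<open>\<bar>1 / x\<bar>\<close> modulo \<open>2 * cc\<close>.\<close>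

definition cc :: real where "cc = cos \<alpha>"

abbreviation R :: "real \<Rightarrow> real" where "R \<equiv> rosen_map q"

lemma lam: "rosen_lambda q = 2 * cc"
  by (simp add: rosen_lambda_def cc_def \<alpha>_def)

lemma \<alpha>: "0 < \<alpha>" "\<alpha> \<le> pi / 3"
  using q by (auto simp: \<alpha>_def divide_simps)

lemma cc: "1 / 2 \<le> cc" "cc < 1" "0 < cc"
proof -
  show "1 / 2 \<le> cc" using cos_monotone_0_pi_le[of \<alpha> "pi / 3"] \<alpha> pi_gt_zero by (simp add: cc_def cos_60)
  thus "0 < cc" by simp
  show "cc < 1" using cos_monotone_0_pi[of 0 \<alpha>] \<alpha> pi_gt_zero by (simp add: cc_def)
qed

text \<open>The digit \<open>k\<close> is determined by \<open>\<bar>1 / x\<bar>\<close>, because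
  \<open>{- cc..<cc}\<close> is a fundamental domain for translation by
  \<open>2 * cc\<close>.\<close>

lemma R_eqI:
  assumes "x \<noteq> 0" "\<bar>1 / x\<bar> = y + 2 * cc * of_int k" "- cc \<le> y" "y < cc"
  shows "R x = y"
proof -
  have "\<bar>1 / (2 * cc * x)\<bar> = \<bar>1 / x\<bar> / (2 * cc)" using cc by (simp add: abs_mult)
  also have "\<dots> = y / (2 * cc) + of_int k" unfolding assms(2) using cc by (simp add: field_simps)
  finally have "\<lfloor>\<bar>1 / (2 * cc * x)\<bar> + 1 / 2\<rfloor> = \<lfloor>y / (2 * cc) + 1 / 2 + of_int k\<rfloor>" by (simp add: algebra_simps)
  also have "\<dots> = \<lfloor>y / (2 * cc) + 1 / 2\<rfloor> + k" by (rule floor_add_int[symmetric])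
  also have "\<lfloor>y / (2 * cc) + 1 / 2\<rfloor> = 0"
    using assms(3,4) cc by (intro floor_unique) (auto simp: field_simps)
  finally show ?thesis using assms(1,2) by (simp add: rosen_map_def lam)
qed

lemma R_digit:
  assumes "x \<noteq> 0"
  obtains k :: int where "\<bar>1 / x\<bar> = R x + 2 * cc * of_int k"
  using that[of "\<lfloor>\<bar>1 / (2 * cc * x)\<bar> + 1 / 2\<rfloor>"] assms by (simp add: rosen_map_def lam)

lemma R_range: "R x \<in> {- cc..<cc}"
proof (cases "x = 0")
  case False
  define y where "y = \<bar>1 / x\<bar> / (2 * cc)"
  have eq: "\<bar>1 / (2 * cc * x)\<bar> = y" using cc by (simp add: abs_mult y_def)
  have "R x = \<bar>1 / x\<bar> - 2 * cc * of_int \<lfloor>y + 1 / 2\<rfloor>"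
    using False by (simp add: rosen_map_def lam eq del: abs_divide abs_mult)
  moreover have "\<bar>1 / x\<bar> = 2 * cc * y" using cc by (simp add: y_def)
  ultimately have "R x = 2 * cc * (y - of_int \<lfloor>y + 1 / 2\<rfloor>)" by (simp add: right_diff_distrib)
  moreover have "- (1 / 2) \<le> y - of_int \<lfloor>y + 1 / 2\<rfloor>" "y - of_int \<lfloor>y + 1 / 2\<rfloor> < 1 / 2" by linarith+
  ultimately show ?thesis
    using mult_left_mono[of "- (1 / 2)" "y - of_int \<lfloor>y + 1 / 2\<rfloor>" "2 * cc"]
      mult_strict_left_mono[of "y - of_int \<lfloor>y + 1 / 2\<rfloor>" "1 / 2" "2 * cc"] cc by simp
qed (use cc in \<open>simp add: rosen_map_def\<close>)

lemma R_minus: "R (- x) = R x"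
  by (simp add: rosen_map_def)

lemma R_image_minus: "R ` (uminus ` A) = R ` A"
  by (simp add: image_image R_minus)

section \<open>The partition of a Rosen map\<close>

definition lo :: "nat \<Rightarrow> real" where "lo k = 1 / ((real k + 1 / 2) * (2 * cc))"

definition hi :: "nat \<Rightarrow> real" where "hi k = 1 / ((real k - 1 / 2) * (2 * cc))"

text \<open>\<open>lo k\<close> and \<open>hi k\<close> bound the points \<open>x > 0\<close> with
  digit \<open>k\<close>, that is, with \<open>1 / x\<close> between \<open>2 * cc * k - cc\<close>
  and \<open>2 * cc * k + cc\<close>. The outermost such interval is truncated at
  \<open>cc\<close>.\<close>

definition Dp :: "nat \<Rightarrow> real set" where "Dp k = {lo k<..min (hi k) cc}"

definition Dm :: "nat \<Rightarrow> real set" where "Dm k = {- min (hi k) cc..<- lo k}"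

definition Ks :: "nat set" where "Ks = {k. 1 \<le> k \<and> lo k < cc}"

lemma lo_hi: assumes "1 \<le> k" shows "0 < lo k" "lo k < hi k" "1 / lo k = 2 * cc * k + cc" "1 / hi k = 2 * cc * k - cc"
proof -
  have "0 < real k - 1 / 2" using assms by simp
  thus "lo k < hi k" unfolding lo_def hi_def using cc
    by (intro divide_strict_left_mono mult_strict_right_mono mult_pos_pos) auto
  show "0 < lo k" using cc by (simp add: lo_def)
  show "1 / lo k = 2 * cc * k + cc" "1 / hi k = 2 * cc * k - cc"
    by (simp_all add: lo_def hi_def algebra_simps)
qed

lemma hi_le_lo: assumes "1 \<le> j" "j < k" shows "hi k \<le> lo j"
proof -
  have "real j + 1 / 2 \<le> real k - 1 / 2" using assms by simp
  thus ?thesis unfolding lo_def hi_def using cc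
    by (intro divide_left_mono mult_right_mono mult_pos_pos) auto
qed

lemma Dp_interior: "interior (Dp k) = {lo k<..<min (hi k) cc}"
  and Dm_interior: "interior (Dm k) = {- min (hi k) cc<..<- lo k}"
  by (simp_all add: Dp_def Dm_def)

lemma Dp_R: assumes "k \<in> Ks" "x \<in> Dp k" shows "R x = \<bar>1 / x\<bar> + - (2 * cc * real k)"
proof -
  have k: "1 \<le> k" using assms(1) by (simp add: Ks_def)
  note l = lo_hi[OF k]
  have x: "lo k < x" "x \<le> hi k" "0 < x" using assms(2) l(1) by (auto simp: Dp_def)
  have "1 / x < 1 / lo k" using x l(1) by (intro divide_strict_left_mono) auto
  moreover have "1 / hi k \<le> 1 / x" using x by (intro divide_left_mono) auto
  ultimately show ?thesis
    using x l by (intro R_eqI[where k = "int k"]) auto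
qed

lemma Dm_minus: "Dm k = uminus ` Dp k"
  by (simp add: Dm_def Dp_def)

lemma Dm_R: assumes "k \<in> Ks" "x \<in> Dm k" shows "R x = \<bar>1 / x\<bar> + - (2 * cc * real k)"
  using Dp_R[of k "- x"] assms by (auto simp: Dm_minus R_minus)

lemma Dp_cover: assumes "0 < x" "x \<le> cc" obtains k where "k \<in> Ks" "x \<in> Dp k"
proof -
  obtain k :: int where k: "\<bar>1 / x\<bar> = R x + 2 * cc * of_int k" using R_digit[of x] assms by auto
  have r: "- cc \<le> R x" "R x < cc" using R_range[of x] by auto
  have "1 < 1 / x" using assms cc by (simp add: field_simps)
  \<comment> \<open>\<open>1 / x > 1 > cc\<close> excludes the digits
    \<open>k \<le> 0\<close>.\<close>
  have k0: "0 < k"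
  proof -
    have "1 / x = R x + 2 * cc * of_int k" using k assms by simp
    moreover have "cc * (2 * of_int k + 1 :: real) = cc + 2 * cc * of_int k" by (simp add: algebra_simps)
    ultimately have gt: "cc * (2 * of_int k + 1 :: real) > 1" using r \<open>1 < 1 / x\<close> by linarith
    show ?thesis
    proof (rule ccontr)
      assume "\<not> 0 < k"
      hence "cc * (2 * of_int k + 1 :: real) \<le> cc * 1" using cc by (intro mult_left_mono) auto
      thus False using gt cc by linarith
    qed
  qed
  define n where "n = nat k"
  have n: "1 \<le> n" "real n = of_int k" using k0 by (auto simp: n_def)
  note l = lo_hi[OF n(1)]
  have e: "1 / x = R x + 2 * cc * real n" using k assms n by simp
  have x1: "lo n < x"
  proof (rule ccontr)
    assume "\<not> lo n < x"
    hence "1 / lo n \<le> 1 / x" using assms by (intro divide_left_mono) (use l in auto)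
    thus False using e l r by simp
  qed
  have x2: "x \<le> hi n"
  proof (rule ccontr)
    assume "\<not> x \<le> hi n"
    hence "1 / x < 1 / hi n" using assms l by (intro divide_strict_left_mono) auto
    thus False using e l r by simp
  qed
  show ?thesis using that[of n] x1 x2 assms n by (auto simp: Ks_def Dp_def)
qed

lemma inverse_image:
  assumes "0 < u" "u < v"
  shows "(\<lambda>x. \<bar>1 / x\<bar> + d) ` {u<..<v} = {1 / v + d<..<1 / u + (d :: real)}"
proof (intro equalityI subsetI)
  fix y assume "y \<in> (\<lambda>x. \<bar>1 / x\<bar> + d) ` {u<..<v}"
  then obtain x where "u < x" "x < v" "y = \<bar>1 / x\<bar> + d" by auto
  thus "y \<in> {1 / v + d<..<1 / u + d}" using assms by (auto simp: divide_strict_left_mono)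
next
  fix y assume y: "y \<in> {1 / v + d<..<1 / u + d}"
  hence "0 < y - d" using assms by (auto simp: less_diff_eq intro: order.strict_trans[rotated])
  moreover have "u < 1 / (y - d)" "1 / (y - d) < v" using y \<open>0 < y - d\<close> assms by (auto simp: field_simps)
  ultimately show "y \<in> (\<lambda>x. \<bar>1 / x\<bar> + d) ` {u<..<v}" by (intro image_eqI[of _ _ "1 / (y - d)"]) auto
qed

lemma mn: assumes "k \<in> Ks" shows "0 < lo k" "lo k < min (hi k) cc" "1 \<le> k"
  using assms lo_hi[of k] by (auto simp: Ks_def)

lemma Dp_image: assumes k: "k \<in> Ks" shows "R ` interior (Dp k) = {1 / min (hi k) cc - 2 * cc * k<..<cc}"
proof -
  have "R ` interior (Dp k) = (\<lambda>x. \<bar>1 / x\<bar> + - (2 * cc * real k)) ` {lo k<..<min (hi k) cc}"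
    unfolding Dp_interior by (intro image_cong refl Dp_R[OF k]) (auto simp: Dp_def)
  also have "\<dots> = {1 / min (hi k) cc + - (2 * cc * k)<..<1 / lo k + - (2 * cc * k)}"
    by (rule inverse_image) (rule mn[OF k])+
  finally show ?thesis using lo_hi(3)[OF mn(3)[OF k]] by simp
qed

lemma Dm_image: "R ` interior (Dm k) = R ` interior (Dp k)"
proof -
  have "interior (Dm k) = uminus ` interior (Dp k)" unfolding Dm_interior Dp_interior by simp
  thus ?thesis by (simp add: R_image_minus)
qed

lemma Dp_image_closure:
  assumes k: "k \<in> Ks"
  shows "(hi k \<le> cc \<and> closure (R ` interior (Dp k)) = {- cc..cc})
    \<or> (cc < hi k \<and> is_interval (R ` interior (Dp k)) \<and> cc \<in> closure (R ` interior (Dp k)))"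
proof -
  have k1: "1 \<le> k" by (rule mn(3)[OF k])
  have "1 / min (hi k) cc < 1 / lo k" using mn[OF k] by (intro divide_strict_left_mono) auto
  hence lt: "1 / min (hi k) cc - 2 * cc * k < cc" using lo_hi(3)[OF k1] by simp
  show ?thesis
  proof (cases "hi k \<le> cc")
    case True
    hence "1 / min (hi k) cc - 2 * cc * k = - cc" using lo_hi(4)[OF k1] by (simp add: min_def)
    thus ?thesis unfolding Dp_image[OF k] using True cc by simp
  next
    case False
    thus ?thesis unfolding Dp_image[OF k] using lt by (simp add: is_interval_oo)
  qed
qed

text \<open>A digit interval has full image unless it is truncated, \<open>cc < hi k\<close>. This
  can happen only for the smallest digit in \<open>Ks\<close>, whose two intervals are therefore the
  rightmost and the leftmost member.\<close>

lemma proper: "proper_iwasawa_map (- rosen_lambda q / 2) (rosen_lambda q / 2) R"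
proof -
  define P where "P = Dp ` Ks \<union> Dm ` Ks"
  have sep: "y < x" if "j \<in> Ks" "k \<in> Ks" "j < k" "x \<in> interior (Dp j)" "y \<in> interior (Dp k)" for x y j k
    using that hi_le_lo[of j k] mn[of j] by (auto simp: Dp_interior)
  have pos: "0 < x" if "k \<in> Ks" "x \<in> interior (Dp k)" for x k
    using that mn[of k] by (auto simp: Dp_interior)
  have neg: "- x \<in> interior (Dp k)" if "x \<in> interior (Dm k)" for x k
    using that by (auto simp: Dp_interior Dm_interior)
  have right: "rightmost P (Dp k)" if k: "k \<in> Ks" "cc < hi k" for k
    unfolding rightmost_def
  proof (intro conjI ballI impI)
    show "Dp k \<in> P" using k by (simp add: P_def)
    fix K x y assume K: "K \<in> P" "K \<noteq> Dp k" and x: "x \<in> interior (Dp k)" and y: "y \<in> interior K"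
    from K consider j where "j \<in> Ks" "K = Dp j" "j \<noteq> k" | j where "j \<in> Ks" "K = Dm j"
      unfolding P_def by blast
    thus "y < x"
    proof cases
      case 1
      have "\<not> j < k" using hi_le_lo[of j k] 1(1) k(2) by (auto simp: Ks_def)
      thus ?thesis using sep[OF k(1) 1(1) _ x] y 1 by simp
    next
      case 2 thus ?thesis using pos[OF k(1) x] pos[OF 2(1) neg[of y]] y by simp
    qed
  qed
  have left: "leftmost P (Dm k)" if k: "k \<in> Ks" "cc < hi k" for k
    unfolding leftmost_def
  proof (intro conjI ballI impI)
    show "Dm k \<in> P" using k by (simp add: P_def)
    fix K x y assume K: "K \<in> P" "K \<noteq> Dm k" and x: "x \<in> interior (Dm k)" and y: "y \<in> interior K"
    from K consider j where "j \<in> Ks" "K = Dm j" "j \<noteq> k" | j where "j \<in> Ks" "K = Dp j"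
      unfolding P_def by blast
    thus "x < y"
    proof cases
      case 1
      have "\<not> j < k" using hi_le_lo[of j k] 1(1) k(2) by (auto simp: Ks_def)
      thus ?thesis using sep[OF k(1) 1(1) _ neg[OF x] neg[of y]] y 1 by simp
    next
      case 2 thus ?thesis using pos[OF k(1) neg[OF x]] pos[OF 2(1)] y by fastforce
    qed
  qed
  have part: "iwasawa_partition (- cc) cc R (\<lambda>x. \<bar>1 / x\<bar>) P"
    unfolding iwasawa_partition_def
  proof (intro conjI ballI impI)
    show "countable P" unfolding P_def by (intro countable_Un countable_image) auto
    show "{- cc..cc} - {0} \<subseteq> \<Union>P"
    proof
      fix x assume x: "x \<in> {- cc..cc} - {0}"
      show "x \<in> \<Union>P"
      proof (cases "0 < x")
        case True
        then obtain k where "k \<in> Ks" "x \<in> Dp k" using Dp_cover[of x] x by auto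
        thus ?thesis by (auto simp: P_def)
      next
        case False
        then obtain k where k: "k \<in> Ks" "- x \<in> Dp k" using Dp_cover[of "- x"] x by auto
        have "x \<in> Dm k" unfolding Dm_minus using k(2) by (intro image_eqI[of _ _ "- x"]) auto
        thus ?thesis using k by (auto simp: P_def)
      qed
    qed
  next
    fix K assume "K \<in> P"
    then obtain k where k: "k \<in> Ks" "K = Dp k \<or> K = Dm k" by (auto simp: P_def)
    have "subinterval (Dp k) (- cc) cc" "subinterval (Dm k) (- cc) cc"
      using mn[OF k(1)] unfolding subinterval_def Dp_interior Dm_interior
      by (auto simp: Dp_def Dm_def is_interval_oc is_interval_co min_less_iff_disj)
    thus "subinterval K (- cc) cc" using k(2) by auto
    have "\<forall>x\<in>interior K. R x = \<bar>1 / x\<bar> + - (2 * cc * real k)"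
      using k(2) Dp_R[OF k(1)] Dm_R[OF k(1)] interior_subset by blast
    thus "\<exists>c. \<forall>x\<in>interior K. R x = \<bar>1 / x\<bar> + c" by blast
    show "closure (R ` interior K) = {- cc..cc} \<or> (leftmost P K \<or> rightmost P K) \<and>
      is_interval (R ` interior K) \<and> (- cc \<in> closure (R ` interior K) \<or> cc \<in> closure (R ` interior K))"
      using Dp_image_closure[OF k(1)] k right left Dm_image by metis
    fix K' assume "K' \<in> P" "K \<noteq> K'"
    then obtain j where j: "j \<in> Ks" "K' = Dp j \<or> K' = Dm j" by (auto simp: P_def)
    show "interior K \<inter> interior K' = {}"
    proof (rule ccontr)
      assume "interior K \<inter> interior K' \<noteq> {}"
      then obtain x where x: "x \<in> interior K" "x \<in> interior K'" by blast
      have pp: "j = k" if "y \<in> interior (Dp k)" "y \<in> interior (Dp j)" for y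
        using sep[of j k y y] sep[of k j y y] that j k by (meson less_irrefl linorder_neqE_nat)
      show False
        using k(2) j(2) pp[of x] pp[of "- x"] pos[OF k(1), of x] pos[OF j(1), of x] pos[OF k(1), of "- x"]
          pos[OF j(1), of "- x"] neg[of x k] neg[of x j] x \<open>K \<noteq> K'\<close> by fastforce
    qed
  qed
  have "R \<in> {- cc..cc} \<rightarrow> {- cc..cc}" using R_range by (auto intro!: less_imp_le) 
  hence "iwasawa_map (- cc) cc R" unfolding iwasawa_map_def using cc part by auto
  thus ?thesis using cc by (simp add: proper_iwasawa_map_def lam)
qed

text \<open>Full images from some time on give an overlap of any two such intervals at a common
  time, and the property passes to supersets and back along \<open>R\<close>. The right endpoint is
  left out because \<open>R\<close> never takes the value \<open>cc\<close>.\<close>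

definition good :: "real set \<Rightarrow> bool" where
  "good J \<longleftrightarrow> (\<exists>N0. \<forall>N\<ge>N0. (R ^^ N) ` J = {- cc..<cc})"

lemma R_pow_range: "0 < N \<Longrightarrow> (R ^^ N) ` J \<subseteq> {- cc..<cc}"
  using R_range by (cases N) auto

lemma good_mono: assumes "good J" "J \<subseteq> J'" shows "good J'"
proof -
  obtain N0 where N0: "\<And>N. N \<ge> N0 \<Longrightarrow> (R ^^ N) ` J = {- cc..<cc}" using assms(1) by (auto simp: good_def)
  have "(R ^^ N) ` J' = {- cc..<cc}" if "N \<ge> max N0 1" for N
  proof (rule antisym)
    show "(R ^^ N) ` J' \<subseteq> {- cc..<cc}" using that by (intro R_pow_range) auto
    show "{- cc..<cc} \<subseteq> (R ^^ N) ` J'" using N0[of N] that image_mono[OF assms(2), of "R ^^ N"] by simp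
  qed
  thus ?thesis unfolding good_def by blast
qed

lemma good_image: assumes "good (R ` J)" shows "good J"
proof -
  obtain N0 where N0: "\<And>N. N \<ge> N0 \<Longrightarrow> (R ^^ N) ` R ` J = {- cc..<cc}" using assms by (auto simp: good_def)
  have "(R ^^ N) ` J = {- cc..<cc}" if N: "N \<ge> Suc N0" for N
  proof -
    obtain M where M: "N = Suc M" "M \<ge> N0" using N by (cases N) auto
    have "(R ^^ N) ` J = (R ^^ M) ` R ` J" by (simp add: M funpow_Suc_right image_comp del: funpow.simps)
    thus ?thesis using N0[OF M(2)] by simp
  qed
  thus ?thesis unfolding good_def by blast
qed

text \<open>The point \<open>1 / (2 * cc * n + y)\<close> has image \<open>y\<close> for every large
  digit \<open>n\<close>.\<close>

lemma R_near_zero: assumes "0 < \<epsilon>" shows "R ` {0<..<\<epsilon>} = {- cc..<cc}"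
proof (intro antisym subsetI)
  fix y assume y: "y \<in> {- cc..<cc}"
  obtain n :: nat where n: "(1 / \<epsilon> + cc) / (2 * cc) < real n" using reals_Archimedean2 by blast
  hence big: "1 / \<epsilon> < 2 * cc * n + y" using y cc by (simp add: field_simps)
  have e: "0 < 1 / \<epsilon>" using assms by simp
  have t0: "0 < 2 * cc * n + y" using big e by linarith
  define x where "x = 1 / (2 * cc * n + y)"
  have x: "0 < x" "x < \<epsilon>"
  proof -
    show "0 < x" using t0 by (simp add: x_def)
    have "1 / (2 * cc * n + y) < 1 / (1 / \<epsilon>)" using big e t0 by (intro divide_strict_left_mono mult_pos_pos) auto
    thus "x < \<epsilon>" by (simp add: x_def)
  qed
  have "R x = y" using x y t0 by (intro R_eqI[where k = "int n"]) (auto simp: x_def)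
  thus "y \<in> R ` {0<..<\<epsilon>}" using x by force
qed (use R_range in auto)

lemma good_zero: assumes "0 < \<epsilon>" shows "good {0<..<\<epsilon>}"
proof -
  have "(R ^^ Suc N) ` {0<..<\<epsilon>} = {- cc..<cc}" for N
  proof (induction N)
    case (Suc N)
    have "(R ^^ Suc (Suc N)) ` {0<..<\<epsilon>} = R ` (R ^^ Suc N) ` {0<..<\<epsilon>}"
      by (simp only: funpow.simps(2)[of "Suc N"] image_comp)
    also have "\<dots> = R ` {- cc..<cc}" unfolding Suc ..
    also have "\<dots> = {- cc..<cc}"
    proof (rule antisym)
      show "R ` {- cc..<cc} \<subseteq> {- cc..<cc}" using R_range by blast
      have "R ` {0<..<cc} \<subseteq> R ` {- cc..<cc}" using cc by (intro image_mono) auto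
      thus "{- cc..<cc} \<subseteq> R ` {- cc..<cc}" using R_near_zero[of cc] cc by simp
    qed
    finally show ?case .
  qed (use R_near_zero[OF assms] in simp)
  hence "\<forall>N\<ge>1. (R ^^ N) ` {0<..<\<epsilon>} = {- cc..<cc}" by (metis One_nat_def Suc_le_D)
  thus ?thesis unfolding good_def by blast
qed

lemma good_uminus: assumes "good (uminus ` J)" shows "good J"
proof -
  obtain N0 where N0: "\<And>N. N \<ge> N0 \<Longrightarrow> (R ^^ N) ` uminus ` J = {- cc..<cc}" using assms by (auto simp: good_def)
  have "(R ^^ N) ` R ` J = {- cc..<cc}" if "N \<ge> N0" for N
  proof -
    have "(R ^^ Suc N) ` uminus ` J = (R ^^ N) ` R ` uminus ` J"
      by (simp only: funpow_Suc_right image_comp o_assoc)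
    hence "(R ^^ N) ` R ` J = (R ^^ Suc N) ` uminus ` J" unfolding R_image_minus ..
    thus ?thesis using N0[of "Suc N"] that by simp
  qed
  hence "good (R ` J)" unfolding good_def by blast
  thus ?thesis by (rule good_image)
qed

section \<open>One-sided neighbourhoods and the orbit of the left endpoint\<close>

definition RN :: "real \<Rightarrow> bool" where
  "RN x \<longleftrightarrow> (\<forall>\<epsilon>>0. x + \<epsilon> \<le> cc \<longrightarrow> good {x<..<x + \<epsilon>})"

lemma RN_zero: "RN 0"
  using good_zero by (simp add: RN_def)

text \<open>On the negative side \<open>- 1 / x\<close> increases, and \<open>R x < cc\<close>
  leaves room on the right; so the points just to the right of \<open>x\<close> cover a right
  neighbourhood of \<open>R x\<close>.\<close>

lemma RN_step: assumes x: "x < 0" and RN: "RN (R x)" shows "RN x"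
  unfolding RN_def
proof (intro allI impI)
  fix \<epsilon> :: real assume e: "0 < \<epsilon>" "x + \<epsilon> \<le> cc"
  obtain k :: int where k: "\<bar>1 / x\<bar> = R x + 2 * cc * of_int k" using R_digit[of x] x by auto
  have r: "- cc \<le> R x" "R x < cc" using R_range[of x] by auto
  define \<delta> where "\<delta> = min \<epsilon> (- x / 2)"
  have d: "0 < \<delta>" "\<delta> \<le> \<epsilon>" "x + \<delta> < 0" using e x by (auto simp: \<delta>_def min_def)
  define \<eta> where "\<eta> = min (cc - R x) (- 1 / (x + \<delta>) + 1 / x)"
  have "1 / (x + \<delta>) < 1 / x" using d x by (intro divide_strict_left_mono mult_neg_neg) auto
  hence eta: "0 < \<eta>" "R x + \<eta> \<le> cc" using r by (auto simp: \<eta>_def)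
  hence g: "good {R x<..<R x + \<eta>}" using RN by (simp add: RN_def)
  have "{R x<..<R x + \<eta>} \<subseteq> R ` {x<..<x + \<epsilon>}"
  proof
    fix z assume z: "z \<in> {R x<..<R x + \<eta>}"
    define t where "t = z + 2 * cc * of_int k"
    have t: "- 1 / x < t" "t < - 1 / (x + \<delta>)" using z k x by (auto simp: t_def \<eta>_def)
    have pos: "0 < - 1 / x" using x by (simp add: divide_neg_neg)
    hence t0: "0 < t" using t(1) by linarith
    define y where "y = - 1 / t"
    have y: "x < y" "y < x + \<delta>" using t t0 x d(3) by (auto simp: y_def field_simps)
    have "R y = z"
      using z r t0 eta by (intro R_eqI[where k = k]) (auto simp: y_def t_def)
    thus "z \<in> R ` {x<..<x + \<epsilon>}" using y d(2) by force
  qed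
  thus "good {x<..<x + \<epsilon>}" by (rule good_image[OF good_mono[OF g]])
qed

text \<open>On the orbit of \<open>- cc\<close> the map acts as a rotation by the angle \<open>\<alpha>\<close> in projective coordinates.\<close>

definition X :: "real \<Rightarrow> real" where "X m = - (sin (m * \<alpha>) / sin ((m + 1) * \<alpha>))"

lemma X_sin:
  assumes "0 \<le> m" "(m + 1) * \<alpha> \<le> pi / 2"
  shows "0 \<le> sin (m * \<alpha>)" "0 < sin ((m + 1) * \<alpha>)" "sin (m * \<alpha>) \<le> cc * sin ((m + 1) * \<alpha>)"
proof -
  have m: "0 \<le> m * \<alpha>" "m * \<alpha> \<le> (m + 1) * \<alpha>" using assms \<alpha> by (auto simp: algebra_simps)
  have "0 < (m + 1) * \<alpha>" using assms(1) \<alpha> by (intro mult_pos_pos) auto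
  note m = m this
  show "0 \<le> sin (m * \<alpha>)" by (rule sin_ge_zero) (use m assms pi_gt_zero in linarith)+
  show "0 < sin ((m + 1) * \<alpha>)" by (rule sin_gt_zero) (use m assms pi_gt_zero in linarith)+
  have "sin (m * \<alpha>) = sin ((m + 1) * \<alpha> - \<alpha>)" by (simp add: algebra_simps)
  also have "\<dots> = sin ((m + 1) * \<alpha>) * cc - cos ((m + 1) * \<alpha>) * sin \<alpha>" by (simp only: sin_diff cc_def)
  also have "\<dots> \<le> sin ((m + 1) * \<alpha>) * cc"
  proof -
    have "0 \<le> cos ((m + 1) * \<alpha>)" by (rule cos_ge_zero) (use m assms pi_gt_zero in linarith)+
    moreover have "0 \<le> sin \<alpha>" by (rule sin_ge_zero) (use \<alpha> pi_gt_zero in linarith)+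
    ultimately show ?thesis by simp
  qed
  finally show "sin (m * \<alpha>) \<le> cc * sin ((m + 1) * \<alpha>)" by (simp add: mult.commute)
qed

lemma X_range:
  assumes "0 \<le> m" "(m + 1) * \<alpha> \<le> pi / 2" shows "- cc \<le> X m" "X m \<le> 0"
  using X_sin[OF assms] by (auto simp: X_def divide_le_eq)

lemma X_neg:
  assumes "0 < m" "(m + 1) * \<alpha> \<le> pi / 2" shows "0 < sin (m * \<alpha>)" "X m < 0"
proof -
  have m: "0 < m * \<alpha>" "m * \<alpha> \<le> (m + 1) * \<alpha>" using assms \<alpha> by (auto simp: algebra_simps)
  show "0 < sin (m * \<alpha>)" by (rule sin_gt_zero) (use m assms pi_gt_zero in linarith)+
  thus "X m < 0" using X_sin(2)[of m] assms by (simp add: X_def)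
qed

text \<open>By the addition theorem, the sines of \<open>(m + 1) * \<alpha>\<close> and
  \<open>(m - 1) * \<alpha>\<close> add up to \<open>2 * cc\<close> times the sine of
  \<open>m * \<alpha>\<close>. So \<open>X m\<close> has digit 1, and the index drops by 1.\<close>

lemma R_X:
  assumes "1 \<le> m" "(m + 1) * \<alpha> \<le> pi / 2" shows "R (X m) = X (m - 1)"
proof (rule R_eqI[where k = 1])
  note s = X_neg[of m] X_sin(2)[of m]
  have s': "0 < sin (m * \<alpha>)" "0 < sin ((m + 1) * \<alpha>)" using s assms by auto
  show "X m \<noteq> 0" using s assms by auto
  have "sin ((m + 1) * \<alpha>) + sin ((m - 1) * \<alpha>) = 2 * cc * sin (m * \<alpha>)"
    by (simp add: distrib_right left_diff_distrib sin_add sin_diff cc_def)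
  hence "sin ((m + 1) * \<alpha>) / sin (m * \<alpha>) = - (sin ((m - 1) * \<alpha>) / sin (m * \<alpha>)) + 2 * cc"
    using s'(1) by (simp add: field_simps)
  moreover have "\<bar>1 / X m\<bar> = sin ((m + 1) * \<alpha>) / sin (m * \<alpha>)" using s' by (simp add: X_def)
  ultimately show "\<bar>1 / X m\<bar> = X (m - 1) + 2 * cc * of_int 1" by (simp add: X_def)
  have "(m - 1 + 1) * \<alpha> \<le> pi / 2" using assms \<alpha> by (simp add: algebra_simps)
  from X_range[OF _ this] assms(1) show "- cc \<le> X (m - 1)" "X (m - 1) < cc" using cc by auto
qed

lemma RN_X:
  assumes "RN (X d)" "0 \<le> d" shows "(real n + d + 1) * \<alpha> \<le> pi / 2 \<Longrightarrow> RN (X (real n + d))"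
proof (induction n)
  case (Suc n)
  have "(real n + d + 1) * \<alpha> \<le> (real (Suc n) + d + 1) * \<alpha>" using \<alpha> by (intro mult_right_mono) auto
  hence "RN (X (real n + d))" using Suc by simp
  moreover have "R (X (real (Suc n) + d)) = X (real n + d)"
    using R_X[of "real (Suc n) + d"] Suc.prems assms(2) by (simp add: algebra_simps)
  moreover have "X (real (Suc n) + d) < 0" using X_neg(2)[of "real (Suc n) + d"] Suc.prems assms(2) by simp
  ultimately show ?case using RN_step[of "X (real (Suc n) + d)"] by simp
qed (use assms in simp)

lemma X_zero: "X 0 = 0" by (simp add: X_def)

text \<open>The condition means \<open>m + 1 = q / 2\<close>; so the left endpoint has an integer
  index for even \<open>q\<close> and a half-integer index for odd \<open>q\<close>.\<close>

lemma X_end: assumes "(m + 1) * \<alpha> = pi / 2" shows "X m = - cc"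
proof -
  have "m * \<alpha> + \<alpha> = pi / 2" using assms by (simp only: distrib_right mult_1)
  hence "m * \<alpha> = pi / 2 - \<alpha>" by linarith
  hence "sin (m * \<alpha>) = sin (pi / 2 - \<alpha>)" by simp
  thus ?thesis by (simp add: X_def assms cc_def cos_sin_eq)
qed

text \<open>For even \<open>q\<close> the integer indices descend from \<open>- cc\<close> to
  \<open>X 0 = 0\<close>. For odd \<open>q\<close> the half-integer indices descend to
  \<open>X (1 / 2)\<close>; there the digit is 2 and the image is \<open>1 - 2 * cc = X n\<close>
  with \<open>n = (q - 3) / 2\<close>, from where the integer indices lead to 0.\<close>

lemma RN_left: "RN (- cc)"
proof (cases "even q")
  case True
  then obtain n where n: "q = 2 * Suc n" using q by (metis evenE not0_implies_Suc mult_0_right not_numeral_le_zero)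
  have "real q = 2 * (real n + 1)" by (simp add: n)
  hence e: "(real n + 1) * \<alpha> = pi / 2" by (simp add: \<alpha>_def field_simps)
  have "RN (X (real n + 0))" by (rule RN_X) (use RN_zero e in \<open>simp_all add: X_zero\<close>)
  thus ?thesis using X_end[OF e] by simp
next
  case False
  then obtain n where "q = 2 * n + 1" by (rule oddE)
  then obtain n where n: "q = 2 * n + 3" using q by (cases n) auto
  have "real q = 2 * (real n + 1 / 2 + 1)" by (simp add: n)
  hence e: "(real n + 1 / 2 + 1) * \<alpha> = pi / 2" by (simp add: \<alpha>_def field_simps)
  have half: "(real n + 1) * \<alpha> = pi / 2 - \<alpha> / 2" "real n * \<alpha> = pi / 2 - 3 * (\<alpha> / 2)" using e by (simp_all add: algebra_simps)
  have cos2: "cc = 2 * (cos (\<alpha> / 2))\<^sup>2 - 1" using cos_double_cos[of "\<alpha> / 2"] by (simp add: cc_def)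
  have s2: "0 < sin (\<alpha> / 2)" by (rule sin_gt_zero) (use \<alpha> pi_gt_zero in linarith)+
  have c2: "0 < cos (\<alpha> / 2)" by (rule cos_gt_zero) (use \<alpha> pi_gt_zero in linarith)+
  have 3: "3 * (\<alpha> / 2) = \<alpha> / 2 + \<alpha>" by simp
  have sin3: "sin (3 * (\<alpha> / 2)) = sin (\<alpha> / 2) * (1 + 2 * cc)"
  proof -
    have "sin (3 * (\<alpha> / 2)) = sin (\<alpha> / 2) * cc + cos (\<alpha> / 2) * sin (2 * (\<alpha> / 2))"
      unfolding 3 sin_add cc_def by simp
    also have "\<dots> = sin (\<alpha> / 2) * (cc + 2 * (cos (\<alpha> / 2))\<^sup>2)"
      unfolding sin_double by (simp add: algebra_simps power2_eq_square)
    also have "cc + 2 * (cos (\<alpha> / 2))\<^sup>2 = 1 + 2 * cc" using cos2 by linarith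
    finally show ?thesis .
  qed
  have cos3: "cos (3 * (\<alpha> / 2)) = cos (\<alpha> / 2) * (2 * cc - 1)"
  proof -
    have "cos (3 * (\<alpha> / 2)) = cos (\<alpha> / 2) * cc - sin (\<alpha> / 2) * sin (2 * (\<alpha> / 2))"
      unfolding 3 cos_add cc_def by simp
    also have "\<dots> = cos (\<alpha> / 2) * (cc - 2 * (sin (\<alpha> / 2))\<^sup>2)"
      unfolding sin_double by (simp add: algebra_simps power2_eq_square)
    also have "cc - 2 * (sin (\<alpha> / 2))\<^sup>2 = 2 * cc - 1" using cos2 sin_squared_eq[of "\<alpha> / 2"] by linarith
    finally show ?thesis .
  qed
  have Xn: "X (real n) = 1 - 2 * cc"
  proof -
    have "X (real n) = - (cos (3 * (\<alpha> / 2)) / cos (\<alpha> / 2))" unfolding X_def half by (simp add: sin_diff)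
    thus ?thesis unfolding cos3 using c2 by simp
  qed
  have "RN (X (real n + 0))"
    by (rule RN_X) (use RN_zero half \<alpha> in \<open>simp_all add: X_zero\<close>)
  moreover have "R (X (1 / 2)) = X (real n)"
    unfolding Xn
  proof (rule R_eqI[where k = 2])
    have X: "X (1 / 2) = - (1 / (1 + 2 * cc))" 
      using s2 sin3 by (simp add: X_def mult.commute[of \<alpha>])
    show "X (1 / 2) \<noteq> 0" "\<bar>1 / X (1 / 2)\<bar> = 1 - 2 * cc + 2 * cc * of_int 2" unfolding X using cc by auto
  qed (use cc in auto)
  moreover have "X (1 / 2) < 0"
    by (rule X_neg) (use \<alpha> in auto)
  ultimately have "RN (X (1 / 2))" using RN_step[of "X (1 / 2)"] by simp
  hence "RN (X (real n + 1 / 2))" by (rule RN_X) (use e in auto)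
  thus ?thesis using X_end[OF e] by simp
qed

text \<open>At an interior point where the digit changes, the image would contain a right
  neighbourhood of \<open>- cc\<close>, which is good by \<open>RN_left\<close>. So an interval that
  is not good lies in one branch, where the derivative is at least \<open>1 / cc\<^sup>2\<close> in
  absolute value, and its image is not good either.\<close>

lemma expand_pos:
  assumes uv: "0 < u" "u < v" "v \<le> cc" and bad: "\<not> good {u<..<v}"
  shows "\<exists>u' v'. - cc \<le> u' \<and> u' < v' \<and> v' \<le> cc \<and> (v - u) / cc\<^sup>2 \<le> v' - u' \<and> \<not> good {u'<..<v'}"
proof -
  \<comment> \<open>At \<open>p\<close> the digits \<open>k\<close> and \<open>k + 1\<close> meet:
    points slightly to the left have digit \<open>k + 1\<close> and values slightly above
    \<open>- cc\<close>.\<close>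
  have nobreak: "1 / p \<noteq> 2 * cc * of_int k + cc" if p: "u < p" "p < v" for p and k :: int
  proof
    assume eq: "1 / p = 2 * cc * of_int k + cc"
    define \<eta> where "\<eta> = min (1 / u - 1 / p) (2 * cc)"
    have "1 / p < 1 / u" using p uv by (intro divide_strict_left_mono) auto
    hence eta: "0 < \<eta>" "- cc + \<eta> \<le> cc" using cc by (auto simp: \<eta>_def)
    have g: "good {- cc<..<- cc + \<eta>}" using RN_left eta by (simp add: RN_def)
    have "{- cc<..<- cc + \<eta>} \<subseteq> R ` {u<..<v}"
    proof
      fix z assume z: "z \<in> {- cc<..<- cc + \<eta>}"
      define t where "t = z + 2 * cc * of_int (k + 1)"
      have t: "1 / p < t" "t < 1 / u" using z eq by (auto simp: t_def \<eta>_def algebra_simps)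
      have "0 < 1 / p" using p uv by simp
      hence t0: "0 < t" using t(1) by linarith
      have y: "u < 1 / t" "1 / t < p" using t t0 p uv by (auto simp: field_simps)
      have "R (1 / t) = z"
        using z t0 eta by (intro R_eqI[where k = "k + 1"]) (auto simp: t_def)
      thus "z \<in> R ` {u<..<v}" using y p by force
    qed
    hence "good {u<..<v}" by (rule good_image[OF good_mono[OF g]])
    thus False using bad by blast
  qed
  \<comment> \<open>The digit \<open>k\<close> is read off at the midpoint; another digit elsewhere
    in the interval would force an excluded change point.\<close>
  define w where "w = (u + v) / 2"
  have w: "u < w" "w < v" "0 < w" using uv by (auto simp: w_def)
  obtain k :: int where k: "\<bar>1 / w\<bar> = R w + 2 * cc * of_int k" using R_digit[of w] w by auto
  have r: "- cc \<le> R w" "R w < cc" using R_range[of w] by auto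
  have wk: "2 * cc * of_int k - cc \<le> 1 / w" "1 / w < 2 * cc * of_int k + cc" using k r w by auto
  have digit: "2 * cc * of_int k - cc \<le> 1 / x \<and> 1 / x < 2 * cc * of_int k + cc" if x: "u < x" "x < v" for x
  proof (rule ccontr)
    assume "\<not> ?thesis"
    then consider "1 / x < 2 * cc * of_int k - cc" | "2 * cc * of_int k + cc \<le> 1 / x" by linarith
    thus False
    proof cases
      case 1
      define p where "p = 1 / (2 * cc * of_int k - cc)"
      have "0 < 1 / x" using x uv by simp
      hence p0: "0 < 2 * cc * of_int k - cc" using 1 by linarith
      have "w \<le> p" "p < x" using p0 1 wk w x uv by (auto simp: p_def field_simps)
      moreover have "1 / p = 2 * cc * of_int (k - 1) + cc" by (simp add: p_def algebra_simps)
      ultimately show False using nobreak[of p "k - 1"] w x by simp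
    next
      case 2
      define p where "p = 1 / (2 * cc * of_int k + cc)"
      have "0 < 1 / w" using w by simp
      hence p0: "0 < 2 * cc * of_int k + cc" using wk by linarith
      have "x \<le> p" "p < w" using p0 2 wk w x uv by (auto simp: p_def field_simps)
      moreover have "1 / p = 2 * cc * of_int k + cc" by (simp add: p_def)
      ultimately show False using nobreak[of p k] w x by simp
    qed
  qed
  define u' v' where "u' = 1 / v - 2 * cc * of_int k" and "v' = 1 / u - 2 * cc * of_int k"
  have lt: "1 / v < 1 / u" using uv by (intro divide_strict_left_mono) auto
  have sub: "{u'<..<v'} \<subseteq> R ` {u<..<v}"
  proof
    fix z assume z: "z \<in> {u'<..<v'}"
    define t where "t = z + 2 * cc * of_int k"
    have t: "1 / v < t" "t < 1 / u" using z by (auto simp: t_def u'_def v'_def)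
    have "0 < 1 / v" using uv by simp
    hence t0: "0 < t" using t(1) by linarith
    have y: "u < 1 / t" "1 / t < v" using t t0 uv by (auto simp: field_simps)
    have "R (1 / t) = z"
      using digit[OF y] t0 by (intro R_eqI[where k = k]) (auto simp: t_def)
    thus "z \<in> R ` {u<..<v}" using y by force
  qed
  have "{u'<..<v'} \<subseteq> {- cc..<cc}" using sub R_range by blast
  moreover have "u' < v'" using lt by (simp add: u'_def v'_def)
  ultimately have "- cc \<le> u'" "v' \<le> cc"
    by (simp_all add: greaterThanLessThan_subseteq_atLeastLessThan_iff)
  moreover have "(v - u) / cc\<^sup>2 \<le> v' - u'"
  proof -
    have "u * v \<le> cc\<^sup>2" unfolding power2_eq_square using uv by (intro mult_mono) auto
    hence "(v - u) / cc\<^sup>2 \<le> (v - u) / (u * v)" using uv by (intro divide_left_mono) auto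
    also have "\<dots> = v' - u'" using uv by (simp add: u'_def v'_def field_simps)
    finally show ?thesis .
  qed
  moreover have "\<not> good {u'<..<v'}" using bad good_image good_mono[OF _ sub] by blast
  ultimately show ?thesis using \<open>u' < v'\<close> by blast
qed

text \<open>An interval that contains 0 or has it as an endpoint is good by
  \<open>good_zero\<close>, and a negative one is reflected.\<close>

lemma expand:
  assumes uv: "- cc \<le> u" "u < v" "v \<le> cc" and bad: "\<not> good {u<..<v}"
  shows "\<exists>u' v'. - cc \<le> u' \<and> u' < v' \<and> v' \<le> cc \<and> (v - u) / cc\<^sup>2 \<le> v' - u' \<and> \<not> good {u'<..<v'}"
proof -
  consider "0 < u" | "u \<le> 0" "0 < v" | "v = 0" | "v < 0" by linarith
  thus ?thesis
  proof cases
    case 1 thus ?thesis using expand_pos[OF _ uv(2,3) bad] by blast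
  next
    case 2
    have "good {u<..<v}" by (rule good_mono[OF good_zero[OF 2(2)]]) (use 2 in auto)
    thus ?thesis using bad by blast
  next
    case 3
    have "good (uminus ` {u<..<v})" using good_zero[of "- u"] uv 3 by simp
    thus ?thesis using bad good_uminus by blast
  next
    case 4
    have "\<not> good {- v<..<- u}" using bad good_uminus[of "{u<..<v}"] by auto
    from expand_pos[OF _ _ _ this] uv 4 show ?thesis by simp
  qed
qed

text \<open>An interval that is not good would yield further ones inside \<open>{- cc..cc}\<close>
  whose lengths grow at least by the factor \<open>1 / cc\<^sup>2 > 1\<close> at each step.\<close>

lemma good_interval:
  assumes "- cc \<le> u" "u < v" "v \<le> cc" shows "good {u<..<v}"
proof (rule ccontr)
  assume bad: "\<not> good {u<..<v}"
  have grow: "\<exists>u' v'. - cc \<le> u' \<and> u' < v' \<and> v' \<le> cc \<and> (v - u) * (1 / cc\<^sup>2) ^ n \<le> v' - u' \<and> \<not> good {u'<..<v'}" for n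
  proof (induction n)
    case 0 show ?case using assms bad by (intro exI[of _ u] exI[of _ v]) simp
  next
    case (Suc n)
    then obtain u' v' where 1: "- cc \<le> u'" "u' < v'" "v' \<le> cc" "(v - u) * (1 / cc\<^sup>2) ^ n \<le> v' - u'" "\<not> good {u'<..<v'}" by blast
    obtain u'' v'' where 2: "- cc \<le> u''" "u'' < v''" "v'' \<le> cc" "(v' - u') / cc\<^sup>2 \<le> v'' - u''" "\<not> good {u''<..<v''}"
      using expand[OF 1(1-3,5)] by blast
    have "(v - u) * (1 / cc\<^sup>2) ^ Suc n = ((v - u) * (1 / cc\<^sup>2) ^ n) / cc\<^sup>2" by simp
    also have "\<dots> \<le> (v' - u') / cc\<^sup>2" by (intro divide_right_mono 1) auto
    finally show ?case using 2 by (intro exI[of _ u''] exI[of _ v'']) auto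
  qed
  have "cc * cc < 1 * 1" using cc by (intro mult_strict_mono) auto
  hence "1 < 1 / cc\<^sup>2" using cc by (simp add: power2_eq_square less_divide_eq)
  then obtain n where "2 * cc / (v - u) < (1 / cc\<^sup>2) ^ n" using real_arch_pow by blast
  hence "2 * cc < (v - u) * (1 / cc\<^sup>2) ^ n" using assms by (simp add: divide_less_eq mult.commute)
  moreover obtain u' v' where "- cc \<le> u'" "v' \<le> cc" "(v - u) * (1 / cc\<^sup>2) ^ n \<le> v' - u'" using grow[of n] by blast
  ultimately show False by linarith
qed

lemma star: "condition_star (- rosen_lambda q / 2) (rosen_lambda q / 2) R"
proof -
  have sub: "good J" if J: "subinterval J (- cc) cc" for J
  proof -
    obtain x where "x \<in> interior J" using J by (auto simp: subinterval_def)
    then obtain d where d: "0 < d" "ball x d \<subseteq> interior J" using open_contains_ball[of "interior J"] by auto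
    have ball: "ball x d = {x - d<..<x + d}" by (auto simp: ball_def dist_real_def)
    have s: "{x - d<..<x + d} \<subseteq> J" using d interior_subset[of J] ball by blast
    hence "{x - d<..<x + d} \<subseteq> {- cc..cc}" using J unfolding subinterval_def by blast
    hence "- cc \<le> x - d" "x + d \<le> cc" using d(1) by (simp_all add: greaterThanLessThan_subseteq_atLeastAtMost_iff)
    hence "good {x - d<..<x + d}" using d(1) by (intro good_interval) auto
    thus ?thesis using s by (rule good_mono)
  qed
  have "condition_star (- cc) cc R"
    unfolding condition_star_def
  proof (intro allI impI)
    fix J K assume "subinterval J (- cc) cc \<and> subinterval K (- cc) cc"
    hence "good J" "good K" using sub by auto
    then obtain M N where "\<And>n. n \<ge> M \<Longrightarrow> (R ^^ n) ` J = {- cc..<cc}" "\<And>n. n \<ge> N \<Longrightarrow> (R ^^ n) ` K = {- cc..<cc}"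
      unfolding good_def by blast
    hence "(R ^^ max M N) ` J \<inter> (R ^^ max M N) ` K = {- cc..<cc}" by simp
    moreover have "0 < emeasure lebesgue {- cc..<cc}" using cc by simp
    ultimately show "\<exists>N. 0 < emeasure lebesgue ((R ^^ N) ` J \<inter> (R ^^ N) ` K)" by metis
  qed
  thus ?thesis by (simp add: lam)
qed

end

theorem theorem4:
  shows "(\<forall>(a::real) (b::real) (T::real \<Rightarrow> real) (f1::real \<Rightarrow> real) (\<mu>::real measure) (f::real \<Rightarrow> real).
            proper_iwasawa_map a b T \<and> condition_star a b T \<and>
            bv_invariant_density a b T f1 \<and> \<mu> = density (lebesgue_on {a..b}) f1 \<and>
            f \<in> BV a b \<and> \<not> condition_H \<mu> T f \<longrightarrow>
            (\<exists>\<sigma>::real. \<sigma> > 0 \<and> (\<forall>v::real.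
               (\<lambda>N::nat. measure \<mu> {x \<in> space \<mu>.
                  (birkhoff_sum T f N x - real N * (LINT y|\<mu>. f y)) / (\<sigma> * sqrt (real N)) \<le> v})
               \<longlonglongrightarrow> 1 / sqrt (2 * pi) * (LBINT t:{..v}. exp (- (t\<^sup>2 / 2))))))
       \<and> (\<forall>q::nat. q \<ge> 3 \<longrightarrow>
            proper_iwasawa_map (- rosen_lambda q / 2) (rosen_lambda q / 2) (rosen_map q) \<and>
            condition_star (- rosen_lambda q / 2) (rosen_lambda q / 2) (rosen_map q))"
proof (intro conjI allI impI)
  fix a b :: real and T f1 :: "real \<Rightarrow> real" and \<mu> :: "real measure" and f :: "real \<Rightarrow> real"
  assume "proper_iwasawa_map a b T \<and> condition_star a b T \<and> bv_invariant_density a b T f1 \<and>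
    \<mu> = density (lebesgue_on {a..b}) f1 \<and> f \<in> BV a b \<and> \<not> condition_H \<mu> T f"
  thus "\<exists>\<sigma>::real. \<sigma> > 0 \<and> (\<forall>v::real.
      (\<lambda>N::nat. measure \<mu> {x \<in> space \<mu>.
        (birkhoff_sum T f N x - real N * (LINT y|\<mu>. f y)) / (\<sigma> * sqrt (real N)) \<le> v})
      \<longlonglongrightarrow> 1 / sqrt (2 * pi) * (LBINT t:{..v}. exp (- (t\<^sup>2 / 2))))"
    unfolding cdf_std_normal[symmetric] by (intro iwasawa_central_limit) auto
next
  fix q :: nat assume "3 \<le> q"
  then interpret rosen q by unfold_locales
  show "proper_iwasawa_map (- rosen_lambda q / 2) (rosen_lambda q / 2) (rosen_map q)" by (rule proper)
  show "condition_star (- rosen_lambda q / 2) (rosen_lambda q / 2) (rosen_map q)" by (rule star)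
qed

end
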